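(* Let $\Gamma\subset\mathbb{R}^n$ be an $h$-set, put $h_j=h(2^{-j})$, $j\in\mathbb{N}_0$, and assume that $\limsup_{j\to\infty}\log_2\frac{h_{j+1}}{h_j}<0$. Let $\sigma=(\sigma_j)_{j\in\mathbb{N}_0}$ be an admissible sequence and, for given $p$, let $\rho_j=\sigma_j\,h_j^{1/p}\,2^{jn/p}$, $j\in\mathbb{N}_0$. (i) Let $0<p\le r<\infty$ and $0<q\le\min(r,1)$. Then $\mathrm{tr}_\Gamma:B^{\rho}_{p,q}(\mathbb{R}^n)\to L_r(\Gamma)$ exists and is bounded if, and only if, $$\left(\sigma_j^{-1}\,h_j^{\frac1r-\frac1p}\right)_{j\in\mathbb{N}_0}\in\ell_\infty.$$ (ii) Let $0<q<\infty$ and $0<p\le r\le\min(q,1)$, and let $v_r\in(0,\infty]$ be given by $\frac{1}{v_r}=\frac1r-\frac1q$. Then $\mathrm{tr}_\Gamma:B^{\rho}_{p,q}(\mathbb{R}^n)\to L_r(\Gamma)$ exists and is bounded if, and only if, $$\left(\sigma_j^{-1}\,h_j^{\frac1r-\frac1p}\right)_{j\in\mathbb{N}_0}\in\ell_{v_r}.$$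
   Context: $h$-sets. Let $\mathbb{H}$ be the class of all positive, continuous, non-decreasing functions $h:(0,1]\to\mathbb{R}$ with $\lim_{r\to0}h(r)=0$. For $h\in\mathbb{H}$, a non-empty compact set $\Gamma\subset\mathbb{R}^n$ is an $h$-set if there is a finite Radon measure $\mu$ on $\mathbb{R}^n$ with $\operatorname{supp}\mu=\Gamma$ and constants $c_1,c_2>0$ with $c_1h(r)\le\mu(B(\gamma,r))\le c_2h(r)$ for all $r\in(0,1]$, $\gamma\in\Gamma$, where $B(x,r)$ is the closed ball. All such measures $\mu$ are mutually equivalent (with two-sided constant bounds); fix one and put $L_r(\Gamma)=L_r(\Gamma,\mu)$. The sequence $(h(2^{-j}))_j$ is admissible in the sense below. A sequence $\sigma=(\sigma_j)_{j\in\mathbb{N}_0}$ of positive numbers is admissible if there are $d_0,d_1>0$ with $d_0\sigma_j\le\sigma_{j+1}\le d_1\sigma_j$ for all $j$. Besov spaces of generalised smoothness. Let $\varphi_0\in\mathcal{S}(\mathbb{R}^n)$ with $\varphi_0=1$ on $\{|x|\le1\}$, $\operatorname{supp}\varphi_0\subset\{|x|\le2\}$, and $\varphi_j(x)=\varphi_0(2^{-j}x)-\varphi_0(2^{-j+1}x)$ for $j\in\mathbb{N}$. For an admissible sequence $\rho$ and $0<p,q<\infty$, $B^{\rho}_{p,q}(\mathbb{R}^n)$ is the space of $f\in\mathcal{S}'(\mathbb{R}^n)$ with $\|f|B^{\rho}_{p,q}(\mathbb{R}^n)\|=\big(\sum_{j=0}^\infty\rho_j^q\|\mathcal{F}^{-1}(\varphi_j\mathcal{F}f)|L_p(\mathbb{R}^n)\|^q\big)^{1/q}<\infty$.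 It is a quasi-Banach space in which $\mathcal{S}(\mathbb{R}^n)$ is dense. Traces. "$\mathrm{tr}_\Gamma:B^{\rho}_{p,q}(\mathbb{R}^n)\to L_r(\Gamma)$ exists and is bounded" means that there is $c>0$ with $\|\varphi|_\Gamma\,|L_r(\Gamma)\|\le c\,\|\varphi|B^{\rho}_{p,q}(\mathbb{R}^n)\|$ for all $\varphi\in\mathcal{S}(\mathbb{R}^n)$ ($\varphi|_\Gamma$ the pointwise restriction); then $\mathrm{tr}_\Gamma$ is the unique continuous linear extension of $\varphi\mapsto\varphi|_\Gamma$ from $\mathcal{S}(\mathbb{R}^n)$ to $B^{\rho}_{p,q}(\mathbb{R}^n)$. *)

theory Defs
  imports "HOL-Analysis.Analysis"
begin

section \<open>Schwartz functions\<close>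

fun iter_partial :: "'a::euclidean_space list \<Rightarrow> ('a \<Rightarrow> complex) \<Rightarrow> 'a \<Rightarrow> complex" where
  "iter_partial [] f = f"
| "iter_partial (b # bs) f = (\<lambda>x. frechet_derivative (iter_partial bs f) (at x) b)"

(* The lists over Basis play the role of multi-indices. Differentiability of all iterated
   partial derivatives is smoothness, and makes frechet_derivative meaningful above. *)
definition schwartz :: "('a::euclidean_space \<Rightarrow> complex) set" where
  "schwartz = {f. \<forall>bs. set bs \<subseteq> Basis \<longrightarrow>
      (\<forall>x. iter_partial bs f differentiable (at x)) \<and>
      (\<forall>N::nat. bounded (range (\<lambda>x. (1 + norm x) ^ N *\<^sub>R iter_partial bs f x)))}"

definition schwartz_seminorm :: "nat \<Rightarrow> ('a::euclidean_space \<Rightarrow> complex) \<Rightarrow> real" where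
  "schwartz_seminorm N f =
     (SUP (bs, x) \<in> {bs. set bs \<subseteq> Basis \<and> length bs \<le> N} \<times> UNIV.
        (1 + norm x) ^ N * norm (iter_partial bs f x))"

definition fourier :: "('a::euclidean_space \<Rightarrow> complex) \<Rightarrow> 'a \<Rightarrow> complex" where
  "fourier f \<xi> = complex_of_real ((2 * pi) powr (- real DIM('a) / 2)) *
     (\<integral>x. exp (- \<i> * complex_of_real (x \<bullet> \<xi>)) * f x \<partial>lborel)"

definition inv_fourier :: "('a::euclidean_space \<Rightarrow> complex) \<Rightarrow> 'a \<Rightarrow> complex" where
  "inv_fourier f x = complex_of_real ((2 * pi) powr (- real DIM('a) / 2)) *
     (\<integral>\<xi>. exp (\<i> * complex_of_real (x \<bullet> \<xi>)) * f \<xi> \<partial>lborel)"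


section \<open>Tempered distributions\<close>

(* A distribution is given by a functional on all functions, of which only the values on
   schwartz matter: two functionals that agree there are the same distribution. *)
type_synonym 'a distr = "('a \<Rightarrow> complex) \<Rightarrow> complex"

definition tempered :: "'a::euclidean_space distr \<Rightarrow> bool" where
  "tempered T \<longleftrightarrow>
     (\<forall>\<phi>\<in>schwartz. \<forall>\<psi>\<in>schwartz. T (\<lambda>x. \<phi> x + \<psi> x) = T \<phi> + T \<psi>) \<and>
     (\<forall>\<phi>\<in>schwartz. \<forall>c. T (\<lambda>x. c * \<phi> x) = c * T \<phi>) \<and>
     (\<exists>C N. \<forall>\<phi>\<in>schwartz. norm (T \<phi>) \<le> C * schwartz_seminorm N \<phi>)"

definition regular_distr :: "('a::euclidean_space \<Rightarrow> complex) \<Rightarrow> 'a distr" where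
  "regular_distr g = (\<lambda>\<psi>. \<integral>x. g x * \<psi> x \<partial>lborel)"

definition represents :: "('a::euclidean_space \<Rightarrow> complex) \<Rightarrow> 'a distr \<Rightarrow> bool" where
  "represents g T \<longleftrightarrow> g \<in> borel_measurable lborel \<and>
     (\<forall>\<psi>\<in>schwartz. integrable lborel (\<lambda>x. g x * \<psi> x) \<and> T \<psi> = regular_distr g \<psi>)"

definition distr_fourier :: "'a::euclidean_space distr \<Rightarrow> 'a distr" where
  "distr_fourier T = (\<lambda>\<psi>. T (fourier \<psi>))"

definition distr_inv_fourier :: "'a::euclidean_space distr \<Rightarrow> 'a distr" where
  "distr_inv_fourier T = (\<lambda>\<psi>. T (inv_fourier \<psi>))"

definition distr_mult :: "('a::euclidean_space \<Rightarrow> complex) \<Rightarrow> 'a distr \<Rightarrow> 'a distr" where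
  "distr_mult g T = (\<lambda>\<psi>. T (\<lambda>x. g x * \<psi> x))"


section \<open>Lebesgue quasi-norms\<close>

(* Only used for exponents a > 0. *)
definition epowr :: "ennreal \<Rightarrow> real \<Rightarrow> ennreal" where
  "epowr t a = (if t = \<infinity> then \<infinity> else ennreal (enn2real t powr a))"

definition Lp_norm :: "'a measure \<Rightarrow> real \<Rightarrow> ('a \<Rightarrow> complex) \<Rightarrow> ennreal" where
  "Lp_norm M p f = epowr (\<integral>\<^sup>+x. ennreal (norm (f x) powr p) \<partial>M) (1 / p)"

(* The functions representing T agree almost everywhere, so the infimum ranges over at most one
   value; it is infinite if T is not a function. *)
definition distr_Lp_norm :: "real \<Rightarrow> 'a::euclidean_space distr \<Rightarrow> ennreal" where
  "distr_Lp_norm p T = (INF g \<in> {g. represents g T}. Lp_norm lborel p g)"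


section \<open>Besov spaces of generalised smoothness\<close>

definition admissible :: "(nat \<Rightarrow> real) \<Rightarrow> bool" where
  "admissible \<sigma> \<longleftrightarrow> (\<forall>j. \<sigma> j > 0) \<and>
     (\<exists>d0>0. \<exists>d1>0. \<forall>j. d0 * \<sigma> j \<le> \<sigma> (Suc j) \<and> \<sigma> (Suc j) \<le> d1 * \<sigma> j)"

definition resolution_generator :: "('a::euclidean_space \<Rightarrow> complex) \<Rightarrow> bool" where
  "resolution_generator \<phi>0 \<longleftrightarrow> \<phi>0 \<in> schwartz \<and> (\<forall>x. norm x \<le> 1 \<longrightarrow> \<phi>0 x = 1) \<and>
     closure {x. \<phi>0 x \<noteq> 0} \<subseteq> cball 0 2"

definition resolution :: "('a::euclidean_space \<Rightarrow> complex) \<Rightarrow> nat \<Rightarrow> 'a \<Rightarrow> complex" where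
  "resolution \<phi>0 j x =
     (if j = 0 then \<phi>0 x
      else \<phi>0 (2 powr (- real j) *\<^sub>R x) - \<phi>0 (2 powr (- real j + 1) *\<^sub>R x))"

definition besov_norm ::
  "('a::euclidean_space \<Rightarrow> complex) \<Rightarrow> (nat \<Rightarrow> real) \<Rightarrow> real \<Rightarrow> real \<Rightarrow> 'a distr \<Rightarrow> ennreal" where
  "besov_norm \<phi>0 \<rho> p q f =
     epowr (\<Sum>j. ennreal (\<rho> j powr q) *
        epowr (distr_Lp_norm p
          (distr_inv_fourier (distr_mult (resolution \<phi>0 j) (distr_fourier f)))) q) (1 / q)"

definition besov_space ::
  "('a::euclidean_space \<Rightarrow> complex) \<Rightarrow> (nat \<Rightarrow> real) \<Rightarrow> real \<Rightarrow> real \<Rightarrow> 'a distr set" where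
  "besov_space \<phi>0 \<rho> p q = {f. tempered f \<and> besov_norm \<phi>0 \<rho> p q f < \<infinity>}"


section \<open>h-sets\<close>

(* Only the values of h on {0<..1} matter. *)
definition gauge_class :: "(real \<Rightarrow> real) set" where
  "gauge_class = {h. (\<forall>r\<in>{0<..1}. h r > 0) \<and> continuous_on {0<..1} h \<and> mono_on {0<..1} h \<and>
     (h \<longlongrightarrow> 0) (at_right 0)}"

definition measure_support :: "'a::topological_space measure \<Rightarrow> 'a set" where
  "measure_support \<mu> = {x. \<forall>U. open U \<longrightarrow> x \<in> U \<longrightarrow> emeasure \<mu> U > 0}"

(* Every finite Borel measure on a Euclidean space is a Radon measure. *)
definition h_measure ::
  "(real \<Rightarrow> real) \<Rightarrow> 'a::euclidean_space set \<Rightarrow> 'a measure \<Rightarrow> bool" where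
  "h_measure h \<Gamma> \<mu> \<longleftrightarrow> finite_measure \<mu> \<and> sets \<mu> = sets borel \<and> measure_support \<mu> = \<Gamma> \<and>
     (\<exists>c1>0. \<exists>c2>0. \<forall>r\<in>{0<..1}. \<forall>\<gamma>\<in>\<Gamma>.
        c1 * h r \<le> measure \<mu> (cball \<gamma> r) \<and> measure \<mu> (cball \<gamma> r) \<le> c2 * h r)"

definition h_set :: "(real \<Rightarrow> real) \<Rightarrow> 'a::euclidean_space set \<Rightarrow> bool" where
  "h_set h \<Gamma> \<longleftrightarrow> h \<in> gauge_class \<and> \<Gamma> \<noteq> {} \<and> compact \<Gamma> \<and> (\<exists>\<mu>. h_measure h \<Gamma> \<mu>)"

definition dyadic :: "(real \<Rightarrow> real) \<Rightarrow> nat \<Rightarrow> real" where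
  "dyadic h j = h (2 powr (- real j))"


section \<open>Traces and sequence spaces\<close>

(* Existence of a bounded trace from the Besov space given by rho, p, q to L_r(Gamma, mu):
   the Schwartz functions are dense in the Besov space, so the estimate on them is what is
   needed to extend the pointwise restriction by continuity. *)
definition bounded_trace ::
  "('a::euclidean_space \<Rightarrow> complex) \<Rightarrow> (nat \<Rightarrow> real) \<Rightarrow> real \<Rightarrow> real \<Rightarrow> 'a set \<Rightarrow> 'a measure \<Rightarrow> real
    \<Rightarrow> bool" where
  "bounded_trace \<phi>0 \<rho> p q \<Gamma> \<mu> r \<longleftrightarrow>
     (\<exists>c>0. \<forall>\<phi>\<in>schwartz. Lp_norm (restrict_space \<mu> \<Gamma>) r \<phi> \<le>
        ennreal c * besov_norm \<phi>0 \<rho> p q (regular_distr \<phi>))"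

definition in_ell :: "ennreal \<Rightarrow> (nat \<Rightarrow> real) \<Rightarrow> bool" where
  "in_ell v x \<longleftrightarrow>
     (if v = \<infinity> then bounded (range x) else summable (\<lambda>j. \<bar>x j\<bar> powr enn2real v))"

end

theory Submission
  imports Defs "HOL-Probability.Probability"
begin

text \<open>
  A block \<open>g\<close> of \<open>f\<close> of frequency \<open>2\<^sup>j\<close> reproduces itself by convolution with a rapidly decreasing kernel,
  so \<open>\<bar>g x\<bar>\<^sup>p\<close> is at most a constant times \<open>2\<^sup>j\<^sup>n\<close> times the integral of \<open>\<bar>g y\<bar>\<^sup>p\<close> against a power of
  \<open>1 / (1 + 2\<^sup>j \<bar>x - y\<bar>)\<close>; for \<open>p < 1\<close> this uses Peetre's maximal function. Integrating over \<open>\<Gamma>\<close>, where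
  \<open>h\<close> is doubling, bounds the norm of \<open>g\<close> in \<open>L\<^sub>r(\<Gamma>)\<close> by \<open>h\<^sub>j\<^sup>1\<^sup>/\<^sup>r 2\<^sup>j\<^sup>n\<^sup>/\<^sup>p\<close> times its norm in \<open>L\<^sub>p\<close>. Summing
  the blocks leaves an estimate between sequences, which is the embedding of \<open>\<ell>\<^sub>q\<close> in case (i) and Hoelder's
  inequality in case (ii).

  For the converse, test with \<open>\<Sum>\<^sub>j a\<^sub>j \<Psi>(2\<^sup>j (x - \<gamma>))\<close>, where \<open>\<gamma> \<in> \<Gamma>\<close>, \<open>\<Psi>\<close> has its spectrum in an annulus
  and \<open>\<Psi>(0) = 1\<close>, and \<open>j\<close> runs through a sparse finite set. Each block sees at most one summand, and on
  the annulus \<open>\<bar>x - \<gamma>\<bar> \<sim> 2\<^sup>-\<^sup>j\<close> the modulus is at least \<open>a\<^sub>j / 4\<close>. These annuli have measure comparable to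
  \<open>h\<^sub>j\<close> by the hypothesis on the limes superior, so the trace inequality becomes an inequality between
  sums over \<open>j\<close>, which one evaluates at a single scale in case (i) and at the extremal sequence of
  Hoelder's inequality in case (ii).
\<close>

section \<open>Closure properties of Schwartz functions\<close>

text \<open>The Besov norm takes an infimum over all functions that represent a distribution, so no
  block can be measured before representing functions are known to agree almost everywhere. This is
  proved by testing with Schwartz functions. The doubling property of \<open>h\<close> is not
  assumed; it follows from the two-sided ball condition and a covering. Its constant may be large,
  which is harmless because the kernels decay to any order. In case (i) a single bump suffices for
  necessity. In case (ii) all scales have to contribute at once, and the bumps sit at the same point
  and interfere. The spacing \<open>M\<close> that controls the interference depends on a growth
  rate \<open>D\<close> of the coefficients; for the extremal sequence this rate is finite because
  \<open>h\<close> is doubling and \<open>\<sigma>\<close> is admissible. Sparsity costs only a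
  factor \<open>M\<close>, since all indices split into \<open>M\<close> residue classes. Optimal
  constants are never sought: for exponents at least 1 the convexity estimates come from
  \<open>s \<le> t powr (1 - p) * s powr p + t\<close>, in which the threshold \<open>t\<close> is
  chosen at the end so that the last term is absorbed.\<close>

abbreviation partial :: "'a::euclidean_space \<Rightarrow> ('a \<Rightarrow> complex) \<Rightarrow> 'a \<Rightarrow> complex" where
  "partial b f \<equiv> (\<lambda>x. frechet_derivative f (at x) b)"

definition rapid :: "('a::euclidean_space \<Rightarrow> complex) \<Rightarrow> bool" where
  "rapid f \<longleftrightarrow> (\<forall>N::nat. \<exists>C. \<forall>x. (1 + norm x) ^ N * norm (f x) \<le> C)"

lemma rapid_iff_bounded:
  "rapid f \<longleftrightarrow> (\<forall>N::nat. bounded (range (\<lambda>x. (1 + norm x) ^ N *\<^sub>R f x)))"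
  unfolding rapid_def bounded_iff by (simp add: abs_mult power_abs)

lemma iter_partial_append: "iter_partial (bs @ cs) f = iter_partial bs (iter_partial cs f)"
  by (induction bs) auto

lemma schwartz_iff:
  "f \<in> schwartz \<longleftrightarrow> (\<forall>bs. set bs \<subseteq> Basis \<longrightarrow>
      (\<forall>x. iter_partial bs f differentiable (at x)) \<and> rapid (iter_partial bs f))"
  unfolding schwartz_def rapid_iff_bounded by auto

text \<open>Replaces a statement about all words of partial derivatives by an invariant: a class of
  rapidly decreasing differentiable functions that is stable under one partial derivative consists
  of Schwartz functions. Each closure property amounts to the choice of \<open>X\<close>.\<close>

lemma schwartz_coinduct:
  assumes "f \<in> X"
    and diff: "\<And>f x. f \<in> X \<Longrightarrow> f differentiable (at x)"
    and rap: "\<And>f. f \<in> X \<Longrightarrow> rapid f"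
    and step: "\<And>f b. f \<in> X \<Longrightarrow> b \<in> Basis \<Longrightarrow> partial b f \<in> X"
  shows "f \<in> schwartz"
proof -
  have "set bs \<subseteq> Basis \<Longrightarrow> iter_partial bs f \<in> X" for bs
    by (induction bs) (use assms in auto)
  then show ?thesis
    unfolding schwartz_iff using diff rap by blast
qed

lemma schwartz_differentiable: "f \<in> schwartz \<Longrightarrow> f differentiable (at x)"
  unfolding schwartz_iff by (drule spec[of _ "[]"]) simp

lemma schwartz_rapid: "f \<in> schwartz \<Longrightarrow> rapid f"
  unfolding schwartz_iff by (drule spec[of _ "[]"]) simp

lemma schwartz_partial:
  assumes "f \<in> schwartz" "b \<in> Basis"
  shows "partial b f \<in> schwartz"
proof -
  have "iter_partial bs (partial b f) = iter_partial (bs @ [b]) f" for bs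
    by (simp add: iter_partial_append)
  then show ?thesis
    using assms unfolding schwartz_iff by simp
qed

lemma schwartz_has_derivative:
  "f \<in> schwartz \<Longrightarrow> (f has_derivative frechet_derivative f (at x)) (at x)"
  using schwartz_differentiable frechet_derivative_works by blast

lemma schwartz_continuous: "f \<in> schwartz \<Longrightarrow> continuous_on A f"
  by (meson continuous_at_imp_continuous_on differentiable_imp_continuous_within schwartz_differentiable)

lemma rapidD: "rapid f \<Longrightarrow> \<exists>C>0. \<forall>x. (1 + norm x) ^ N * norm (f x) \<le> C"
proof -
  assume "rapid f"
  then obtain C where C: "\<And>x. (1 + norm x) ^ N * norm (f x) \<le> C" unfolding rapid_def by blast
  then have "(1 + norm x) ^ N * norm (f x) \<le> \<bar>C\<bar> + 1" for x using C[of x] by linarith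
  then show ?thesis by (intro exI[of _ "\<bar>C\<bar> + 1"]) auto
qed

lemma rapid_add:
  assumes "rapid f" "rapid g"
  shows "rapid (\<lambda>x. f x + g x)"
  unfolding rapid_def
proof
  fix N
  obtain C D where "\<And>x. (1 + norm x) ^ N * norm (f x) \<le> C" "\<And>x. (1 + norm x) ^ N * norm (g x) \<le> D"
    using assms unfolding rapid_def by metis
  moreover have "(1 + norm x) ^ N * norm (f x + g x)
      \<le> (1 + norm x) ^ N * norm (f x) + (1 + norm x) ^ N * norm (g x)" for x
    unfolding distrib_left[symmetric] by (intro mult_left_mono norm_triangle_ineq) auto
  ultimately show "\<exists>C. \<forall>x. (1 + norm x) ^ N * norm (f x + g x) \<le> C"
    by (intro exI[of _ "C + D"]) (meson add_mono order_trans)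
qed

lemma rapid_bounded_mult:
  assumes "rapid f" "\<And>x. norm (g x) \<le> K * (1 + norm x) ^ k"
  shows "rapid (\<lambda>x. g x * f x)"
  unfolding rapid_def
proof
  fix N
  obtain C where C: "\<And>x. (1 + norm x) ^ (k + N) * norm (f x) \<le> C"
    using assms unfolding rapid_def by metis
  have K: "K \<ge> 0" using order_trans[OF norm_ge_zero assms(2)[of 0]] by simp
  have "(1 + norm x) ^ N * norm (g x * f x) \<le> K * C" for x
  proof -
    have "(1 + norm x) ^ N * norm (g x * f x) = norm (g x) * ((1 + norm x) ^ N * norm (f x))"
      by (simp add: norm_mult)
    also have "\<dots> \<le> (K * (1 + norm x) ^ k) * ((1 + norm x) ^ N * norm (f x))"
      by (intro mult_right_mono assms) auto
    also have "\<dots> = K * ((1 + norm x) ^ (k + N) * norm (f x))" by (simp add: power_add)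
    also have "\<dots> \<le> K * C" by (intro mult_left_mono C K)
    finally show ?thesis .
  qed
  then show "\<exists>C. \<forall>x. (1 + norm x) ^ N * norm (g x * f x) \<le> C" by blast
qed

lemma rapid_cmult: "rapid f \<Longrightarrow> rapid (\<lambda>x. c * f x)"
  by (rule rapid_bounded_mult[where K = "norm c" and k = 0]) auto

lemma schwartz_bounded:
  assumes "f \<in> schwartz"
  obtains K where "K > 0" "\<And>x. norm (f x) \<le> K"
  using rapidD[OF schwartz_rapid[OF assms], of 0] by auto

lemma schwartz_add:
  fixes f g :: "'a::euclidean_space \<Rightarrow> complex"
  assumes "f \<in> schwartz" "g \<in> schwartz"
  shows "(\<lambda>x. f x + g x) \<in> schwartz"
proof (rule schwartz_coinduct[where X = "{\<lambda>x. f x + g x |f g. f \<in> schwartz \<and> g \<in> schwartz}"])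
  fix f :: "'a \<Rightarrow> complex" and b assume "f \<in> {\<lambda>x. f x + g x |f g. f \<in> schwartz \<and> g \<in> schwartz}" and b: "b \<in> (Basis :: 'a set)"
  then obtain u v where f: "f = (\<lambda>x. u x + v x)" "u \<in> schwartz" "v \<in> schwartz" by blast
  have "partial b f = (\<lambda>x. partial b u x + partial b v x)"
    unfolding f(1) by (simp add: frechet_derivative_at[OF has_derivative_add[OF
        schwartz_has_derivative[OF f(2)] schwartz_has_derivative[OF f(3)]], symmetric])
  then show "partial b f \<in> {\<lambda>x. f x + g x |f g. f \<in> schwartz \<and> g \<in> schwartz}"
    using schwartz_partial[OF f(2) b] schwartz_partial[OF f(3) b] by (intro CollectI exI conjI)
next
  show "(\<lambda>x. f x + g x) \<in> {\<lambda>x. f x + g x |f g. f \<in> schwartz \<and> g \<in> schwartz}" using assms by blast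
next
  fix f :: "'a \<Rightarrow> complex" assume "f \<in> {\<lambda>x. f x + g x |f g. f \<in> schwartz \<and> g \<in> schwartz}"
  then obtain u v where f: "f = (\<lambda>x. u x + v x)" "u \<in> schwartz" "v \<in> schwartz" by blast
  show "rapid f" unfolding f(1) by (intro rapid_add schwartz_rapid f)
  show "f differentiable at x" for x unfolding f(1) by (intro differentiable_add schwartz_differentiable f)
qed

lemma schwartz_cmult:
  fixes f :: "'a::euclidean_space \<Rightarrow> complex"
  assumes "f \<in> schwartz"
  shows "(\<lambda>x. c * f x) \<in> schwartz"
proof (rule schwartz_coinduct[where X = "{\<lambda>x. c * f x |f. f \<in> schwartz}"])
  fix f :: "'a \<Rightarrow> complex" and b assume "f \<in> {\<lambda>x. c * f x |f. f \<in> schwartz}" and b: "b \<in> (Basis :: 'a set)"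
  then obtain u where f: "f = (\<lambda>x. c * u x)" "u \<in> schwartz" by blast
  have "partial b f = (\<lambda>x. c * partial b u x)"
    unfolding f(1) by (simp add: frechet_derivative_at[OF has_derivative_mult_right[OF
        schwartz_has_derivative[OF f(2)]], symmetric])
  then show "partial b f \<in> {\<lambda>x. c * f x |f. f \<in> schwartz}"
    using schwartz_partial[OF f(2) b] by (intro CollectI exI conjI)
next
  show "(\<lambda>x. c * f x) \<in> {\<lambda>x. c * f x |f. f \<in> schwartz}" using assms by blast
next
  fix f :: "'a \<Rightarrow> complex" assume "f \<in> {\<lambda>x. c * f x |f. f \<in> schwartz}"
  then obtain u where f: "f = (\<lambda>x. c * u x)" "u \<in> schwartz" by blast
  show "rapid f" unfolding f(1) by (intro rapid_cmult schwartz_rapid f)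
  show "f differentiable at x" for x unfolding f(1)
    by (intro differentiable_mult differentiable_const schwartz_differentiable f)
qed

lemma schwartz_zero: "(\<lambda>x::'a::euclidean_space. 0) \<in> schwartz"
  by (rule schwartz_coinduct[where X = "{\<lambda>x. 0}"])
    (auto simp: rapid_def frechet_derivative_const)

lemma schwartz_sum:
  "(\<And>i. i \<in> I \<Longrightarrow> f i \<in> schwartz) \<Longrightarrow> (\<lambda>x. \<Sum>i\<in>I. f i x) \<in> schwartz"
  by (induction I rule: infinite_finite_induct) (auto intro: schwartz_add schwartz_zero)

lemma schwartz_diff:
  assumes "f \<in> schwartz" "g \<in> schwartz"
  shows "(\<lambda>x. f x - g x) \<in> schwartz"
  using schwartz_add[OF assms(1) schwartz_cmult[OF assms(2), of "-1"]] by simp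

lemma has_derivative_coord: "((\<lambda>x. complex_of_real (x \<bullet> c)) has_derivative (\<lambda>h. complex_of_real (h \<bullet> c))) (at x)"
  by (rule has_derivative_of_real) (rule has_derivative_inner_left[OF has_derivative_ident])

lemma norm_coord_le: "norm (complex_of_real (x \<bullet> c)) \<le> norm c * (1 + norm x) ^ 1"
proof -
  have "\<bar>x \<bullet> c\<bar> \<le> norm x * norm c" by (rule Cauchy_Schwarz_ineq2)
  also have "\<dots> \<le> norm c * (1 + norm x) ^ 1" by (simp add: algebra_simps)
  finally show ?thesis by simp
qed

text \<open>Products with a coordinate are not stable under differentiation by themselves, because
  the product rule also differentiates the coordinate. Adding an arbitrary Schwartz function to the
  invariant absorbs that term.\<close>

lemma schwartz_coord_mult:
  fixes c :: "'a::euclidean_space"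
  assumes "f \<in> schwartz"
  shows "(\<lambda>x. complex_of_real (x \<bullet> c) * f x) \<in> schwartz"
proof (rule schwartz_coinduct[where X = "{\<lambda>x. complex_of_real (x \<bullet> c) * f x + g x |f g. f \<in> schwartz \<and> g \<in> schwartz}"])
  show "(\<lambda>x. complex_of_real (x \<bullet> c) * f x) \<in> {\<lambda>x. complex_of_real (x \<bullet> c) * f x + g x |f g. f \<in> schwartz \<and> g \<in> schwartz}"
    using assms schwartz_zero by force
  fix f assume "f \<in> {\<lambda>x. complex_of_real (x \<bullet> c) * f x + g x |f g. f \<in> schwartz \<and> g \<in> schwartz}"
  then obtain u v where f: "f = (\<lambda>x. complex_of_real (x \<bullet> c) * u x + v x)" "u \<in> schwartz" "v \<in> schwartz" by blast
  have d: "(f has_derivative (\<lambda>h. complex_of_real (x \<bullet> c) * frechet_derivative u (at x) h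
      + complex_of_real (h \<bullet> c) * u x + frechet_derivative v (at x) h)) (at x)" for x
    unfolding f(1)
    by (intro has_derivative_add has_derivative_mult schwartz_has_derivative f has_derivative_coord)
  show "f differentiable at x" for x using d differentiableI by blast
  show "rapid f" unfolding f(1)
    by (rule rapid_add[OF rapid_bounded_mult[OF schwartz_rapid[OF f(2)] norm_coord_le]
        schwartz_rapid[OF f(3)]])
  fix b assume b: "b \<in> (Basis :: 'a set)"
  have "partial b f = (\<lambda>x. complex_of_real (x \<bullet> c) * partial b u x + (complex_of_real (b \<bullet> c) * u x + partial b v x))"
    by (simp add: frechet_derivative_at[OF d, symmetric] add_ac)
  then show "partial b f \<in> {\<lambda>x. complex_of_real (x \<bullet> c) * f x + g x |f g. f \<in> schwartz \<and> g \<in> schwartz}"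
    using schwartz_partial[OF f(2) b] schwartz_add[OF schwartz_cmult[OF f(2)] schwartz_partial[OF f(3) b]]
    by (intro CollectI exI conjI)
qed

text \<open>By Leibniz' rule the derivatives of a product are sums of products; closing the products
  under addition gives an invariant without any bookkeeping of the summands.\<close>

inductive_set prod_span :: "('a::euclidean_space \<Rightarrow> complex) set" where
  mult: "f \<in> schwartz \<Longrightarrow> g \<in> schwartz \<Longrightarrow> (\<lambda>x. f x * g x) \<in> prod_span"
| add: "f \<in> prod_span \<Longrightarrow> g \<in> prod_span \<Longrightarrow> (\<lambda>x. f x + g x) \<in> prod_span"

lemma schwartz_mult:
  fixes f g :: "'a::euclidean_space \<Rightarrow> complex"
  assumes "f \<in> schwartz" "g \<in> schwartz"
  shows "(\<lambda>x. f x * g x) \<in> schwartz"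
proof (rule schwartz_coinduct[where X = prod_span])
  show "(\<lambda>x. f x * g x) \<in> prod_span" by (intro prod_span.mult assms)
  show d: "f differentiable at x" if "f \<in> prod_span" for f :: "'a \<Rightarrow> complex" and x
    using that by induction (simp_all add: differentiable_add differentiable_mult schwartz_differentiable)
  show "rapid f" if "f \<in> prod_span" for f :: "'a \<Rightarrow> complex"
    using that
  proof induction
    case (mult f g)
    obtain K where "\<And>x. norm (f x) \<le> K" using schwartz_bounded[OF mult(1)] by metis
    then show ?case
      by (intro rapid_bounded_mult[where K = K and k = 0] schwartz_rapid mult) auto
  qed (rule rapid_add)
  show "partial b f \<in> prod_span" if "f \<in> prod_span" and b: "b \<in> Basis" for f :: "'a \<Rightarrow> complex" and b
    using that(1)
  proof induction
    case (mult f g)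
    have "partial b (\<lambda>x. f x * g x) = (\<lambda>x. f x * partial b g x + partial b f x * g x)"
      by (simp add: frechet_derivative_at[OF has_derivative_mult[OF
        schwartz_has_derivative[OF mult(1)] schwartz_has_derivative[OF mult(2)]], symmetric])
    then show ?case
      by (simp add: prod_span.add prod_span.mult mult schwartz_partial[OF _ b])
  next
    case (add f g)
    have "partial b (\<lambda>x. f x + g x) = (\<lambda>x. partial b f x + partial b g x)"
      by (simp add: frechet_derivative_at[OF has_derivative_add[OF
        d[OF add(1), unfolded frechet_derivative_works] d[OF add(2), unfolded frechet_derivative_works]], symmetric])
    then show ?case by (simp add: prod_span.add add)
  qed
qed

lemma schwartz_cnj:
  fixes f :: "'a::euclidean_space \<Rightarrow> complex"
  assumes "f \<in> schwartz"
  shows "(\<lambda>x. cnj (f x)) \<in> schwartz"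
proof (rule schwartz_coinduct[where X = "{\<lambda>x. cnj (f x) |f. f \<in> schwartz}"])
  fix f assume "f \<in> {\<lambda>x. cnj (f x) |f. f \<in> (schwartz :: ('a \<Rightarrow> complex) set)}"
  then obtain u where f: "f = (\<lambda>x. cnj (u x))" "u \<in> schwartz" by blast
  have d: "(f has_derivative (\<lambda>h. cnj (frechet_derivative u (at x) h))) (at x)" for x
    unfolding f(1) by (intro has_derivative_cnj schwartz_has_derivative f)
  show "f differentiable at x" for x using d differentiableI by blast
  show "rapid f" using schwartz_rapid[OF f(2)] unfolding f(1) rapid_def by simp
  fix b assume b: "b \<in> (Basis :: 'a set)"
  have "partial b f = (\<lambda>x. cnj (partial b u x))"
    by (simp add: frechet_derivative_at[OF d, symmetric])
  then show "partial b f \<in> {\<lambda>x. cnj (f x) |f. f \<in> schwartz}"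
    using schwartz_partial[OF f(2) b] by (intro CollectI exI conjI)
qed (use assms in auto)

lemma rapid_affine:
  fixes f :: "'a::euclidean_space \<Rightarrow> complex" and c :: real
  assumes "rapid f" "c \<noteq> 0"
  shows "rapid (\<lambda>x. f (c *\<^sub>R x + a))"
  unfolding rapid_def
proof
  fix N
  obtain C where C: "\<And>x. (1 + norm x) ^ N * norm (f x) \<le> C"
    using assms unfolding rapid_def by metis
  \<comment> \<open>Since \<open>\<bar>c\<bar> * norm x \<le> norm (c *\<^sub>R x + a) + norm
    a\<close>, the weight at \<open>x\<close> is at most \<open>K\<close> times the weight at its
    image.\<close>
  define K where "K = 1 + norm a / \<bar>c\<bar> + 1 / \<bar>c\<bar>"
  have K: "1 + norm x \<le> K * (1 + norm (c *\<^sub>R x + a))" for x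
  proof -
    have "norm (c *\<^sub>R x) \<le> norm (c *\<^sub>R x + a) + norm a"
      using norm_triangle_ineq4[of "c *\<^sub>R x + a" a] by simp
    then have "norm x \<le> (norm (c *\<^sub>R x + a) + norm a) / \<bar>c\<bar>"
      using assms(2) by (simp add: field_simps)
    then have "1 + norm x \<le> 1 + norm a / \<bar>c\<bar> + 1 / \<bar>c\<bar> * norm (c *\<^sub>R x + a)"
      by (simp add: add_divide_distrib)
    also have "\<dots> \<le> K * (1 + norm (c *\<^sub>R x + a))"
      unfolding K_def using norm_ge_zero[of "c *\<^sub>R x + a"]
      by (simp only: distrib_left distrib_right mult_1 mult_1_right) (simp add: add_nonneg_nonneg)
    finally show ?thesis .
  qed
  have "(1 + norm x) ^ N * norm (f (c *\<^sub>R x + a)) \<le> K ^ N * C" for x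
  proof -
    have "(1 + norm x) ^ N \<le> K ^ N * (1 + norm (c *\<^sub>R x + a)) ^ N"
      using power_mono[OF K, of x N] by (simp add: power_mult_distrib)
    from mult_right_mono[OF this norm_ge_zero[of "f (c *\<^sub>R x + a)"]]
    have "(1 + norm x) ^ N * norm (f (c *\<^sub>R x + a)) \<le> K ^ N * ((1 + norm (c *\<^sub>R x + a)) ^ N * norm (f (c *\<^sub>R x + a)))"
      by (simp add: mult.assoc)
    also have "\<dots> \<le> K ^ N * C"
      by (intro mult_left_mono C zero_le_power) (simp add: K_def)
    finally show ?thesis .
  qed
  then show "\<exists>C. \<forall>x. (1 + norm x) ^ N * norm (f (c *\<^sub>R x + a)) \<le> C" by blast
qed

lemma schwartz_affine:
  fixes f :: "'a::euclidean_space \<Rightarrow> complex" and c :: real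
  assumes "f \<in> schwartz" "c \<noteq> 0"
  shows "(\<lambda>x. f (c *\<^sub>R x + a)) \<in> schwartz"
\<comment> \<open>The factor \<open>k\<close> collects the powers of \<open>c\<close> that the chain
  rule produces.\<close>
proof (rule schwartz_coinduct[where X = "{\<lambda>x. k * f (c *\<^sub>R x + a) |f k. f \<in> schwartz}"])
  show "(\<lambda>x. f (c *\<^sub>R x + a)) \<in> {\<lambda>x. k * f (c *\<^sub>R x + a) |f k. f \<in> schwartz}"
    using assms by (auto intro!: exI[of _ f] exI[of _ 1])
  fix f assume "f \<in> {\<lambda>x. k * f (c *\<^sub>R x + a) |f k. f \<in> schwartz}"
  then obtain u k where f: "f = (\<lambda>x. k * u (c *\<^sub>R x + a))" "u \<in> schwartz" by blast
  have "((\<lambda>x. u (c *\<^sub>R x + a)) has_derivative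
      (\<lambda>h. frechet_derivative u (at (c *\<^sub>R x + a)) (c *\<^sub>R h))) (at x)" for x
    using schwartz_has_derivative[OF f(2), of "c *\<^sub>R x + a"]
    by (rule has_derivative_compose[rotated]) (auto intro!: derivative_eq_intros)
  from has_derivative_mult_right[OF this, of k]
  have d: "(f has_derivative (\<lambda>h. k * frechet_derivative u (at (c *\<^sub>R x + a)) (c *\<^sub>R h))) (at x)" for x
    unfolding f(1) .
  show "f differentiable at x" for x using d differentiableI by blast
  show "rapid f" unfolding f(1)
    by (intro rapid_cmult rapid_affine schwartz_rapid f assms)
  fix b assume b: "b \<in> (Basis :: 'a set)"
  have "linear (frechet_derivative u (at x))" for x
    using linear_frechet_derivative schwartz_differentiable f(2) by blast
  then have "partial b f = (\<lambda>x. (k * of_real c) * partial b u (c *\<^sub>R x + a))"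
    by (simp add: frechet_derivative_at[OF d, symmetric] linear_scale scaleR_conv_of_real mult.assoc)
  then show "partial b f \<in> {\<lambda>x. k * f (c *\<^sub>R x + a) |f k. f \<in> schwartz}"
    using schwartz_partial[OF f(2) b] by (intro CollectI exI conjI)
qed

lemma schwartz_scale:
  assumes "f \<in> schwartz" "c \<noteq> 0" shows "(\<lambda>x. f (c *\<^sub>R x)) \<in> schwartz"
  using schwartz_affine[OF assms, of 0] by simp

section \<open>The Fourier transform of Schwartz functions\<close>

lemma nn_integral_inverse_1_plus_square_finite:
  "(\<integral>\<^sup>+x. ennreal (inverse (1 + (x::real)\<^sup>2)) \<partial>lborel) < \<infinity>"
proof -
  have "integrable lborel (\<lambda>x::real. inverse (1 + x\<^sup>2))"
    using integrable_inverse_1_plus_square by (simp add: set_integrable_def einterval_iff)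
  then show ?thesis
    unfolding integrable_iff_bounded by (simp add: add_nonneg_nonneg)
qed

text \<open>In each coordinate \<open>1 + (x \<bullet> b)\<^sup>2\<close> is at most
  \<open>(1 + norm x) ^ 2\<close>, so the weight lies below a product of one-dimensional Cauchy
  densities (up to constants) and Tonelli applies. The exponent spends two powers on each coordinate
  and is not sharp.\<close>

lemma integrable_inverse_power_weight:
  "integrable lborel (\<lambda>x::'a::euclidean_space. 1 / (1 + norm x) ^ (2 * DIM('a)))"
proof (rule integrableI_bounded)
  show "(\<lambda>x::'a. 1 / (1 + norm x) ^ (2 * DIM('a))) \<in> borel_measurable lborel" by measurable
  have "(\<integral>\<^sup>+x. ennreal (norm (1 / (1 + norm (x::'a)) ^ (2 * DIM('a)))) \<partial>lborel)
      \<le> (\<integral>\<^sup>+x. (\<Prod>b\<in>Basis. ennreal (inverse (1 + ((x::'a) \<bullet> b)\<^sup>2))) \<partial>lborel)"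
  proof (rule nn_integral_mono)
    fix x :: 'a
    have "(\<Prod>b\<in>Basis. (1 + (x \<bullet> b)\<^sup>2)) \<le> (\<Prod>b\<in>(Basis::'a set). (1 + norm x) ^ 2)"
    proof (rule prod_mono)
      fix b :: 'a assume "b \<in> Basis"
      then have "\<bar>x \<bullet> b\<bar> \<le> norm x" by (rule Basis_le_norm)
      then have "(x \<bullet> b)\<^sup>2 \<le> (norm x)\<^sup>2" by (metis norm_ge_zero power2_abs power_mono abs_ge_zero)
      then show "0 \<le> 1 + (x \<bullet> b)\<^sup>2 \<and> 1 + (x \<bullet> b)\<^sup>2 \<le> (1 + norm x) ^ 2"
        by (simp add: power2_sum add_nonneg_nonneg add_increasing2)
    qed
    moreover have "0 < (\<Prod>b\<in>Basis. (1 + (x \<bullet> b)\<^sup>2))"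
      by (intro prod_pos) (simp add: add_pos_nonneg)
    ultimately have "1 / (1 + norm x) ^ (2 * DIM('a)) \<le> inverse (\<Prod>b\<in>Basis. (1 + (x \<bullet> b)\<^sup>2))"
      by (simp add: divide_inverse power_mult[symmetric] le_imp_inverse_le)
    then show "ennreal (norm (1 / (1 + norm x) ^ (2 * DIM('a)))) \<le> (\<Prod>b\<in>Basis. ennreal (inverse (1 + (x \<bullet> b)\<^sup>2)))"
      by (subst prod_ennreal) (auto simp: prod_inversef[symmetric] o_def intro!: ennreal_leI)
  qed
  also have "\<dots> = (\<Prod>b\<in>(Basis::'a set). (\<integral>\<^sup>+x. ennreal (inverse (1 + x\<^sup>2)) \<partial>lborel))"
    by (subst nn_integral_lborel_prod[where f = "\<lambda>b x. ennreal (inverse (1 + x\<^sup>2))"]) auto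
  also have "\<dots> < \<infinity>"
    using nn_integral_inverse_1_plus_square_finite
    by (simp add: prod_constant power_less_top_ennreal)
  finally show "(\<integral>\<^sup>+x. ennreal (norm (1 / (1 + norm (x::'a)) ^ (2 * DIM('a)))) \<partial>lborel) < \<infinity>" .
qed

lemma rapid_integrable:
  fixes f :: "'a::euclidean_space \<Rightarrow> complex"
  assumes [measurable]: "f \<in> borel_measurable borel" and "rapid f"
  shows "integrable lborel (\<lambda>x. (1 + norm x) ^ N *\<^sub>R f x)"
proof -
  obtain C where C: "\<And>x. (1 + norm x) ^ (N + 2 * DIM('a)) * norm (f x) \<le> C"
    using assms(2) unfolding rapid_def by blast
  show ?thesis
  proof (rule Bochner_Integration.integrable_bound)
    show "integrable lborel (\<lambda>x::'a. C * (1 / (1 + norm x) ^ (2 * DIM('a))))"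
      by (intro integrable_mult_right integrable_inverse_power_weight)
    show "AE x in lborel. norm ((1 + norm x) ^ N *\<^sub>R f x) \<le> norm (C * (1 / (1 + norm x) ^ (2 * DIM('a))))"
    proof (rule AE_I2)
      fix x :: 'a
      have "0 < (1 + norm x) ^ (2 * DIM('a))" by (simp add: add_pos_nonneg)
      then have "(1 + norm x) ^ N * norm (f x) \<le> C / (1 + norm x) ^ (2 * DIM('a))"
        using C[of x] by (simp add: field_simps power_add)
      also have "\<dots> \<le> norm (C * (1 / (1 + norm x) ^ (2 * DIM('a))))" by (simp add: divide_right_mono)
      finally show "norm ((1 + norm x) ^ N *\<^sub>R f x) \<le> norm (C * (1 / (1 + norm x) ^ (2 * DIM('a))))"
        by simp
    qed
  qed measurable
qed

lemma schwartz_measurable: "f \<in> schwartz \<Longrightarrow> f \<in> borel_measurable borel"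
  using schwartz_continuous borel_measurable_continuous_onI by blast

lemma schwartz_integrable: "f \<in> schwartz \<Longrightarrow> integrable lborel f"
  using rapid_integrable[OF schwartz_measurable schwartz_rapid, of f 0] by simp

section \<open>The Fourier integral of integrable functions\<close>

abbreviation wave :: "'a::euclidean_space \<Rightarrow> 'a \<Rightarrow> complex" where
  "wave x \<xi> \<equiv> exp (- \<i> * complex_of_real (x \<bullet> \<xi>))"

lemma norm_wave [simp]: "norm (wave x \<xi>) = 1"
  by (simp add: norm_exp_eq_Re)

lemma integrable_wave:
  assumes "integrable lborel f" shows "integrable lborel (\<lambda>x. wave x \<xi> * f x)"
proof (rule Bochner_Integration.integrable_bound[OF assms])
  have [measurable]: "f \<in> borel_measurable borel" using assms by auto
  show "(\<lambda>x. wave x \<xi> * f x) \<in> borel_measurable lborel" by measurable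
qed (simp add: norm_mult)

abbreviation fconst :: "'a::euclidean_space itself \<Rightarrow> complex" where
  "fconst T \<equiv> complex_of_real ((2 * pi) powr (- real DIM('a) / 2))"

lemma fourier_eq: "fourier f \<xi> = fconst TYPE('a::euclidean_space) * (\<integral>x. wave (x::'a) \<xi> * f x \<partial>lborel)"
  unfolding fourier_def ..

lemma lborel_integral_affine:
  fixes f :: "'a::euclidean_space \<Rightarrow> 'b::{banach, second_countable_topology}"
  assumes [measurable]: "f \<in> borel_measurable borel" and "c \<noteq> 0"
  shows "(\<integral>x. f x \<partial>lborel) = \<bar>c\<bar> ^ DIM('a) *\<^sub>R (\<integral>x. f (a + c *\<^sub>R x) \<partial>lborel)"
  by (subst lborel_affine[OF assms(2), of a]) (simp add: integral_density integral_distr)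

lemma nn_integral_lborel_affine:
  fixes f :: "'a::euclidean_space \<Rightarrow> ennreal"
  assumes [measurable]: "f \<in> borel_measurable borel" and "c \<noteq> 0"
  shows "(\<integral>\<^sup>+x. f x \<partial>lborel) = ennreal (\<bar>c\<bar> ^ DIM('a)) * (\<integral>\<^sup>+x. f (a + c *\<^sub>R x) \<partial>lborel)"
  by (subst lborel_affine[OF assms(2), of a]) (simp add: nn_integral_density nn_integral_distr nn_integral_cmult)

lemma lborel_integrable_affine:
  fixes f :: "'a::euclidean_space \<Rightarrow> 'b::{banach, second_countable_topology}"
  assumes f: "integrable lborel f" and "c \<noteq> 0"
  shows "integrable lborel (\<lambda>x. f (a + c *\<^sub>R x))"
proof -
  have [measurable]: "f \<in> borel_measurable borel" using f by auto
  have "(\<integral>\<^sup>+x. ennreal (norm (f x)) \<partial>lborel) = ennreal (\<bar>c\<bar> ^ DIM('a)) * (\<integral>\<^sup>+x. ennreal (norm (f (a + c *\<^sub>R x))) \<partial>lborel)"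
    by (rule nn_integral_lborel_affine[OF _ assms(2)]) measurable
  moreover have "(\<integral>\<^sup>+x. ennreal (norm (f x)) \<partial>lborel) < \<infinity>" using f by (simp add: integrable_iff_bounded)
  ultimately have "(\<integral>\<^sup>+x. ennreal (norm (f (a + c *\<^sub>R x))) \<partial>lborel) < \<infinity>"
    using assms(2) zero_less_power[of "\<bar>c\<bar>" "DIM('a)", unfolded zero_less_abs_iff, OF assms(2)]
    by (auto simp: ennreal_mult_eq_top_iff less_top[symmetric] ennreal_eq_0_iff)
  then show ?thesis by (auto simp: integrable_iff_bounded)
qed

lemma fourier_affine:
  fixes f :: "'a::euclidean_space \<Rightarrow> complex"
  assumes [measurable]: "f \<in> borel_measurable borel" and "c \<noteq> 0"
  shows "fourier (\<lambda>x. f (a + c *\<^sub>R x)) \<xi> = of_real (1 / \<bar>c\<bar> ^ DIM('a)) * (wave (- a) (\<xi> /\<^sub>R c) * fourier f (\<xi> /\<^sub>R c))"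
proof -
  have "(\<integral>x. wave x (\<xi> /\<^sub>R c) * f x \<partial>lborel) = \<bar>c\<bar> ^ DIM('a) *\<^sub>R (\<integral>x. wave (a + c *\<^sub>R x) (\<xi> /\<^sub>R c) * f (a + c *\<^sub>R x) \<partial>lborel)"
    by (rule lborel_integral_affine[OF _ assms(2)]) measurable
  also have "(\<lambda>x. wave (a + c *\<^sub>R x) (\<xi> /\<^sub>R c) * f (a + c *\<^sub>R x)) = (\<lambda>x. wave a (\<xi> /\<^sub>R c) * (wave x \<xi> * f (a + c *\<^sub>R x)))"
  proof
    fix x
    have "(a + c *\<^sub>R x) \<bullet> (\<xi> /\<^sub>R c) = a \<bullet> (\<xi> /\<^sub>R c) + x \<bullet> \<xi>"
      using assms(2) by (simp add: inner_add_left distrib_left mult.assoc[symmetric])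
    then show "wave (a + c *\<^sub>R x) (\<xi> /\<^sub>R c) * f (a + c *\<^sub>R x) = wave a (\<xi> /\<^sub>R c) * (wave x \<xi> * f (a + c *\<^sub>R x))"
      by (simp only: of_real_add distrib_left exp_add mult.assoc)
  qed
  finally have *: "(\<integral>x. wave x (\<xi> /\<^sub>R c) * f x \<partial>lborel) = \<bar>c\<bar> ^ DIM('a) *\<^sub>R (wave a (\<xi> /\<^sub>R c) * (\<integral>x. wave x \<xi> * f (a + c *\<^sub>R x) \<partial>lborel))"
    by simp
  have "wave (- a) (\<xi> /\<^sub>R c) * wave a (\<xi> /\<^sub>R c) = 1"
    by (simp add: exp_add[symmetric])
  then show ?thesis
    unfolding fourier_eq * using assms(2)
    by (simp add: scaleR_conv_of_real mult.left_commute[of "wave (- a) _"] mult.assoc[symmetric] del: inner_scaleR_right)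
qed

lemma inv_fourier_eq_fourier: "inv_fourier f x = fourier f (- x)"
  unfolding fourier_def inv_fourier_def by (simp add: inner_commute)

lemma norm_fourier_le:
  fixes f :: "'a::euclidean_space \<Rightarrow> complex"
  assumes "integrable lborel f"
  shows "norm (fourier f \<xi>) \<le> (2 * pi) powr (- real DIM('a) / 2) * (\<integral>x. norm (f x) \<partial>lborel)"
proof -
  have "norm (\<integral>x. wave x \<xi> * f x \<partial>lborel) \<le> (\<integral>x. norm (wave x \<xi> * f x) \<partial>lborel)"
    by (rule integral_norm_bound)
  then show ?thesis
    unfolding fourier_eq by (simp add: norm_mult mult_left_mono)
qed

lemma continuous_fourier:
  fixes f :: "'a::euclidean_space \<Rightarrow> complex"
  assumes "integrable lborel f"
  shows "continuous_on UNIV (fourier f)"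
proof -
  have [measurable]: "f \<in> borel_measurable borel" using assms by auto
  have "((\<lambda>n. \<integral>x. wave x (s n) * f x \<partial>lborel) \<longlonglongrightarrow> (\<integral>x. wave x \<xi> * f x \<partial>lborel))" if s: "s \<longlonglongrightarrow> \<xi>" for s :: "nat \<Rightarrow> 'a" and \<xi>
  proof (rule integral_dominated_convergence[where w = "\<lambda>x. norm (f x)"])
    show "AE x in lborel. (\<lambda>n. wave x (s n) * f x) \<longlonglongrightarrow> wave x \<xi> * f x"
      by (intro AE_I2 tendsto_intros s)
  qed (use assms in \<open>auto simp: norm_mult\<close>)
  then have "isCont (fourier f) \<xi>" for \<xi>
    unfolding fourier_eq[abs_def] continuous_at_sequentially
    by (auto simp: o_def intro!: tendsto_mult_left)
  then show ?thesis by (simp add: continuous_at_imp_continuous_on)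
qed

lemma fourier_measurable:
  "integrable lborel f \<Longrightarrow> fourier f \<in> borel_measurable borel"
  using continuous_fourier borel_measurable_continuous_onI by blast

lemma fourier_linear:
  assumes "integrable lborel f" "integrable lborel g"
  shows "fourier (\<lambda>x. c * f x + d * g x) \<xi> = c * fourier f \<xi> + d * fourier g \<xi>"
proof -
  have "(\<lambda>x. wave x \<xi> * (c * f x + d * g x)) = (\<lambda>x. c * (wave x \<xi> * f x) + d * (wave x \<xi> * g x))"
    by (simp add: algebra_simps)
  then have "(\<integral>x. wave x \<xi> * (c * f x + d * g x) \<partial>lborel)
      = c * (\<integral>x. wave x \<xi> * f x \<partial>lborel) + d * (\<integral>x. wave x \<xi> * g x \<partial>lborel)"
    using integrable_wave[OF assms(1)] integrable_wave[OF assms(2)] by simp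
  then show ?thesis unfolding fourier_eq by (simp add: algebra_simps)
qed

lemma fourier_cmult: "fourier (\<lambda>x. c * f x) \<xi> = c * fourier f \<xi>"
  unfolding fourier_eq mult.left_commute[of _ c] by simp

lemma fourier_sum:
  assumes "\<And>i. i \<in> I \<Longrightarrow> integrable lborel (f i)"
  shows "fourier (\<lambda>x. \<Sum>i\<in>I. c i * f i x) \<xi> = (\<Sum>i\<in>I. c i * fourier (f i) \<xi>)"
  using assms
proof (induction I rule: infinite_finite_induct)
  case (insert i I)
  then have "fourier (\<lambda>x. c i * f i x + 1 * (\<Sum>i\<in>I. c i * f i x)) \<xi> = c i * fourier (f i) \<xi> + 1 * fourier (\<lambda>x. \<Sum>i\<in>I. c i * f i x) \<xi>"
    by (intro fourier_linear) auto
  then show ?case using insert by simp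
qed (auto simp: fourier_def)

lemma integrable_kernel_product:
  fixes f g :: "'a::euclidean_space \<Rightarrow> complex"
  assumes f: "integrable lborel f" and g: "integrable lborel g"
    and [measurable]: "(\<lambda>(x, y). K x y) \<in> borel_measurable (borel \<Otimes>\<^sub>M borel)"
    and K: "\<And>x y. norm (K x y) \<le> B"
  shows "integrable (lborel \<Otimes>\<^sub>M lborel) (\<lambda>(x, y). K x y * f x * g y)"
proof (rule Bochner_Integration.integrable_bound)
  have [measurable]: "f \<in> borel_measurable borel" "g \<in> borel_measurable borel" using f g by auto
  show "integrable (lborel \<Otimes>\<^sub>M lborel) (\<lambda>(x, y). B *\<^sub>R (f x * g y))"
    by (rule lborel_pair.Fubini_integrable) (use f g in \<open>auto simp: norm_mult\<close>)
  show "(\<lambda>(x, y). K x y * f x * g y) \<in> borel_measurable (lborel \<Otimes>\<^sub>M lborel)" by measurable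
  have "norm (K x y * f x * g y) \<le> \<bar>B\<bar> * (norm (f x) * norm (g y))" for x y
    using mult_right_mono[OF order_trans[OF K[of x y] abs_ge_self], of "norm (f x) * norm (g y)"]
    by (simp add: norm_mult mult.assoc)
  then show "AE x in lborel \<Otimes>\<^sub>M lborel. norm (case x of (x, y) \<Rightarrow> K x y * f x * g y) \<le> norm (case x of (x, y) \<Rightarrow> B *\<^sub>R (f x * g y))"
    by (auto simp: norm_mult)
qed

lemma integral_kernel_swap:
  fixes f g :: "'a::euclidean_space \<Rightarrow> complex"
  assumes f: "integrable lborel f" and g: "integrable lborel g"
    and [measurable]: "(\<lambda>(x, y). K x y) \<in> borel_measurable (borel \<Otimes>\<^sub>M borel)"
    and K: "\<And>x y. norm (K x y) \<le> B"
  shows "(\<integral>y. (\<integral>x. K x y * f x \<partial>lborel) * g y \<partial>lborel) = (\<integral>x. f x * (\<integral>y. K x y * g y \<partial>lborel) \<partial>lborel)"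
proof -
  have "(\<integral>y. (\<integral>x. K x y * f x * g y \<partial>lborel) \<partial>lborel) = (\<integral>x. (\<integral>y. K x y * f x * g y \<partial>lborel) \<partial>lborel)"
    using lborel_pair.Fubini_integral[OF integrable_kernel_product[OF assms]] by simp
  moreover have "(\<integral>x. K x y * f x * g y \<partial>lborel) = (\<integral>x. K x y * f x \<partial>lborel) * g y" for y
    by simp
  moreover have "(\<integral>y. K x y * f x * g y \<partial>lborel) = f x * (\<integral>y. K x y * g y \<partial>lborel)" for x
    by (subst integral_mult_right_zero[symmetric]) (simp add: mult_ac)
  ultimately show ?thesis by simp
qed

text \<open>Fubini with the unimodular kernel \<open>wave\<close>. This one identity yields the
  convolution theorem, the inversion theorem, and the agreement of the distributional transform with
  the classical one.\<close>

lemma fourier_multiplication_formula: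
  fixes f g :: "'a::euclidean_space \<Rightarrow> complex"
  assumes f: "integrable lborel f" and g: "integrable lborel g"
  shows "(\<integral>\<xi>. fourier f \<xi> * g \<xi> \<partial>lborel) = (\<integral>x. f x * fourier g x \<partial>lborel)"
proof -
  have "(\<integral>y. (\<integral>x. wave x y * f x \<partial>lborel) * g y \<partial>lborel) = (\<integral>x. f x * (\<integral>y. wave x y * g y \<partial>lborel) \<partial>lborel)"
    by (rule integral_kernel_swap[OF f g, where B = 1]) simp_all
  then have "fconst TYPE('a) * (\<integral>y. (\<integral>x. wave x y * f x \<partial>lborel) * g y \<partial>lborel)
      = fconst TYPE('a) * (\<integral>x. f x * (\<integral>y. wave y x * g y \<partial>lborel) \<partial>lborel)"
    by (simp add: inner_commute)
  moreover have "f x * (fconst TYPE('a) * z) = fconst TYPE('a) * (f x * z)" for x z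
    by (rule mult.left_commute)
  ultimately show ?thesis
    unfolding fourier_eq by (simp only: mult.assoc integral_mult_right_zero)
qed

lemma inv_fourier_mult_fourier:
  fixes f m :: "'a::euclidean_space \<Rightarrow> complex"
  assumes f: "integrable lborel f" and m: "integrable lborel m"
  shows "inv_fourier (\<lambda>\<xi>. m \<xi> * fourier f \<xi>) x = fconst TYPE('a) * (\<integral>y. f y * inv_fourier m (x - y) \<partial>lborel)"
proof -
  \<comment> \<open>The multiplier modulated by \<open>x\<close>: its Fourier transform is the
    kernel reflected and translated to \<open>x\<close>, so the multiplication formula turns into a
    convolution.\<close>
  define E where "E \<xi> = wave \<xi> (- x) * m \<xi>" for \<xi>
  have E: "integrable lborel E" unfolding E_def by (rule integrable_wave[OF m])
  have "wave \<xi> y * wave \<xi> (- x) = wave \<xi> (- (x - y))" for \<xi> y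
    by (simp add: exp_add[symmetric] inner_diff_right algebra_simps)
  then have *: "fourier E y = inv_fourier m (x - y)" for y
    unfolding inv_fourier_eq_fourier fourier_eq E_def mult.assoc[symmetric] by simp
  have "(\<lambda>\<xi>. wave \<xi> (- x) * (m \<xi> * fourier f \<xi>)) = (\<lambda>\<xi>. fourier f \<xi> * E \<xi>)"
    unfolding E_def by (intro ext) (simp only: mult_ac)
  then have "inv_fourier (\<lambda>\<xi>. m \<xi> * fourier f \<xi>) x = fconst TYPE('a) * (\<integral>\<xi>. fourier f \<xi> * E \<xi> \<partial>lborel)"
    unfolding inv_fourier_eq_fourier[of "\<lambda>\<xi>. m \<xi> * fourier f \<xi>"] fourier_eq[of "\<lambda>\<xi>. m \<xi> * fourier f \<xi>"] by (rule arg_cong)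
  also have "(\<integral>\<xi>. fourier f \<xi> * E \<xi> \<partial>lborel) = (\<integral>y. f y * fourier E y \<partial>lborel)"
    by (rule fourier_multiplication_formula[OF f E])
  finally show ?thesis unfolding * .
qed

section \<open>Differentiation against decay: the Schwartz class is stable under
  \<open>fourier\<close>\<close>

lemma difference_quotient_limit:
  fixes F :: "real \<Rightarrow> complex"
  assumes "(F has_vector_derivative D) (at 0)"
  shows "(\<lambda>k. of_nat (Suc k) * (F (1 / real (Suc k)) - F 0)) \<longlonglongrightarrow> D"
proof -
  define t where "t k = 1 / real (Suc k)" for k
  have t: "filterlim t (at 0) sequentially"
    unfolding t_def filterlim_at using LIMSEQ_inverse_real_of_nat by (simp add: inverse_eq_divide)
  have "(\<lambda>h. norm (F (0 + h) - F 0 - h *\<^sub>R D) / norm h) \<midarrow>0\<rightarrow> 0"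
    using assms unfolding has_vector_derivative_def has_derivative_at by simp
  then have "(\<lambda>k. norm (F (0 + t k) - F 0 - t k *\<^sub>R D) / norm (t k)) \<longlonglongrightarrow> 0"
    by (rule filterlim_compose[OF _ t])
  moreover have "norm (F (0 + t k) - F 0 - t k *\<^sub>R D) / norm (t k) = norm (of_nat (Suc k) * (F (t k) - F 0) - D)" for k
  proof -
    have "F (0 + t k) - F 0 - t k *\<^sub>R D = of_real (t k) * (of_nat (Suc k) * (F (t k) - F 0) - D)"
      by (simp add: t_def scaleR_conv_of_real field_simps del: of_nat_Suc)
    then show ?thesis by (simp only: norm_mult norm_of_real real_norm_def) (simp add: t_def)
  qed
  ultimately have "(\<lambda>k. of_nat (Suc k) * (F (t k) - F 0) - D) \<longlonglongrightarrow> 0"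
    by (simp add: tendsto_norm_zero_iff)
  then show ?thesis unfolding t_def by (rule LIM_zero_cancel)
qed

lemma schwartz_line_derivative:
  assumes "f \<in> schwartz"
  shows "((\<lambda>s. f (x + s *\<^sub>R b)) has_vector_derivative partial b f (x + s *\<^sub>R b)) (at s within S)"
proof -
  have lin: "linear (frechet_derivative f (at (x + s *\<^sub>R b)))"
    using linear_frechet_derivative schwartz_differentiable assms by blast
  have "((\<lambda>s. f (x + s *\<^sub>R b)) has_derivative (\<lambda>h. frechet_derivative f (at (x + s *\<^sub>R b)) (h *\<^sub>R b))) (at s within S)"
    by (rule has_derivative_compose[OF _ schwartz_has_derivative[OF assms]]) (auto intro!: derivative_eq_intros)
  then show ?thesis
    unfolding has_vector_derivative_def by (simp add: linear_scale[OF lin])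
qed

lemma rapid_bound_weight:
  assumes "rapid f"
  obtains C where "C > 0" "\<And>x. norm (f x) \<le> C / (1 + norm x) ^ N"
proof -
  obtain C where C: "C > 0" "\<And>x. (1 + norm x) ^ N * norm (f x) \<le> C"
    using rapidD[OF assms] by blast
  have "norm (f x) \<le> C / (1 + norm x) ^ N" for x
  proof -
    have "0 < (1 + norm x) ^ N" by (simp add: add_pos_nonneg)
    then show ?thesis using C(2)[of x] by (simp add: pos_le_divide_eq mult.commute)
  qed
  then show ?thesis using that C(1) by blast
qed

text \<open>The mean value inequality along the segment from \<open>x\<close> to
  \<open>x + s *\<^sub>R b\<close>. Moving by at most 1 changes the weight by at most the factor
  \<open>2 ^ N\<close>, so the decay of the derivative survives; this supplies the integrable
  majorant of the difference quotients.\<close>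

lemma schwartz_difference_bound:
  fixes f :: "'a::euclidean_space \<Rightarrow> complex"
  assumes f: "f \<in> schwartz" and b: "b \<in> Basis"
  obtains C where "\<And>x s. 0 \<le> s \<Longrightarrow> s \<le> 1 \<Longrightarrow> norm (f (x + s *\<^sub>R b) - f x) \<le> C / (1 + norm x) ^ N * s"
proof -
  obtain C where C: "C > 0" "\<And>x. norm (partial b f x) \<le> C / (1 + norm x) ^ N"
    using rapid_bound_weight[OF schwartz_rapid[OF schwartz_partial[OF f b]]] by blast
  have "norm (f (x + s *\<^sub>R b) - f (x + 0 *\<^sub>R b)) \<le> (C * 2 ^ N / (1 + norm x) ^ N) * norm (s - 0)"
    if s: "0 \<le> s" "s \<le> 1" for x s
  proof (rule differentiable_bound[of "{0..1}" "\<lambda>s. f (x + s *\<^sub>R b)"])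
    fix t :: real assume t: "t \<in> {0..1}"
    show "((\<lambda>s. f (x + s *\<^sub>R b)) has_derivative (\<lambda>h. h *\<^sub>R partial b f (x + t *\<^sub>R b))) (at t within {0..1})"
      using schwartz_line_derivative[OF f] unfolding has_vector_derivative_def .
    have "norm x \<le> norm (x + t *\<^sub>R b) + norm (t *\<^sub>R b)"
      using norm_triangle_ineq4[of "x + t *\<^sub>R b" "t *\<^sub>R b"] by simp
    moreover have "norm (t *\<^sub>R b) \<le> 1" using t b by simp
    moreover have "a \<le> m + k \<Longrightarrow> k \<le> 1 \<Longrightarrow> 0 \<le> m \<Longrightarrow> 1 + a \<le> 2 * (1 + m)" for a m k :: real
      by simp
    ultimately have "1 + norm x \<le> 2 * (1 + norm (x + t *\<^sub>R b))"
      using norm_ge_zero by blast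
    from power_mono[OF this, of N, unfolded power_mult_distrib] have le: "(1 + norm x) ^ N \<le> 2 ^ N * (1 + norm (x + t *\<^sub>R b)) ^ N"
      by simp
    have pos: "0 < (1 + norm x) ^ N" "0 < (1 + norm (x + t *\<^sub>R b)) ^ N" by (simp_all add: add_pos_nonneg)
    have "norm (partial b f (x + t *\<^sub>R b)) \<le> C / (1 + norm (x + t *\<^sub>R b)) ^ N" by (rule C)
    also have "\<dots> \<le> C * 2 ^ N / (1 + norm x) ^ N"
      using mult_left_mono[OF le, of C] C(1) pos by (simp add: field_simps)
    finally have "norm (h *\<^sub>R partial b f (x + t *\<^sub>R b)) \<le> C * 2 ^ N / (1 + norm x) ^ N * norm h" for h
      by (metis mult.commute mult_right_mono norm_ge_zero norm_scaleR real_norm_def)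
    then show "onorm (\<lambda>h. h *\<^sub>R partial b f (x + t *\<^sub>R b)) \<le> C * 2 ^ N / (1 + norm x) ^ N"
      by (rule onorm_le)
  qed (use s in auto)
  then show ?thesis using that[of "C * 2 ^ N"] by fastforce
qed

text \<open>Translating by \<open>t b\<close> multiplies the Fourier transform by \<open>exp (\<i> t (b \<bullet> \<xi>))\<close>; the formula for
  the partial derivative is the limit of the difference quotients, without boundary terms.\<close>

lemma fourier_partial:
  fixes f :: "'a::euclidean_space \<Rightarrow> complex"
  assumes f: "f \<in> schwartz" and b: "b \<in> Basis"
  shows "fourier (partial b f) \<xi> = \<i> * of_real (b \<bullet> \<xi>) * fourier f \<xi>"
proof -
  note [measurable] = schwartz_measurable[OF f] schwartz_measurable[OF schwartz_partial[OF f b]]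
  obtain C where C: "\<And>x s. 0 \<le> s \<Longrightarrow> s \<le> 1 \<Longrightarrow> norm (f (x + s *\<^sub>R b) - f x) \<le> C / (1 + norm x) ^ (2 * DIM('a)) * s"
    using schwartz_difference_bound[OF f b] by metis
  define t where "t k = 1 / real (Suc k)" for k
  have t: "0 < t k" "t k \<le> 1" for k by (simp_all add: t_def)
  define q where "q k x = of_nat (Suc k) * (f (x + t k *\<^sub>R b) - f (x + 0 *\<^sub>R b))" for k x
  have "(\<lambda>k. \<integral>x. wave x \<xi> * q k x \<partial>lborel) \<longlonglongrightarrow> (\<integral>x. wave x \<xi> * partial b f x \<partial>lborel)"
  proof (rule integral_dominated_convergence[where w = "\<lambda>x. C * (1 / (1 + norm x) ^ (2 * DIM('a)))"])
    show "integrable lborel (\<lambda>x::'a. C * (1 / (1 + norm x) ^ (2 * DIM('a))))"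
      by (intro integrable_mult_right integrable_inverse_power_weight)
    have "(\<lambda>k. q k x) \<longlonglongrightarrow> partial b f x" for x
      unfolding q_def t_def using difference_quotient_limit[OF schwartz_line_derivative[OF f, of x b 0]] by simp
    then show "AE x in lborel. (\<lambda>k. wave x \<xi> * q k x) \<longlonglongrightarrow> wave x \<xi> * partial b f x"
      by (intro AE_I2 tendsto_mult_left)
    show "AE x in lborel. norm (wave x \<xi> * q k x) \<le> C * (1 / (1 + norm x) ^ (2 * DIM('a)))" for k
    proof (rule AE_I2)
      fix x :: 'a
      have "norm (q k x) \<le> real (Suc k) * (C / (1 + norm x) ^ (2 * DIM('a)) * t k)"
        unfolding q_def using mult_left_mono[OF C[of "t k" x], of "real (Suc k)"] t[of k]
        by (simp add: norm_mult del: of_nat_Suc)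
      then show "norm (wave x \<xi> * q k x) \<le> C * (1 / (1 + norm x) ^ (2 * DIM('a)))"
        by (simp add: norm_mult t_def del: of_nat_Suc)
    qed
  qed (simp_all add: q_def)
  then have "(\<lambda>k. fourier (q k) \<xi>) \<longlonglongrightarrow> fourier (partial b f) \<xi>"
    unfolding fourier_eq by (rule tendsto_mult_left)
  moreover have "fourier (q k) \<xi> = of_nat (Suc k) * (exp (\<i> * of_real (t k * (b \<bullet> \<xi>))) - exp (\<i> * of_real (0 * (b \<bullet> \<xi>)))) * fourier f \<xi>" for k
  proof -
    have i: "integrable lborel (\<lambda>x. f (t k *\<^sub>R b + x))"
      using lborel_integrable_affine[OF schwartz_integrable[OF f], of 1 "t k *\<^sub>R b"] by simp
    have "q k = (\<lambda>x. of_nat (Suc k) * f (t k *\<^sub>R b + x) + (- of_nat (Suc k)) * f x)"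
      unfolding q_def by (auto simp: algebra_simps)
    then have "fourier (q k) \<xi> = of_nat (Suc k) * fourier (\<lambda>x. f (t k *\<^sub>R b + x)) \<xi> + (- of_nat (Suc k)) * fourier f \<xi>"
      by (simp only: fourier_linear[OF i schwartz_integrable[OF f]])
    moreover have "fourier (\<lambda>x. f (t k *\<^sub>R b + x)) \<xi> = exp (\<i> * of_real (t k * (b \<bullet> \<xi>))) * fourier f \<xi>"
      using fourier_affine[of f 1 "t k *\<^sub>R b" \<xi>] by simp
    ultimately show ?thesis
      by (simp add: left_diff_distrib right_diff_distrib mult.assoc del: of_nat_Suc)
  qed
  moreover have "(\<lambda>k. of_nat (Suc k) * (exp (\<i> * of_real (t k * (b \<bullet> \<xi>))) - exp (\<i> * of_real (0 * (b \<bullet> \<xi>)))) * fourier f \<xi>)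
      \<longlonglongrightarrow> \<i> * of_real (b \<bullet> \<xi>) * fourier f \<xi>"
  proof (rule tendsto_mult_right, unfold t_def, rule difference_quotient_limit)
    have "((\<lambda>s. exp (\<i> * (s * complex_of_real (b \<bullet> \<xi>)))) has_field_derivative \<i> * of_real (b \<bullet> \<xi>)) (at (of_real 0))"
      by (auto intro!: derivative_eq_intros)
    from has_vector_derivative_real_field[OF this, of UNIV]
    show "((\<lambda>s. exp (\<i> * complex_of_real (s * (b \<bullet> \<xi>)))) has_vector_derivative \<i> * of_real (b \<bullet> \<xi>)) (at 0)"
      by simp
  qed
  ultimately show ?thesis by (simp add: LIMSEQ_unique)
qed

text \<open>Each power of \<open>norm \<xi>\<close> is traded for one derivative of
  \<open>f\<close>: the norm is at most the sum of the moduli of the coordinates, and a coordinate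
  times the transform is, up to a unit, the transform of a partial derivative. The induction has to
  range over all Schwartz functions because \<open>f\<close> changes.\<close>

lemma norm_fourier_rapid:
  fixes f :: "'a::euclidean_space \<Rightarrow> complex"
  assumes "f \<in> schwartz"
  shows "\<exists>C. \<forall>\<xi>. (1 + norm \<xi>) ^ N * norm (fourier f \<xi>) \<le> C"
  using assms
proof (induction N arbitrary: f)
  case 0
  then show ?case using norm_fourier_le[OF schwartz_integrable] by fastforce
next
  case (Suc N)
  obtain C where C: "\<And>\<xi>. (1 + norm \<xi>) ^ N * norm (fourier f \<xi>) \<le> C" using Suc by blast
  have "\<forall>b\<in>Basis. \<exists>D. \<forall>\<xi>. (1 + norm \<xi>) ^ N * norm (fourier (partial b f) \<xi>) \<le> D"
    using Suc.IH schwartz_partial[OF Suc.prems] by blast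
  then obtain D where D: "\<And>b \<xi>. b \<in> Basis \<Longrightarrow> (1 + norm \<xi>) ^ N * norm (fourier (partial b f) \<xi>) \<le> D b"
    by metis
  have "(1 + norm \<xi>) ^ Suc N * norm (fourier f \<xi>) \<le> C + (\<Sum>b\<in>Basis. D b)" for \<xi>
  proof -
    have "norm \<xi> * norm (fourier f \<xi>) \<le> (\<Sum>b\<in>Basis. \<bar>\<xi> \<bullet> b\<bar>) * norm (fourier f \<xi>)"
      by (intro mult_right_mono norm_le_l1) auto
    also have "\<dots> = (\<Sum>b\<in>Basis. norm (fourier (partial b f) \<xi>))"
      by (simp add: sum_distrib_right fourier_partial[OF Suc.prems] norm_mult inner_commute)
    finally have "(1 + norm \<xi>) ^ N * (norm \<xi> * norm (fourier f \<xi>)) \<le> (1 + norm \<xi>) ^ N * (\<Sum>b\<in>Basis. norm (fourier (partial b f) \<xi>))"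
      by (intro mult_left_mono) auto
    also have "\<dots> \<le> (\<Sum>b\<in>Basis. D b)"
      unfolding sum_distrib_left by (intro sum_mono D)
    finally show ?thesis using C[of \<xi>] by (simp add: algebra_simps)
  qed
  then show ?case by blast
qed

text \<open>Differentiation under the integral with an explicit remainder: the first-order Taylor
  polynomial of the exponential has an error of second order in \<open>x \<bullet> v\<close>, so the
  total error is at most \<open>(norm v)\<^sup>2\<close> times a second moment of \<open>f\<close>,
  which is finite.\<close>

lemma fourier_has_derivative:
  fixes f :: "'a::euclidean_space \<Rightarrow> complex"
  assumes f: "f \<in> schwartz"
  shows "(fourier f has_derivative (\<lambda>v. fourier (\<lambda>x. - \<i> * (of_real (x \<bullet> v) * f x)) \<xi>)) (at \<xi>)"
proof -
  note [measurable] = schwartz_measurable[OF f]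
  have int: "integrable lborel (\<lambda>x. - \<i> * (of_real (x \<bullet> v) * f x))" for v
    by (intro schwartz_integrable schwartz_cmult schwartz_coord_mult f)
  have int1: "integrable lborel (\<lambda>x. norm x * norm (f x))"
    by (rule Bochner_Integration.integrable_bound[OF integrable_norm[OF rapid_integrable[OF _ schwartz_rapid[OF f], of 1]]])
      (auto simp: mult_right_mono)
  have int2: "integrable lborel (\<lambda>x. (norm x)\<^sup>2 * norm (f x))"
    by (rule Bochner_Integration.integrable_bound[OF integrable_norm[OF rapid_integrable[OF _ schwartz_rapid[OF f], of 2]]])
      (auto simp: mult_right_mono power_mono)
  define c where "c = (2 * pi) powr (- real DIM('a) / 2)"
  define K where "K = c * (\<integral>x. (norm x)\<^sup>2 * norm (f x) \<partial>lborel)"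
  let ?D = "\<lambda>v. fourier (\<lambda>x. - \<i> * (of_real (x \<bullet> v) * f x)) \<xi>"
  show ?thesis
  proof (rule has_derivativeI_sandwich[where e = 1 and H = "\<lambda>y. K * norm (y - \<xi>)"])
    show "bounded_linear ?D"
    proof (rule bounded_linear_intro[where K = "c * (\<integral>x. norm x * norm (f x) \<partial>lborel)"])
      fix v w :: 'a and r :: real
      have "(\<lambda>x. - \<i> * (of_real (x \<bullet> (v + w)) * f x)) = (\<lambda>x. 1 * (- \<i> * (of_real (x \<bullet> v) * f x)) + 1 * (- \<i> * (of_real (x \<bullet> w) * f x)))"
        by (simp add: inner_add_right algebra_simps)
      then show "?D (v + w) = ?D v + ?D w"
        using fourier_linear[OF int[of v] int[of w], of 1 1 \<xi>] by (simp only: mult_1)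
      have "(\<lambda>x. - \<i> * (of_real (x \<bullet> (r *\<^sub>R v)) * f x)) = (\<lambda>x. of_real r * (- \<i> * (of_real (x \<bullet> v) * f x)))"
        by (simp add: algebra_simps)
      then show "?D (r *\<^sub>R v) = r *\<^sub>R ?D v"
        by (simp only: fourier_cmult scaleR_conv_of_real)
      have "norm (?D v) \<le> c * (\<integral>x. norm (- \<i> * (of_real (x \<bullet> v) * f x)) \<partial>lborel)"
        unfolding c_def by (rule norm_fourier_le[OF int])
      also have "\<dots> \<le> c * (\<integral>x. norm v * (norm x * norm (f x)) \<partial>lborel)"
      proof (intro mult_left_mono integral_mono integrable_mult_right int1)
        show "integrable lborel (\<lambda>x. norm (- \<i> * (of_real (x \<bullet> v) * f x)))" using int by (rule integrable_norm)
        show "norm (- \<i> * (of_real (x \<bullet> v) * f x)) \<le> norm v * (norm x * norm (f x))" for x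
          using mult_right_mono[OF Cauchy_Schwarz_ineq2[of x v], of "norm (f x)"] by (simp add: norm_mult mult_ac)
      qed (simp add: c_def)
      also have "\<dots> = norm v * (c * (\<integral>x. norm x * norm (f x) \<partial>lborel))" by simp
      finally show "norm (?D v) \<le> norm v * (c * (\<integral>x. norm x * norm (f x) \<partial>lborel))" .
    qed
    fix \<eta> assume "\<eta> \<noteq> \<xi>"
    define v where "v = \<eta> - \<xi>"
    have v: "\<eta> = \<xi> + v" by (simp add: v_def)
    have pw: "norm (wave x \<eta> * f x - wave x \<xi> * f x - wave x \<xi> * (- \<i> * (of_real (x \<bullet> v) * f x))) \<le> (norm v)\<^sup>2 * ((norm x)\<^sup>2 * norm (f x))" for x
    proof -
      have "cmod (iexp (- (x \<bullet> v)) - (\<Sum>k\<le>1. (\<i> * of_real (- (x \<bullet> v))) ^ k / fact k)) \<le> \<bar>- (x \<bullet> v)\<bar> ^ Suc 1 / fact (Suc 1)"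
        by (rule iexp_approx1)
      then have "cmod (wave x v - 1 + \<i> * of_real (x \<bullet> v)) \<le> \<bar>x \<bullet> v\<bar>\<^sup>2 / 2"
        by (simp add: power2_eq_square algebra_simps)
      also have "\<dots> \<le> \<bar>x \<bullet> v\<bar>\<^sup>2" by simp
      also have "\<dots> \<le> (norm x * norm v)\<^sup>2"
        by (rule power_mono[OF Cauchy_Schwarz_ineq2]) simp
      finally have *: "cmod (wave x v - 1 + \<i> * of_real (x \<bullet> v)) \<le> (norm x * norm v)\<^sup>2" .
      have "wave x \<eta> = wave x \<xi> * wave x v"
        unfolding v by (simp add: exp_add[symmetric] inner_add_right algebra_simps)
      moreover have "(W * V) * F - W * F - W * (- \<i> * (s * F)) = W * ((V - 1 + \<i> * s) * F)" for W V F s :: complex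
        by (simp add: algebra_simps)
      ultimately have "wave x \<eta> * f x - wave x \<xi> * f x - wave x \<xi> * (- \<i> * (of_real (x \<bullet> v) * f x))
          = wave x \<xi> * ((wave x v - 1 + \<i> * of_real (x \<bullet> v)) * f x)"
        by (simp only:)
      then have "norm (wave x \<eta> * f x - wave x \<xi> * f x - wave x \<xi> * (- \<i> * (of_real (x \<bullet> v) * f x)))
          = norm (wave x v - 1 + \<i> * of_real (x \<bullet> v)) * norm (f x)"
        by (simp only: norm_mult norm_wave mult_1)
      also have "\<dots> \<le> (norm x * norm v)\<^sup>2 * norm (f x)" by (intro mult_right_mono *) auto
      finally show ?thesis by (simp add: power_mult_distrib mult_ac)
    qed
    have "norm (fourier f \<eta> - fourier f \<xi> - ?D v)
      = c * norm (\<integral>x. wave x \<eta> * f x - wave x \<xi> * f x - wave x \<xi> * (- \<i> * (of_real (x \<bullet> v) * f x)) \<partial>lborel)"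
      unfolding fourier_eq right_diff_distrib[symmetric] norm_mult c_def
      using integrable_wave[OF schwartz_integrable[OF f]] integrable_wave[OF int] by simp
    also have "\<dots> \<le> c * (\<integral>x. (norm v)\<^sup>2 * ((norm x)\<^sup>2 * norm (f x)) \<partial>lborel)"
      by (intro mult_left_mono Bochner_Integration.integral_norm_bound_integral integrable_mult_right int2
          Bochner_Integration.integrable_diff integrable_wave schwartz_integrable[OF f] int pw)
        (simp add: c_def)
    also have "\<dots> = K * norm v * norm v" by (simp add: K_def power2_eq_square)
    finally show "norm (fourier f \<eta> - fourier f \<xi> - ?D (\<eta> - \<xi>)) / norm (\<eta> - \<xi>) \<le> K * norm (\<eta> - \<xi>)"
      using \<open>\<eta> \<noteq> \<xi>\<close> unfolding v_def by (simp add: divide_le_eq)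
  next
    show "((\<lambda>y. K * norm (y - \<xi>)) \<longlongrightarrow> 0) (at \<xi>)"
      by (rule tendsto_eq_intros refl | simp)+
  qed simp
qed

text \<open>The set of all transforms of Schwartz functions is itself the invariant: differentiating
  a transform multiplies the original function by a coordinate.\<close>

lemma fourier_schwartz:
  assumes "f \<in> schwartz" shows "fourier f \<in> schwartz"
proof (rule schwartz_coinduct[where X = "fourier ` schwartz"])
  show "g differentiable at x" if "g \<in> fourier ` schwartz" for g :: "'a \<Rightarrow> complex" and x
    using that fourier_has_derivative differentiableI by blast
  show "rapid g" if "g \<in> fourier ` schwartz" for g :: "'a \<Rightarrow> complex"
    using that norm_fourier_rapid unfolding rapid_def by blast
  fix g :: "'a \<Rightarrow> complex" and b :: 'a assume "g \<in> fourier ` schwartz" "b \<in> Basis"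
  then obtain f where f: "f \<in> schwartz" "g = fourier f" by blast
  have "partial b g = fourier (\<lambda>x. - \<i> * (of_real (x \<bullet> b) * f x))"
    unfolding f(2) by (simp add: frechet_derivative_at[OF fourier_has_derivative[OF f(1)], symmetric])
  then show "partial b g \<in> fourier ` schwartz"
    using schwartz_cmult[OF schwartz_coord_mult[OF f(1)]] by blast
qed (use assms in auto)

lemma inv_fourier_schwartz:
  assumes "f \<in> schwartz" shows "inv_fourier f \<in> schwartz"
proof -
  have "inv_fourier f = (\<lambda>x. fourier f ((- 1) *\<^sub>R x))"
    by (simp add: inv_fourier_eq_fourier[abs_def])
  then show ?thesis using schwartz_scale[OF fourier_schwartz[OF assms], of "-1"] by simp
qed

section \<open>The Gaussian and the inversion theorem\<close>

lemma lborel_integral_prod: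
  fixes g :: "'a::euclidean_space \<Rightarrow> real \<Rightarrow> complex"
  assumes "\<And>b. b \<in> Basis \<Longrightarrow> integrable lborel (g b)"
  shows "(\<integral>x. (\<Prod>b\<in>Basis. g b (x \<bullet> b)) \<partial>lborel) = (\<Prod>b\<in>(Basis::'a set). \<integral>t. g b t \<partial>lborel)"
proof -
  interpret product_sigma_finite "\<lambda>b::'a. interval_measure (\<lambda>x. x)"
    using sigma_finite_lborel[where 'a = real] by (simp add: product_sigma_finite_def lborel_eq_real)
  have [measurable]: "b \<in> Basis \<Longrightarrow> g b \<in> borel_measurable borel" for b using assms[of b] by auto
  have "(\<integral>x. (\<Prod>b\<in>Basis. g b (x \<bullet> b)) \<partial>lborel)
      = (\<integral>x. (\<Prod>b\<in>(Basis::'a set). g b (x b)) \<partial>(\<Pi>\<^sub>M b\<in>(Basis::'a set). interval_measure (\<lambda>x. x)))"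
    unfolding lborel_def by (subst integral_distr) simp_all
  also have "\<dots> = (\<Prod>b\<in>(Basis::'a set). \<integral>t. g b t \<partial>interval_measure (\<lambda>x. x))"
    using assms by (intro product_integral_prod) (simp_all add: lborel_eq_real)
  finally show ?thesis by (simp add: lborel_eq_real)
qed

text \<open>The standard normal density. The product form reduces integrals to dimension one. In
  this normalisation it has integral 1 and is a fixed point of \<open>fourier\<close>, so it can
  serve both as convergence factor and as approximate identity.\<close>

definition gauss :: "'a::euclidean_space \<Rightarrow> real" where
  "gauss x = (\<Prod>b\<in>Basis. std_normal_density (x \<bullet> b))"

lemma norm_power2_eq_sum: "(norm (x::'a::euclidean_space))\<^sup>2 = (\<Sum>b\<in>Basis. (x \<bullet> b)\<^sup>2)"
  unfolding power2_norm_eq_inner by (subst euclidean_inner) (simp add: power2_eq_square)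

lemma gauss_eq: "gauss (x::'a::euclidean_space) = (2 * pi) powr (- real DIM('a) / 2) * exp (- (norm x)\<^sup>2 / 2)"
proof -
  have "(\<Prod>b\<in>Basis. exp (- (x \<bullet> b)\<^sup>2 / 2)) = exp (- (norm x)\<^sup>2 / 2)"
    by (simp add: norm_power2_eq_sum exp_sum[symmetric] sum_negf sum_divide_distrib)
  moreover have "(1 / sqrt (2 * pi)) ^ DIM('a) = (2 * pi) powr (- real DIM('a) / 2)"
    by (simp add: powr_half_sqrt[symmetric] powr_minus_divide[symmetric] powr_power)
  ultimately show ?thesis
    unfolding gauss_def std_normal_density_def by (simp only: prod.distrib prod_constant)
qed

lemma gauss_nonneg: "gauss x \<ge> 0"
  by (simp add: gauss_eq)

lemma gauss_measurable [measurable]: "gauss \<in> borel_measurable borel"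
  unfolding gauss_def[abs_def] by measurable

lemma nn_integral_gauss: "(\<integral>\<^sup>+x. ennreal (gauss (x::'a::euclidean_space)) \<partial>lborel) = 1"
proof -
  have "(\<integral>\<^sup>+x. ennreal (gauss (x::'a)) \<partial>lborel) = (\<integral>\<^sup>+x. (\<Prod>b\<in>(Basis::'a set). ennreal (std_normal_density (x \<bullet> b))) \<partial>lborel)"
    by (simp add: gauss_def prod_ennreal)
  also have "\<dots> = (\<Prod>b\<in>(Basis::'a set). (\<integral>\<^sup>+t. ennreal (std_normal_density t) \<partial>lborel))"
    by (rule nn_integral_lborel_prod) auto
  also have "(\<integral>\<^sup>+t. ennreal (std_normal_density t) \<partial>lborel) = 1"
    by (subst nn_integral_eq_integral) (auto simp: integral_normal_density)
  finally show ?thesis by simp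
qed

lemma gauss_integrable: "integrable lborel gauss"
  by (rule integrableI_bounded) (simp_all add: gauss_nonneg nn_integral_gauss)

lemma integral_gauss: "(\<integral>x. gauss x \<partial>lborel) = 1"
  by (subst integral_eq_nn_integral) (simp_all add: gauss_nonneg nn_integral_gauss)

lemma fourier_std_normal_density:
  "(\<integral>t. exp (- \<i> * complex_of_real (t * s)) * complex_of_real (std_normal_density t) \<partial>lborel) = complex_of_real (exp (- s\<^sup>2 / 2))"
proof -
  have "char std_normal_distribution (- s) = (\<integral>t. std_normal_density t *\<^sub>R iexp (- s * t) \<partial>lborel)"
    unfolding char_def by (subst integral_density) auto
  then show ?thesis
    by (simp add: char_std_normal_distribution scaleR_conv_of_real mult_ac)
qed

lemma fourier_gauss: "fourier (\<lambda>x. complex_of_real (gauss x)) = (\<lambda>\<xi>::'a::euclidean_space. complex_of_real (gauss \<xi>))"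
proof
  fix \<xi> :: 'a
  have "wave x \<xi> = (\<Prod>b\<in>Basis. exp (- \<i> * complex_of_real ((x \<bullet> b) * (\<xi> \<bullet> b))))" for x
    by (simp add: exp_sum[symmetric] sum_negf sum_distrib_left[symmetric] of_real_sum[symmetric] euclidean_inner[of x \<xi>]
        del: of_real_mult of_real_sum)
  then have "(\<integral>x. wave x \<xi> * complex_of_real (gauss x) \<partial>lborel)
     = (\<integral>x. (\<Prod>b\<in>Basis. exp (- \<i> * complex_of_real ((x \<bullet> b) * (\<xi> \<bullet> b))) * complex_of_real (std_normal_density (x \<bullet> b))) \<partial>lborel)"
    unfolding gauss_def by (simp only: of_real_prod prod.distrib)
  also have "\<dots> = (\<Prod>b\<in>Basis. \<integral>t. exp (- \<i> * complex_of_real (t * (\<xi> \<bullet> b))) * complex_of_real (std_normal_density t) \<partial>lborel)"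
  proof (rule lborel_integral_prod)
    show "integrable lborel (\<lambda>t. exp (- \<i> * complex_of_real (t * (\<xi> \<bullet> b))) * complex_of_real (std_normal_density t))" for b
      using integrable_wave[of "\<lambda>t. complex_of_real (std_normal_density t)" "\<xi> \<bullet> b"] integrable_normal_density[of 1 0]
      by simp
  qed
  also have "\<dots> = complex_of_real (exp (- (norm \<xi>)\<^sup>2 / 2))"
    unfolding fourier_std_normal_density
    by (simp add: norm_power2_eq_sum exp_sum[symmetric] sum_negf sum_divide_distrib
        of_real_prod[symmetric] del: of_real_prod)
  finally show "fourier (\<lambda>x. complex_of_real (gauss x)) \<xi> = complex_of_real (gauss \<xi>)"
    unfolding fourier_eq gauss_eq by simp
qed

lemma fourier_modulate: "fourier (\<lambda>x. wave x a * f x) \<xi> = fourier f (\<xi> + a)"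
proof -
  have "wave x \<xi> * (wave x a * f x) = wave x (\<xi> + a) * f x" for x
  proof -
    have "wave x (\<xi> + a) = wave x \<xi> * wave x a"
      by (simp add: exp_add[symmetric] inner_add_right algebra_simps)
    then show ?thesis by (simp only: mult.assoc)
  qed
  then show ?thesis unfolding fourier_eq by (simp only:)
qed

text \<open>The iterated integral need not converge absolutely, so a factor
  \<open>gauss (e k *\<^sub>R \<xi>)\<close> is inserted. The multiplication formula moves the
  transform from \<open>f\<close> to this factor, which becomes an approximate identity of width
  \<open>e k\<close> at \<open>x\<close>; dominated convergence then applies on both sides.\<close>

lemma fourier_inversion:
  fixes f :: "'a::euclidean_space \<Rightarrow> complex"
  assumes f: "f \<in> schwartz"
  shows "inv_fourier (fourier f) x = f x"
proof -
  note [measurable] = schwartz_measurable[OF f] schwartz_measurable[OF fourier_schwartz[OF f]]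
  let ?G = "\<lambda>x::'a. complex_of_real (gauss x)"
  have G: "integrable lborel ?G" by (intro integrable_of_real gauss_integrable)
  define e where "e k = 1 / real (Suc k)" for k
  have e: "e k > 0" for k by (simp add: e_def)
  have e0: "e \<longlonglongrightarrow> 0" unfolding e_def using LIMSEQ_inverse_real_of_nat by (simp add: inverse_eq_divide)
  have cont: "continuous_on UNIV gauss" unfolding gauss_eq[abs_def] by (auto intro!: continuous_intros)
  have *: "(\<integral>\<xi>. fourier f \<xi> * (wave \<xi> (- x) * ?G (0 + e k *\<^sub>R \<xi>)) \<partial>lborel) = (\<integral>z. f (x + e k *\<^sub>R z) * ?G z \<partial>lborel)" for k
  proof -
    have "(\<integral>\<xi>. fourier f \<xi> * (wave \<xi> (- x) * ?G (0 + e k *\<^sub>R \<xi>)) \<partial>lborel)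
        = (\<integral>y. f y * fourier (\<lambda>\<xi>. wave \<xi> (- x) * ?G (0 + e k *\<^sub>R \<xi>)) y \<partial>lborel)"
      by (intro fourier_multiplication_formula schwartz_integrable f integrable_wave lborel_integrable_affine G) (simp add: e_def)
    also have "\<dots> = (\<integral>y. f y * (of_real (1 / e k ^ DIM('a)) * ?G ((y - x) /\<^sub>R e k)) \<partial>lborel)"
      unfolding fourier_modulate using e[of k]
      by (subst fourier_affine) (simp_all add: fourier_gauss)
    also have "\<dots> = \<bar>e k\<bar> ^ DIM('a) *\<^sub>R (\<integral>z. f (x + e k *\<^sub>R z) * (of_real (1 / e k ^ DIM('a)) * ?G ((x + e k *\<^sub>R z - x) /\<^sub>R e k)) \<partial>lborel)"
      using e[of k] by (intro lborel_integral_affine) simp_all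
    also have "\<dots> = (\<integral>z. f (x + e k *\<^sub>R z) * ?G z \<partial>lborel)"
      using e[of k] by (simp add: mult.left_commute[of "f _"] scaleR_conv_of_real)
    finally show ?thesis .
  qed
  have "(\<lambda>k. \<integral>z. f (x + e k *\<^sub>R z) * ?G z \<partial>lborel) \<longlonglongrightarrow> (\<integral>z. f (x + 0 *\<^sub>R z) * ?G z \<partial>lborel)"
  proof -
    obtain K where K: "\<And>x. norm (f x) \<le> K" using schwartz_bounded[OF f] by metis
    show ?thesis
    proof (rule integral_dominated_convergence[where w = "\<lambda>z. K * gauss z"])
      show "AE z in lborel. (\<lambda>k. f (x + e k *\<^sub>R z) * ?G z) \<longlonglongrightarrow> f (x + 0 *\<^sub>R z) * ?G z"
        by (intro AE_I2 tendsto_intros continuous_on_tendsto_compose[OF schwartz_continuous[OF f, of UNIV]] e0) auto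
      show "AE z in lborel. norm (f (x + e k *\<^sub>R z) * ?G z) \<le> K * gauss z" for k
        by (intro AE_I2) (simp add: norm_mult gauss_nonneg mult_right_mono K)
    qed (use gauss_integrable in auto)
  qed
  moreover have "(\<lambda>k. \<integral>\<xi>. fourier f \<xi> * (wave \<xi> (- x) * ?G (0 + e k *\<^sub>R \<xi>)) \<partial>lborel)
      \<longlonglongrightarrow> (\<integral>\<xi>. fourier f \<xi> * (wave \<xi> (- x) * ?G (0 + 0 *\<^sub>R \<xi>)) \<partial>lborel)"
  proof (rule integral_dominated_convergence[where w = "\<lambda>\<xi>. norm (fourier f \<xi>) * gauss (0::'a)"])
    show "integrable lborel (\<lambda>\<xi>. norm (fourier f \<xi>) * gauss (0::'a))"
      using schwartz_integrable[OF fourier_schwartz[OF f]] by simp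
    show "AE \<xi> in lborel. (\<lambda>k. fourier f \<xi> * (wave \<xi> (- x) * ?G (0 + e k *\<^sub>R \<xi>)))
        \<longlonglongrightarrow> fourier f \<xi> * (wave \<xi> (- x) * ?G (0 + 0 *\<^sub>R \<xi>))"
      by (intro AE_I2 tendsto_intros continuous_on_tendsto_compose[OF cont] e0) auto
    have "gauss z \<le> gauss (0::'a)" for z :: 'a by (simp add: gauss_eq)
    then show "AE \<xi> in lborel. norm (fourier f \<xi> * (wave \<xi> (- x) * ?G (0 + e k *\<^sub>R \<xi>))) \<le> norm (fourier f \<xi>) * gauss (0::'a)" for k
      by (intro AE_I2) (simp add: norm_mult gauss_nonneg mult_left_mono)
  qed simp_all
  ultimately have "(\<integral>\<xi>. fourier f \<xi> * (wave \<xi> (- x) * ?G (0 + 0 *\<^sub>R \<xi>)) \<partial>lborel) = (\<integral>z. f (x + 0 *\<^sub>R z) * ?G z \<partial>lborel)"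
    unfolding * by (rule LIMSEQ_unique[rotated])
  moreover have "\<dots> = f x" by (simp add: integral_gauss)
  moreover have "(\<integral>\<xi>. fourier f \<xi> * (wave \<xi> (- x) * ?G (0 + 0 *\<^sub>R \<xi>)) \<partial>lborel) = inv_fourier (fourier f) x"
  proof -
    \<comment> \<open>The limit of the convergence factor is not 1 but the normalising constant of
      the transform, which is the one that \<open>inv_fourier\<close> still lacks.\<close>
    have "?G (0 + 0 *\<^sub>R \<xi>) = fconst TYPE('a)" for \<xi> by (simp add: gauss_eq)
    then have "(\<lambda>\<xi>. fourier f \<xi> * (wave \<xi> (- x) * ?G (0 + 0 *\<^sub>R \<xi>))) = (\<lambda>\<xi>. fconst TYPE('a) * (wave \<xi> (- x) * fourier f \<xi>))"
      by (simp only: mult_ac)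
    then show ?thesis
      unfolding inv_fourier_eq_fourier fourier_eq[of "fourier f"] by (simp only: integral_mult_right_zero)
  qed
  ultimately show ?thesis by (simp only:)
qed

lemma fourier_inv_fourier:
  fixes f :: "'a::euclidean_space \<Rightarrow> complex"
  assumes "f \<in> schwartz" shows "fourier (inv_fourier f) \<xi> = f \<xi>"
proof -
  have [measurable]: "fourier f \<in> borel_measurable borel" by (intro schwartz_measurable fourier_schwartz assms)
  have "inv_fourier f = (\<lambda>x. fourier f (0 + (- 1) *\<^sub>R x))"
    by (simp add: inv_fourier_eq_fourier[abs_def])
  then have "fourier (inv_fourier f) \<xi> = of_real (1 / \<bar>- 1\<bar> ^ DIM('a)) * (wave (- 0) (\<xi> /\<^sub>R (- 1)) * fourier (fourier f) (\<xi> /\<^sub>R (- 1)))"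
    by (simp only:) (rule fourier_affine, simp_all)
  then have "fourier (inv_fourier f) \<xi> = fourier (fourier f) (- \<xi>)" by simp
  then show ?thesis using fourier_inversion[OF assms, of \<xi>] by (simp add: inv_fourier_eq_fourier)
qed

section \<open>Littlewood-Paley blocks of Schwartz functions\<close>

definition block :: "('a::euclidean_space \<Rightarrow> complex) \<Rightarrow> nat \<Rightarrow> ('a \<Rightarrow> complex) \<Rightarrow> 'a \<Rightarrow> complex" where
  "block \<phi>0 j f = inv_fourier (\<lambda>\<xi>. resolution \<phi>0 j \<xi> * fourier f \<xi>)"

lemma resolution_schwartz:
  assumes "\<phi>0 \<in> schwartz" shows "resolution \<phi>0 j \<in> schwartz"
proof (cases "j = 0")
  case True
  then show ?thesis using assms by (simp add: resolution_def[abs_def])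
next
  case False
  have "(\<lambda>x. \<phi>0 (2 powr (- real j) *\<^sub>R x) - \<phi>0 (2 powr (- real j + 1) *\<^sub>R x)) \<in> schwartz"
    by (intro schwartz_diff schwartz_scale assms) simp_all
  then show ?thesis using False by (simp add: resolution_def[abs_def])
qed

lemma block_schwartz: "\<phi>0 \<in> schwartz \<Longrightarrow> f \<in> schwartz \<Longrightarrow> block \<phi>0 j f \<in> schwartz"
  unfolding block_def by (intro inv_fourier_schwartz schwartz_mult resolution_schwartz fourier_schwartz)

lemma inv_fourier_multiplication_formula:
  fixes f g :: "'a::euclidean_space \<Rightarrow> complex"
  assumes f: "integrable lborel f" and g: "integrable lborel g"
  shows "(\<integral>x. inv_fourier f x * g x \<partial>lborel) = (\<integral>\<xi>. f \<xi> * inv_fourier g \<xi> \<partial>lborel)"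
proof -
  have [measurable]: "f \<in> borel_measurable borel" "g \<in> borel_measurable borel" "fourier f \<in> borel_measurable borel"
    using f g fourier_measurable by auto
  have g': "integrable lborel (\<lambda>x. g (0 + (- 1) *\<^sub>R x))"
    by (rule lborel_integrable_affine[OF g]) simp
  have "(\<integral>x. inv_fourier f x * g x \<partial>lborel) = (\<integral>x. fourier f (- x) * g x \<partial>lborel)"
    by (simp add: inv_fourier_eq_fourier)
  also have "\<dots> = \<bar>- 1\<bar> ^ DIM('a) *\<^sub>R (\<integral>x. fourier f (- (0 + (- 1) *\<^sub>R x)) * g (0 + (- 1) *\<^sub>R x) \<partial>lborel)"
    by (rule lborel_integral_affine) simp_all
  also have "\<dots> = (\<integral>x. fourier f x * g (0 + (- 1) *\<^sub>R x) \<partial>lborel)" by simp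
  also have "\<dots> = (\<integral>\<xi>. f \<xi> * fourier (\<lambda>x. g (0 + (- 1) *\<^sub>R x)) \<xi> \<partial>lborel)"
    by (rule fourier_multiplication_formula[OF f g'])
  also have "fourier (\<lambda>x. g (0 + (- 1) *\<^sub>R x)) = inv_fourier g"
  proof
    fix \<xi>
    have "fourier (\<lambda>x. g (0 + (- 1) *\<^sub>R x)) \<xi> = of_real (1 / \<bar>- 1\<bar> ^ DIM('a)) * (wave (- 0) (\<xi> /\<^sub>R (- 1)) * fourier g (\<xi> /\<^sub>R (- 1)))"
      by (rule fourier_affine) simp_all
    then show "fourier (\<lambda>x. g (0 + (- 1) *\<^sub>R x)) \<xi> = inv_fourier g \<xi>"
      by (simp add: inv_fourier_eq_fourier)
  qed
  finally show ?thesis .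
qed

text \<open>Distributional operations act on the test function; two applications of the
  multiplication formula move them back to \<open>f\<close>.\<close>

lemma block_represents:
  assumes \<phi>: "\<phi>0 \<in> schwartz" and f: "f \<in> schwartz"
  shows "represents (block \<phi>0 j f)
    (distr_inv_fourier (distr_mult (resolution \<phi>0 j) (distr_fourier (regular_distr f))))"
  unfolding represents_def
proof (intro conjI ballI)
  show "block \<phi>0 j f \<in> borel_measurable lborel"
    using schwartz_measurable[OF block_schwartz[OF \<phi> f]] by simp
  fix \<psi> :: "'a \<Rightarrow> complex" assume \<psi>: "\<psi> \<in> schwartz"
  show "integrable lborel (\<lambda>x. block \<phi>0 j f x * \<psi> x)"
    by (intro schwartz_integrable schwartz_mult block_schwartz \<phi> f \<psi>)
  note S = resolution_schwartz[OF \<phi>] fourier_schwartz inv_fourier_schwartz f \<psi> schwartz_mult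
  have "(\<integral>x. f x * fourier (\<lambda>x. resolution \<phi>0 j x * inv_fourier \<psi> x) x \<partial>lborel)
      = (\<integral>\<xi>. fourier f \<xi> * (resolution \<phi>0 j \<xi> * inv_fourier \<psi> \<xi>) \<partial>lborel)"
    by (rule fourier_multiplication_formula[symmetric]) (intro schwartz_integrable S)+
  also have "\<dots> = (\<integral>\<xi>. (resolution \<phi>0 j \<xi> * fourier f \<xi>) * inv_fourier \<psi> \<xi> \<partial>lborel)"
    by (simp only: mult_ac)
  also have "\<dots> = (\<integral>x. block \<phi>0 j f x * \<psi> x \<partial>lborel)"
    unfolding block_def by (rule inv_fourier_multiplication_formula[symmetric]) (intro schwartz_integrable S)+
  finally show "distr_inv_fourier (distr_mult (resolution \<phi>0 j) (distr_fourier (regular_distr f))) \<psi> = regular_distr (block \<phi>0 j f) \<psi>"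
    by (simp add: distr_inv_fourier_def distr_mult_def distr_fourier_def regular_distr_def)
qed

section \<open>Pointwise convergence of the series of blocks\<close>

lemma sum_resolution: "(\<Sum>j\<le>J. resolution \<phi>0 j \<xi>) = \<phi>0 (2 powr (- real J) *\<^sub>R \<xi>)"
proof (induction J)
  case (Suc J)
  have "- real (Suc J) + 1 = - real J" by simp
  then show ?case using Suc by (simp only: sum.atMost_Suc resolution_def) simp
qed (simp add: resolution_def)

lemma two_powr_minus_of_nat: "2 powr (- real j) = inverse (2 ^ j)"
  unfolding powr_minus by (subst powr_realpow) simp_all

lemma sum_block:
  assumes \<phi>: "\<phi>0 \<in> schwartz" and f: "f \<in> schwartz"
  shows "(\<Sum>j\<le>J. block \<phi>0 j f x) = inv_fourier (\<lambda>\<xi>. \<phi>0 (2 powr (- real J) *\<^sub>R \<xi>) * fourier f \<xi>) x"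
proof -
  have "(\<Sum>j\<le>J. 1 * fourier (\<lambda>\<xi>. resolution \<phi>0 j \<xi> * fourier f \<xi>) (- x))
      = fourier (\<lambda>\<xi>. \<Sum>j\<le>J. 1 * (resolution \<phi>0 j \<xi> * fourier f \<xi>)) (- x)"
    by (rule fourier_sum[symmetric]) (intro schwartz_integrable schwartz_mult resolution_schwartz \<phi> fourier_schwartz f)
  then show ?thesis
    by (simp add: block_def inv_fourier_eq_fourier sum_distrib_right[symmetric] sum_resolution)
qed

text \<open>The partial sums telescope to one cut-off, which equals 1 at any given frequency once
  \<open>J\<close> is large, and dominated convergence applies on the Fourier side. Convergence at
  every point is needed because \<open>\<Gamma>\<close> may be a Lebesgue null set.\<close>

lemma block_sum_tendsto:
  fixes f :: "'a::euclidean_space \<Rightarrow> complex"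
  assumes \<phi>: "resolution_generator \<phi>0" and f: "f \<in> schwartz"
  shows "(\<lambda>J. \<Sum>j\<le>J. block \<phi>0 j f x) \<longlonglongrightarrow> f x"
proof -
  have \<phi>S: "\<phi>0 \<in> schwartz" and \<phi>1: "\<And>x. norm x \<le> 1 \<Longrightarrow> \<phi>0 x = 1"
    using \<phi> by (auto simp: resolution_generator_def)
  obtain K where K: "\<And>x. norm (\<phi>0 x) \<le> K" using schwartz_bounded[OF \<phi>S] by metis
  note [measurable] = schwartz_measurable[OF \<phi>S] schwartz_measurable[OF fourier_schwartz[OF f]]
  have "(\<lambda>J. \<integral>\<xi>. wave \<xi> (- x) * (\<phi>0 (2 powr (- real J) *\<^sub>R \<xi>) * fourier f \<xi>) \<partial>lborel)
      \<longlonglongrightarrow> (\<integral>\<xi>. wave \<xi> (- x) * fourier f \<xi> \<partial>lborel)"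
  proof (rule integral_dominated_convergence[where w = "\<lambda>\<xi>. K * norm (fourier f \<xi>)"])
    have "(\<lambda>J. wave \<xi> (- x) * (\<phi>0 (2 powr (- real J) *\<^sub>R \<xi>) * fourier f \<xi>)) \<longlonglongrightarrow> wave \<xi> (- x) * fourier f \<xi>" for \<xi>
    proof (rule tendsto_eventually)
      have "(\<lambda>J. 2 powr (- real J) * norm \<xi>) \<longlonglongrightarrow> 0 * norm \<xi>"
      proof (rule tendsto_mult_right)
        have "(\<lambda>J. inverse 2 ^ J) \<longlonglongrightarrow> (0::real)" by (rule LIMSEQ_power_zero) simp
        then show "(\<lambda>J. 2 powr (- real J)) \<longlonglongrightarrow> (0::real)"
          by (simp only: two_powr_minus_of_nat power_inverse)
      qed
      then have "\<forall>\<^sub>F J in sequentially. 2 powr (- real J) * norm \<xi> < 1"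
        by (intro order_tendstoD(2)) auto
      then show "\<forall>\<^sub>F J in sequentially. wave \<xi> (- x) * (\<phi>0 (2 powr (- real J) *\<^sub>R \<xi>) * fourier f \<xi>) = wave \<xi> (- x) * fourier f \<xi>"
        by (rule eventually_mono) (simp add: \<phi>1)
    qed
    then show "AE \<xi> in lborel. (\<lambda>J. wave \<xi> (- x) * (\<phi>0 (2 powr (- real J) *\<^sub>R \<xi>) * fourier f \<xi>)) \<longlonglongrightarrow> wave \<xi> (- x) * fourier f \<xi>"
      by simp
    show "AE \<xi> in lborel. norm (wave \<xi> (- x) * (\<phi>0 (2 powr (- real J) *\<^sub>R \<xi>) * fourier f \<xi>)) \<le> K * norm (fourier f \<xi>)" for J
      by (intro AE_I2, simp only: norm_mult norm_wave mult_1) (intro mult_right_mono K norm_ge_zero)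
    show "integrable lborel (\<lambda>\<xi>. K * norm (fourier f \<xi>))"
      by (intro integrable_mult_right integrable_norm schwartz_integrable fourier_schwartz f)
  qed measurable
  then have "(\<lambda>J. fourier (\<lambda>\<xi>. \<phi>0 (2 powr (- real J) *\<^sub>R \<xi>) * fourier f \<xi>) (- x)) \<longlonglongrightarrow> fourier (fourier f) (- x)"
    unfolding fourier_eq[of _ "- x"] by (rule tendsto_mult_left)
  then show ?thesis
    using fourier_inversion[OF f, of x] by (simp add: sum_block[OF \<phi>S f] inv_fourier_eq_fourier)
qed

section \<open>Uniqueness of the representing function\<close>

text \<open>Since \<open>ennreal\<close> cuts off at 0, the densities \<open>ennreal (v x)\<close>
  and \<open>ennreal (- v x)\<close> are the positive and the negative part of \<open>v\<close>. The
  finite measures they define agree on open sets, an intersection-stable generator, hence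
  everywhere; so the two parts agree almost everywhere and both vanish.\<close>

lemma AE_zero_if_open_integrals_zero:
  fixes v :: "'a::euclidean_space \<Rightarrow> real"
  assumes v: "integrable lborel v"
    and zero: "\<And>U. open U \<Longrightarrow> (\<integral>x. indicator U x * v x \<partial>lborel) = 0"
  shows "AE x in lborel. v x = 0"
proof -
  have [measurable]: "v \<in> borel_measurable borel" using v by auto
  have em: "emeasure (density lborel (\<lambda>x. ennreal (w x))) U = ennreal (\<integral>x. indicator U x * max 0 (w x) \<partial>lborel)"
    if "open U" "w = v \<or> w = (\<lambda>x. - v x)" for U w
  proof -
    have w: "integrable lborel w" using that(2) v by auto
    have [measurable]: "w \<in> borel_measurable borel" "U \<in> sets borel" using w that(1) by auto
    have "emeasure (density lborel (\<lambda>x. ennreal (w x))) U = (\<integral>\<^sup>+x. ennreal (indicator U x * max 0 (w x)) \<partial>lborel)"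
      by (subst emeasure_density) (auto intro!: nn_integral_cong simp: max_def ennreal_neg split: split_indicator)
    also have "\<dots> = ennreal (\<integral>x. indicator U x * max 0 (w x) \<partial>lborel)"
      by (rule nn_integral_eq_integral)
        (auto intro!: Bochner_Integration.integrable_bound[OF w] AE_I2 split: split_indicator)
    finally show ?thesis .
  qed
  have eq: "emeasure (density lborel (\<lambda>x. ennreal (v x))) U = emeasure (density lborel (\<lambda>x. ennreal (- v x))) U" if U: "open U" for U
  proof -
    have [measurable]: "U \<in> sets borel" using U by auto
    have i: "integrable lborel (\<lambda>x. indicator U x * max 0 (w x))" if "integrable lborel w" for w :: "'a \<Rightarrow> real"
      by (rule Bochner_Integration.integrable_bound[OF that]) (use that in \<open>auto split: split_indicator\<close>)
    have "(\<integral>x. indicator U x * max 0 (v x) \<partial>lborel) - (\<integral>x. indicator U x * max 0 (- v x) \<partial>lborel)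
        = (\<integral>x. indicator U x * max 0 (v x) - indicator U x * max 0 (- v x) \<partial>lborel)"
      using i[OF v] i[of "\<lambda>x. - v x"] v by simp
    also have "\<dots> = (\<integral>x. indicator U x * v x \<partial>lborel)"
      by (intro Bochner_Integration.integral_cong) (auto simp: max_def split: split_indicator)
    finally show ?thesis using zero[OF U] by (simp add: em[OF U])
  qed
  have "density lborel (\<lambda>x. ennreal (v x)) = density lborel (\<lambda>x. ennreal (- v x))"
  proof (rule measure_eqI_generator_eq[where E = "Collect open" and \<Omega> = UNIV and A = "\<lambda>_. UNIV"])
    show "Int_stable (Collect open)" by (auto simp: Int_stable_def)
    show "emeasure (density lborel (\<lambda>x. ennreal (v x))) UNIV \<noteq> \<infinity>" by (subst em) auto
  qed (auto simp: eq borel_def sets_measure_of_conv)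
  then have "AE x in lborel. ennreal (v x) = ennreal (- v x)"
    by (intro sigma_finite_measure.density_unique[OF sigma_finite_lborel]) auto
  then show ?thesis
  proof (rule AE_mp, intro AE_I2 impI)
    fix x assume "ennreal (v x) = ennreal (- v x)"
    then show "v x = 0" by (cases "v x \<ge> 0"; cases "v x \<le> 0") (auto simp: ennreal_neg ennreal_eq_0_iff)
  qed
qed

text \<open>The Schwartz functions \<open>1 - (1 - \<psi> / M) ^ k\<close> are polynomials in \<open>\<psi>\<close> without constant term and
  increase to the indicator of the positivity set. Finite sums of squared moduli of dilates of the
  generator then produce arbitrary open sets.\<close>

lemma annihilator_vanishes_on_positivity_set:
  fixes u :: "'a::euclidean_space \<Rightarrow> complex"
  assumes orth: "\<And>\<psi>. \<psi> \<in> schwartz \<Longrightarrow> (\<integral>x. u x * \<psi> x \<partial>lborel) = 0"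
    and [measurable]: "B \<in> sets borel" and int: "integrable lborel (\<lambda>x. indicator B x * u x)"
    and \<psi>: "(\<lambda>x. complex_of_real (\<psi> x)) \<in> schwartz" "\<And>x. \<psi> x \<ge> 0" "{x. \<psi> x > 0} \<subseteq> B"
    and um [measurable]: "u \<in> borel_measurable borel"
  shows "(\<integral>x. indicator {x. \<psi> x > 0} x * u x \<partial>lborel) = 0"
proof -
  obtain M where M: "M > 0" "\<And>x. norm (complex_of_real (\<psi> x)) \<le> M" using schwartz_bounded[OF \<psi>(1)] by metis
  have t: "0 \<le> \<psi> x / M" "\<psi> x / M \<le> 1" for x using M(1) M(2)[of x] \<psi>(2)[of x] by auto
  define s where "s k x = 1 - (1 - \<psi> x / M) ^ k" for k x
  have s: "(\<lambda>x. complex_of_real (s k x)) \<in> schwartz" for k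
  proof (induction k)
    case (Suc k)
    have "(\<lambda>x. complex_of_real (s (Suc k) x)) = (\<lambda>x. (complex_of_real (s k x) + of_real (1 / M) * complex_of_real (\<psi> x))
        - of_real (1 / M) * (complex_of_real (s k x) * complex_of_real (\<psi> x)))"
      by (simp add: s_def fun_eq_iff algebra_simps)
    then show ?case
      by (simp only:) (intro schwartz_diff schwartz_add schwartz_cmult schwartz_mult Suc \<psi>(1))
  qed (simp add: s_def schwartz_zero)
  have s01: "norm (complex_of_real (s k x)) \<le> indicator B x" for k x
  proof (cases "\<psi> x = 0")
    case False
    then have "x \<in> B" using \<psi>(2)[of x] \<psi>(3) by (auto simp: less_le)
    moreover have "0 \<le> (1 - \<psi> x / M) ^ k" "(1 - \<psi> x / M) ^ k \<le> 1"
      using t[of x] by (auto intro: power_le_one)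
    ultimately show ?thesis unfolding s_def norm_of_real by simp
  qed (simp add: s_def)
  have [measurable]: "(\<lambda>x. complex_of_real (s k x)) \<in> borel_measurable borel" for k using schwartz_measurable[OF s] .
  have [measurable]: "\<psi> \<in> borel_measurable borel"
    using measurable_compose[OF schwartz_measurable[OF \<psi>(1)] borel_measurable_Re] by simp
  have "(\<lambda>k. \<integral>x. u x * complex_of_real (s k x) \<partial>lborel) \<longlonglongrightarrow> (\<integral>x. indicator {x. \<psi> x > 0} x * u x \<partial>lborel)"
  proof (rule integral_dominated_convergence[where w = "\<lambda>x. norm (indicator B x * u x)"])
    have "(\<lambda>k. u x * complex_of_real (s k x)) \<longlonglongrightarrow> indicator {x. \<psi> x > 0} x * u x" for x
    proof (cases "\<psi> x = 0")
      case False
      then have "\<psi> x > 0" using \<psi>(2)[of x] by (simp add: less_le)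
      then have "0 < \<psi> x / M" using M by simp
      then have "(\<lambda>k. (1 - \<psi> x / M) ^ k) \<longlonglongrightarrow> 0" using t[of x] by (intro LIMSEQ_power_zero) auto
      then have "(\<lambda>k. s k x) \<longlonglongrightarrow> 1 - 0" unfolding s_def by (rule tendsto_diff[OF tendsto_const])
      then have "(\<lambda>k. u x * complex_of_real (s k x)) \<longlonglongrightarrow> u x * complex_of_real (1 - 0)"
        by (intro tendsto_intros)
      then show ?thesis using \<open>\<psi> x > 0\<close> by simp
    qed (simp add: s_def)
    then show "AE x in lborel. (\<lambda>k. u x * complex_of_real (s k x)) \<longlonglongrightarrow> indicator {x. \<psi> x > 0} x * u x" by simp
    show "AE x in lborel. norm (u x * complex_of_real (s k x)) \<le> norm (indicator B x * u x)" for k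
    proof (rule AE_I2)
      fix x
      have "norm (u x) * norm (complex_of_real (s k x)) \<le> norm (u x) * indicator B x"
        by (intro mult_left_mono s01) auto
      then show "norm (u x * complex_of_real (s k x)) \<le> norm (indicator B x * u x)"
        by (simp add: norm_mult split: split_indicator split_indicator_asm)
    qed
  qed (use int in \<open>auto intro: integrable_norm\<close>)
  then show ?thesis using orth[OF s] by (simp add: LIMSEQ_const_iff)
qed

lemma AE_eq_0_if_orthogonal_schwartz:
  fixes u :: "'a::euclidean_space \<Rightarrow> complex"
  assumes \<phi>: "resolution_generator (\<phi>0 :: 'a \<Rightarrow> complex)"
    and um [measurable]: "u \<in> borel_measurable borel"
    and int: "\<And>\<psi>. \<psi> \<in> schwartz \<Longrightarrow> integrable lborel (\<lambda>x. u x * \<psi> x)"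
    and orth: "\<And>\<psi>. \<psi> \<in> schwartz \<Longrightarrow> (\<integral>x. u x * \<psi> x \<partial>lborel) = 0"
  shows "AE x in lborel. u x = 0"
proof -
  have \<phi>S: "\<phi>0 \<in> schwartz" and \<phi>1: "\<And>x. norm x \<le> 1 \<Longrightarrow> \<phi>0 x = 1"
    and \<phi>supp: "\<And>x. \<phi>0 x \<noteq> 0 \<Longrightarrow> norm x \<le> 2"
    using \<phi> closure_subset[of "{x. \<phi>0 x \<noteq> 0}"] by (auto simp: resolution_generator_def)
  \<comment> \<open>The generator equals 1 on the unit ball, so pairing \<open>u\<close> with a
    dilate of it gives integrability on a ball.\<close>
  have intB: "integrable lborel (\<lambda>x. indicator (ball 0 R) x * u x)" if "R > 0" for R
  proof (rule Bochner_Integration.integrable_bound)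
    show "integrable lborel (\<lambda>x. u x * \<phi>0 ((1 / R) *\<^sub>R x))"
      using that by (intro int schwartz_scale \<phi>S) simp
    show "AE x in lborel. norm (indicator (ball 0 R) x * u x) \<le> norm (u x * \<phi>0 ((1 / R) *\<^sub>R x))"
      using that by (intro AE_I2) (auto simp: \<phi>1 split: split_indicator)
    show "(\<lambda>x. indicator (ball 0 R) x * u x) \<in> borel_measurable lborel"
      by (intro borel_measurable_times borel_measurable_indicator) (use um in auto)
  qed
  have zero: "(\<integral>x. indicator U x * u x \<partial>lborel) = 0" if U: "open U" "U \<subseteq> ball 0 R" "R > 0" for U R
  proof (cases "U = {}")
    case False
    define N where "N c z = {x. \<phi>0 (c *\<^sub>R x + z) \<noteq> 0}" for c :: real and z
    have openN: "open (N c z)" for c z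
    proof -
      have "continuous_on UNIV (\<lambda>x. \<phi>0 (c *\<^sub>R x + z))"
        by (rule continuous_on_compose2[OF schwartz_continuous[OF \<phi>S, of UNIV]]) (auto intro!: continuous_intros)
      then show ?thesis unfolding N_def by (rule open_Collect_neq[OF _ continuous_on_const])
    qed
    have "\<exists>c z. c \<noteq> 0 \<and> x \<in> N c z \<and> N c z \<subseteq> U" if xU: "x \<in> U" for x
    proof -
      obtain e where e: "e > 0" "ball x e \<subseteq> U" using U(1) xU unfolding open_contains_ball by blast
      \<comment> \<open>The generator vanishes outside radius 2; the scale \<open>3 / e\<close>
        shrinks this radius to \<open>2 * e / 3\<close>, which is less than
        \<open>e\<close>.\<close>
      have "y \<in> ball x e" if "y \<in> N (3 / e) (- (3 / e) *\<^sub>R x)" for y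
      proof -
        have "\<phi>0 ((3 / e) *\<^sub>R (y - x)) \<noteq> 0" using that by (simp add: N_def scaleR_diff_right)
        from \<phi>supp[OF this] have "3 / e * norm (y - x) \<le> 2" using e(1) by simp
        then have "norm (y - x) \<le> 2 * e / 3" using e(1) by (simp add: field_simps)
        then show ?thesis using e by (simp add: dist_norm norm_minus_commute)
      qed
      moreover have "x \<in> N (3 / e) (- (3 / e) *\<^sub>R x)" by (simp add: N_def \<phi>1)
      ultimately show ?thesis using e by (intro exI[of _ "3 / e"] exI[of _ "- (3 / e) *\<^sub>R x"]) auto
    qed
    then obtain c z where cz: "\<And>x. x \<in> U \<Longrightarrow> c x \<noteq> 0 \<and> x \<in> N (c x) (z x) \<and> N (c x) (z x) \<subseteq> U" by metis
    \<comment> \<open>Lindeloef's theorem leaves countably many of these neighbourhoods, so that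
      \<open>U\<close> is an increasing union of finite unions and dominated convergence
      applies.\<close>
    have "\<And>S. S \<in> (\<lambda>x. N (c x) (z x)) ` U \<Longrightarrow> open S" using openN by blast
    then obtain F where F: "F \<subseteq> (\<lambda>x. N (c x) (z x)) ` U" "countable F" "\<Union>F = (\<Union>x\<in>U. N (c x) (z x))"
      by (rule Lindelof)
    have "countable F \<and> F \<subseteq> (\<lambda>x. N (c x) (z x)) ` U" using F by simp
    then obtain X where X: "X \<subseteq> U" "countable X" "F = (\<lambda>x. N (c x) (z x)) ` X"
      unfolding countable_subset_image by (elim exE conjE)
    have UX: "(\<Union>x\<in>X. N (c x) (z x)) = U" using F(3) X(3) cz by blast
    then have "X \<noteq> {}" using False by auto
    define a where "a = from_nat_into X"
    have aX: "a i \<in> X" for i using from_nat_into[OF \<open>X \<noteq> {}\<close>] by (simp add: a_def)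
    have "range a = X" unfolding a_def using range_from_nat_into[OF \<open>X \<noteq> {}\<close> X(2)] .
    then have UN: "(\<Union>i. N (c (a i)) (z (a i))) = U" using UX by auto
    \<comment> \<open>Squared moduli rule out cancellation: the sum is positive exactly on the union
      of the sets where some summand is nonzero. Being a product with the conjugate, each summand is
      still a Schwartz function.\<close>
    define \<psi> where "\<psi> k x = (\<Sum>i<k. (norm (\<phi>0 (c (a i) *\<^sub>R x + z (a i))))\<^sup>2)" for k :: nat and x
    have pos: "{x. \<psi> k x > 0} = (\<Union>i<k. N (c (a i)) (z (a i)))" for k
      unfolding \<psi>_def N_def less_le by (auto simp: sum_nonneg sum_nonneg_eq_0_iff)
    have 0: "(\<integral>x. indicator {x. \<psi> k x > 0} x * u x \<partial>lborel) = 0" for k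
    proof (rule annihilator_vanishes_on_positivity_set[OF orth _ intB[OF U(3)]])
      have "(\<lambda>x. complex_of_real (\<psi> k x)) = (\<lambda>x. \<Sum>i<k. \<phi>0 (c (a i) *\<^sub>R x + z (a i)) * cnj (\<phi>0 (c (a i) *\<^sub>R x + z (a i))))"
        by (simp add: \<psi>_def complex_norm_square del: of_real_power)
      moreover have "c (a i) \<noteq> 0" for i using cz aX X(1) by blast
      ultimately show "(\<lambda>x. complex_of_real (\<psi> k x)) \<in> schwartz"
        by (simp only:) (intro schwartz_sum schwartz_mult schwartz_cnj schwartz_affine \<phi>S)
      show "{x. \<psi> k x > 0} \<subseteq> ball 0 R" unfolding pos using UN U(2) by blast
    qed (auto simp: \<psi>_def sum_nonneg)
    have [measurable]: "U \<in> sets borel" "N c z \<in> sets borel" for c z using U(1) openN by auto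
    have "(\<lambda>k. \<integral>x. indicator {x. \<psi> k x > 0} x * u x \<partial>lborel) \<longlonglongrightarrow> (\<integral>x. indicator U x * u x \<partial>lborel)"
    proof (rule integral_dominated_convergence[where w = "\<lambda>x. norm (indicator (ball 0 R) x * u x)"])
      have "(\<lambda>k. indicator {x. \<psi> k x > 0} x * u x) \<longlonglongrightarrow> indicator U x * u x" for x
      proof (rule tendsto_eventually, cases "x \<in> U")
        case True
        then obtain i where i: "x \<in> N (c (a i)) (z (a i))" using UN by blast
        show "\<forall>\<^sub>F k in sequentially. indicator {x. \<psi> k x > 0} x * u x = indicator U x * u x"
          using eventually_gt_at_top[of i]
        proof (rule eventually_mono)
          fix k assume "k > i"
          then have "x \<in> {x. \<psi> k x > 0}" unfolding pos using i by blast
          then show "indicator {x. \<psi> k x > 0} x * u x = indicator U x * u x" using True by simp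
        qed
      next
        case False
        have "x \<notin> {x. \<psi> k x > 0}" for k unfolding pos using UN False by blast
        then show "\<forall>\<^sub>F k in sequentially. indicator {x. \<psi> k x > 0} x * u x = indicator U x * u x"
          using False by simp
      qed
      then show "AE x in lborel. (\<lambda>k. indicator {x. \<psi> k x > 0} x * u x) \<longlonglongrightarrow> indicator U x * u x" by simp
      have sub: "norm x < R" if "0 < \<psi> k x" for k x
      proof -
        have "x \<in> (\<Union>i<k. N (c (a i)) (z (a i)))" using that pos[of k] by blast
        then have "x \<in> ball 0 R" using UN U(2) by blast
        then show ?thesis by simp
      qed
      show "AE x in lborel. norm (indicator {x. \<psi> k x > 0} x * u x) \<le> norm (indicator (ball 0 R) x * u x)" for k
        by (intro AE_I2) (auto split: split_indicator dest: sub)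
      have "open {x. \<psi> k x > 0}" for k unfolding pos using openN by blast
      then show "(\<lambda>x. indicator {x. \<psi> k x > 0} x * u x) \<in> borel_measurable lborel" for k
        using um by (intro borel_measurable_times borel_measurable_indicator) auto
      show "(\<lambda>x. indicator U x * u x) \<in> borel_measurable lborel"
        using um U(1) by (intro borel_measurable_times borel_measurable_indicator) auto
      show "integrable lborel (\<lambda>x. norm (indicator (ball 0 R) x * u x))"
        by (intro integrable_norm intB U(3))
    qed
    then show ?thesis unfolding 0 by (simp add: LIMSEQ_const_iff)
  qed simp
  have "AE x in lborel. indicator (ball 0 (real (Suc n))) x * u x = 0" for n
  proof -
    let ?v = "\<lambda>x. indicator (ball 0 (real (Suc n))) x * u x"
    have v: "integrable lborel ?v" by (rule intB) simp
    have iU: "integrable lborel (\<lambda>x. indicator U x * ?v x)" if "open U" for U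
    proof (rule Bochner_Integration.integrable_bound[OF v])
      show "(\<lambda>x. indicator U x * ?v x) \<in> borel_measurable lborel"
        by (intro borel_measurable_times borel_measurable_indicator borel_measurable_integrable[OF v]) (use that in auto)
    qed (intro AE_I2, auto split: split_indicator)
    have z: "(\<integral>x. indicator U x * ?v x \<partial>lborel) = 0" if "open U" for U
    proof -
      have "(\<integral>x. indicator (U \<inter> ball 0 (real (Suc n))) x * u x \<partial>lborel) = 0"
        by (rule zero[of _ "real (Suc n)"]) (use that in auto)
      moreover have "(\<lambda>x. indicator U x * ?v x) = (\<lambda>x. indicator (U \<inter> ball 0 (real (Suc n))) x * u x)"
        by (auto simp: fun_eq_iff split: split_indicator)
      ultimately show ?thesis by (simp only:)
    qed
    have "AE x in lborel. Re (?v x) = 0"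
    proof (rule AE_zero_if_open_integrals_zero)
      show "(\<integral>x. indicator U x * Re (?v x) \<partial>lborel) = 0" if "open U" for U
      proof -
        have "(\<integral>x. indicator U x * Re (?v x) \<partial>lborel) = (\<integral>x. Re (indicator U x * ?v x) \<partial>lborel)"
          by (intro Bochner_Integration.integral_cong) (auto split: split_indicator)
        then show ?thesis using integral_Re[OF iU[OF that]] z[OF that] by simp
      qed
    qed (use v integrable_Re in blast)
    moreover have "AE x in lborel. Im (?v x) = 0"
    proof (rule AE_zero_if_open_integrals_zero)
      show "(\<integral>x. indicator U x * Im (?v x) \<partial>lborel) = 0" if "open U" for U
      proof -
        have "(\<integral>x. indicator U x * Im (?v x) \<partial>lborel) = (\<integral>x. Im (indicator U x * ?v x) \<partial>lborel)"
          by (intro Bochner_Integration.integral_cong) (auto split: split_indicator)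
        then show ?thesis using integral_Im[OF iU[OF that]] z[OF that] by simp
      qed
    qed (use v integrable_Im in blast)
    ultimately show ?thesis by eventually_elim (simp add: complex_eq_iff)
  qed
  then have "AE x in lborel. \<forall>n. indicator (ball 0 (real (Suc n))) x * u x = 0"
    unfolding AE_all_countable by blast
  then show ?thesis
  proof (rule AE_mp, intro AE_I2 impI)
    fix x assume *: "\<forall>n. indicator (ball 0 (real (Suc n))) x * u x = 0"
    obtain n where "norm x < real n" using reals_Archimedean2 by blast
    then have "x \<in> ball 0 (real (Suc n))" by simp
    then show "u x = 0" using *[rule_format, of n] by simp
  qed
qed

lemma distr_Lp_norm_eq:
  fixes g :: "'a::euclidean_space \<Rightarrow> complex"
  assumes \<phi>: "resolution_generator (\<phi>0 :: 'a \<Rightarrow> complex)" and g: "represents g T"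
  shows "distr_Lp_norm p T = Lp_norm lborel p g"
proof -
  have "Lp_norm lborel p g' = Lp_norm lborel p g" if g': "represents g' T" for g'
  proof -
    have [measurable]: "g \<in> borel_measurable borel" "g' \<in> borel_measurable borel"
      using g g' by (auto simp: represents_def)
    have *: "integrable lborel (\<lambda>x. g x * \<psi> x)" "integrable lborel (\<lambda>x. g' x * \<psi> x)"
        "(\<integral>x. g x * \<psi> x \<partial>lborel) = (\<integral>x. g' x * \<psi> x \<partial>lborel)" if "\<psi> \<in> schwartz" for \<psi>
      using g g' that by (auto simp: represents_def regular_distr_def)
    have "AE x in lborel. g x - g' x = 0"
      by (rule AE_eq_0_if_orthogonal_schwartz[OF \<phi>]) (auto simp: left_diff_distrib *)
    then have "AE x in lborel. ennreal (norm (g' x) powr p) = ennreal (norm (g x) powr p)"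
      by eventually_elim simp
    then have "(\<integral>\<^sup>+x. ennreal (norm (g' x) powr p) \<partial>lborel) = (\<integral>\<^sup>+x. ennreal (norm (g x) powr p) \<partial>lborel)"
      by (rule nn_integral_cong_AE)
    then show ?thesis by (simp add: Lp_norm_def)
  qed
  then have "distr_Lp_norm p T = (INF g'\<in>{g. represents g T}. Lp_norm lborel p g)"
    unfolding distr_Lp_norm_def by (intro INF_cong refl) simp
  also have "\<dots> = Lp_norm lborel p g" using g by (intro cINF_const) blast
  finally show ?thesis .
qed

lemma besov_norm_regular:
  fixes f :: "'a::euclidean_space \<Rightarrow> complex"
  assumes \<phi>: "resolution_generator \<phi>0" and f: "f \<in> schwartz"
  shows "besov_norm \<phi>0 \<rho> p q (regular_distr f)
    = epowr (\<Sum>j. ennreal (\<rho> j powr q) * epowr (Lp_norm lborel p (block \<phi>0 j f)) q) (1 / q)"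
proof -
  have "\<phi>0 \<in> schwartz" using \<phi> by (simp add: resolution_generator_def)
  then show ?thesis
    by (simp add: besov_norm_def distr_Lp_norm_eq[OF \<phi> block_represents[OF _ f]])
qed

section \<open>Local estimates for band-limited functions\<close>

definition weight :: "nat \<Rightarrow> 'a::euclidean_space \<Rightarrow> 'a \<Rightarrow> real" where
  "weight j x y = 1 / (1 + 2 ^ j * norm (x - y))"

lemma weight_pos: "0 < weight j x y"
  by (simp add: weight_def add_pos_nonneg)

lemma weight_le_1: "weight j x y \<le> 1"
  by (simp add: weight_def divide_le_eq_1 add_pos_nonneg)

text \<open>The triangle inequality together with
  \<open>1 + (a + b) \<le> (1 + a) * (1 + b)\<close>. It allows a weight centred at \<open>y\<close>
  to be exchanged for one centred at \<open>x\<close>.\<close>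

lemma weight_triangle: "weight j x y * weight j y z \<le> weight j x z"
proof -
  have "2 ^ j * norm (x - z) \<le> 2 ^ j * (norm (x - y) + norm (y - z))"
    by (intro mult_left_mono order_trans[OF _ norm_triangle_ineq]) simp_all
  moreover have "1 + (a + b) \<le> (1 + a) * (1 + b)" if "a \<ge> 0" "b \<ge> 0" for a b :: real
    using that by (simp add: algebra_simps)
  ultimately have "1 + 2 ^ j * norm (x - z) \<le> (1 + 2 ^ j * norm (x - y)) * (1 + 2 ^ j * norm (y - z))"
    by (smt (verit) distrib_left mult_nonneg_nonneg norm_ge_zero zero_le_power zero_le_numeral)
  then show ?thesis
    unfolding weight_def by (simp add: frac_le add_pos_nonneg)
qed

lemma weight_measurable [measurable]: "weight j x \<in> borel_measurable borel"
  unfolding weight_def[abs_def] by measurable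

lemma schwartz_powr_integrable:
  fixes f :: "'a::euclidean_space \<Rightarrow> complex"
  assumes f: "f \<in> schwartz" and p: "p > 0"
  shows "integrable lborel (\<lambda>x. norm (f x) powr p)"
proof -
  note [measurable] = schwartz_measurable[OF f]
  \<comment> \<open>The product \<open>N * p\<close> has to reach the integrable exponent
    \<open>2 * DIM('a)\<close>; small \<open>p\<close> requires faster decay.\<close>
  obtain N :: nat where N: "real (2 * DIM('a)) / p \<le> real N" using real_arch_simple by blast
  obtain C where C: "C > 0" "\<And>x. norm (f x) \<le> C / (1 + norm x) ^ N"
    using rapid_bound_weight[OF schwartz_rapid[OF f]] by blast
  show ?thesis
  proof (rule Bochner_Integration.integrable_bound)
    show "integrable lborel (\<lambda>x::'a. C powr p * (1 / (1 + norm x) ^ (2 * DIM('a))))"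
      by (intro integrable_mult_right integrable_inverse_power_weight)
    have "norm (f x) powr p \<le> C powr p * (1 / (1 + norm x) ^ (2 * DIM('a)))" for x
    proof -
      have "(1 + norm x) ^ (2 * DIM('a)) = (1 + norm x) powr real (2 * DIM('a))"
        by (rule powr_realpow[symmetric]) (simp add: add_pos_nonneg)
      also have "\<dots> \<le> (1 + norm x) powr (real N * p)"
        using N p by (intro powr_mono) (simp_all add: field_simps)
      also have "\<dots> = ((1 + norm x) ^ N) powr p"
        by (subst powr_realpow[symmetric]) (simp_all add: add_pos_nonneg powr_powr)
      finally have le: "(1 + norm x) ^ (2 * DIM('a)) \<le> ((1 + norm x) ^ N) powr p" .
      have "norm (f x) powr p \<le> (C / (1 + norm x) ^ N) powr p"
        using p by (intro powr_mono2 C) simp_all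
      also have "\<dots> = C powr p / ((1 + norm x) ^ N) powr p" by (rule powr_divide)
      also have "\<dots> \<le> C powr p / (1 + norm x) ^ (2 * DIM('a))"
        using le add_pos_nonneg[OF zero_less_one norm_ge_zero[of x]]
        by (intro divide_left_mono mult_pos_pos) auto
      finally show ?thesis by simp
    qed
    then show "AE x in lborel. norm (norm (f x) powr p) \<le> norm (C powr p * (1 / (1 + norm x) ^ (2 * DIM('a))))"
      by (intro AE_I2) (simp add: abs_mult)
  qed measurable
qed

section \<open>Spectrum of a block and its reproducing kernel\<close>

lemma resolution_nonzero_le:
  assumes "resolution_generator \<phi>0" "resolution \<phi>0 j \<xi> \<noteq> 0"
  shows "norm \<xi> \<le> 2 ^ Suc j"
proof -
  have supp: "norm x \<le> 2" if "\<phi>0 x \<noteq> 0" for x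
    using assms(1) closure_subset[of "{x. \<phi>0 x \<noteq> 0}"] that by (auto simp: resolution_generator_def)
  show ?thesis
  proof (cases j)
    case 0
    then show ?thesis using assms(2) supp by (simp add: resolution_def)
  next
    case (Suc k)
    have e: "2 powr (- real j + 1) = inverse (2 ^ k)"
      unfolding Suc two_powr_minus_of_nat[symmetric] by simp
    have "norm (inverse (2 ^ j) *\<^sub>R \<xi>) \<le> 2 \<or> norm (inverse (2 ^ k) *\<^sub>R \<xi>) \<le> 2"
    proof (rule ccontr)
      assume "\<not> ?thesis"
      then have "\<phi>0 (inverse (2 ^ j) *\<^sub>R \<xi>) = 0" "\<phi>0 (inverse (2 ^ k) *\<^sub>R \<xi>) = 0" using supp by blast+
      then show False using assms(2) unfolding resolution_def two_powr_minus_of_nat e by (simp add: Suc)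
    qed
    then have "norm \<xi> \<le> 2 * 2 ^ j \<or> norm \<xi> \<le> 2 * 2 ^ k"
      by (simp add: divide_simps mult.commute)
    moreover have "(2::real) * 2 ^ k \<le> 2 ^ Suc j" unfolding Suc by simp
    ultimately show ?thesis by (auto intro: order_trans)
  qed
qed

lemma fourier_block:
  "\<phi>0 \<in> schwartz \<Longrightarrow> f \<in> schwartz \<Longrightarrow> fourier (block \<phi>0 j f) \<xi> = resolution \<phi>0 j \<xi> * fourier f \<xi>"
  unfolding block_def by (intro fourier_inv_fourier schwartz_mult resolution_schwartz fourier_schwartz)

lemma inv_fourier_dilation:
  fixes m :: "'a::euclidean_space \<Rightarrow> complex"
  assumes "m \<in> schwartz" "c > 0"
  shows "inv_fourier (\<lambda>\<xi>. m (inverse c *\<^sub>R \<xi>)) x = of_real (c ^ DIM('a)) * inv_fourier m (c *\<^sub>R x)"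
proof -
  note [measurable] = schwartz_measurable[OF assms(1)]
  have "fourier (\<lambda>\<xi>. m (0 + inverse c *\<^sub>R \<xi>)) (- x) = of_real (1 / \<bar>inverse c\<bar> ^ DIM('a)) *
      (wave (- 0) (- x /\<^sub>R inverse c) * fourier m (- x /\<^sub>R inverse c))"
    using assms(2) by (intro fourier_affine) simp_all
  then show ?thesis
    using assms(2) by (simp add: inv_fourier_eq_fourier power_inverse divide_inverse)
qed

text \<open>The kernel is that of the cut-off \<open>\<phi>0 (\<xi> / 2\<^sup>j\<^sup>+\<^sup>1)\<close>, which is \<open>1\<close> on the spectrum of the block.\<close>

lemma block_reproducing:
  fixes f :: "'a::euclidean_space \<Rightarrow> complex"
  assumes \<phi>: "resolution_generator \<phi>0" and f: "f \<in> schwartz"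
  shows "block \<phi>0 j f x = fconst TYPE('a) *
    (\<integral>y. block \<phi>0 j f y * (of_real ((2 ^ Suc j) ^ DIM('a)) * inv_fourier \<phi>0 ((2 ^ Suc j) *\<^sub>R (x - y))) \<partial>lborel)"
proof -
  have \<phi>S: "\<phi>0 \<in> schwartz" and \<phi>1: "\<And>x. norm x \<le> 1 \<Longrightarrow> \<phi>0 x = 1"
    using \<phi> by (auto simp: resolution_generator_def)
  let ?m = "\<lambda>\<xi>::'a. \<phi>0 (inverse (2 ^ Suc j) *\<^sub>R \<xi>)"
  have m: "?m \<in> schwartz" by (rule schwartz_scale[OF \<phi>S]) simp
  have "?m \<xi> * fourier (block \<phi>0 j f) \<xi> = fourier (block \<phi>0 j f) \<xi>" for \<xi>
  proof (cases "resolution \<phi>0 j \<xi> = 0")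
    case True
    then show ?thesis by (simp add: fourier_block[OF \<phi>S f])
  next
    case False
    then have "norm \<xi> \<le> 2 ^ Suc j" by (rule resolution_nonzero_le[OF \<phi>])
    then have "norm (inverse (2 ^ Suc j) *\<^sub>R \<xi>) \<le> 1" by (simp add: divide_simps)
    then show ?thesis using \<phi>1 by simp
  qed
  then have "block \<phi>0 j f x = inv_fourier (\<lambda>\<xi>. ?m \<xi> * fourier (block \<phi>0 j f) \<xi>) x"
    using fourier_inversion[OF block_schwartz[OF \<phi>S f]] by (simp only:)
  also have "\<dots> = fconst TYPE('a) * (\<integral>y. block \<phi>0 j f y * inv_fourier ?m (x - y) \<partial>lborel)"
    by (rule inv_fourier_mult_fourier) (intro schwartz_integrable block_schwartz \<phi>S f m)+
  finally show ?thesis by (simp only: inv_fourier_dilation[OF \<phi>S] zero_less_power zero_less_numeral)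
qed

lemma integrable_weight_mult:
  fixes g :: "'a::euclidean_space \<Rightarrow> real"
  assumes "integrable lborel g"
  shows "integrable lborel (\<lambda>y. g y * weight j x y ^ N)"
proof (rule Bochner_Integration.integrable_bound[OF assms])
  have [measurable]: "g \<in> borel_measurable borel" using assms by auto
  show "(\<lambda>y. g y * weight j x y ^ N) \<in> borel_measurable lborel" by measurable
  have "\<bar>g y\<bar> * weight j x y ^ N \<le> \<bar>g y\<bar> * 1" for y
    by (intro mult_left_mono power_le_one weight_le_1 less_imp_le[OF weight_pos]) simp
  then show "AE y in lborel. norm (g y * weight j x y ^ N) \<le> norm (g y)"
    by (intro AE_I2) (simp add: abs_mult weight_pos less_imp_le)
qed

text \<open>Absolute values in the reproducing formula. The kernel lives at scale
  \<open>2 ^ Suc j\<close>, and passing to the scale \<open>2 ^ j\<close> of the weight only weakens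
  the bound; the power \<open>N\<close> is free because the unscaled kernel is a Schwartz
  function.\<close>

lemma block_kernel_estimate:
  fixes \<phi>0 :: "'a::euclidean_space \<Rightarrow> complex"
  assumes \<phi>: "resolution_generator \<phi>0"
  obtains C where "C > 0"
    "\<And>j f x. f \<in> schwartz \<Longrightarrow> norm (block \<phi>0 j f x)
      \<le> C * (2 ^ j) ^ DIM('a) * (\<integral>y. norm (block \<phi>0 j f y) * weight j x y ^ N \<partial>lborel)"
proof -
  have \<phi>S: "\<phi>0 \<in> schwartz" using \<phi> by (auto simp: resolution_generator_def)
  obtain K where K: "K > 0" "\<And>x. norm (inv_fourier \<phi>0 x) \<le> K / (1 + norm x) ^ N"
    using rapid_bound_weight[OF schwartz_rapid[OF inv_fourier_schwartz[OF \<phi>S]]] by blast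
  define c where "c = norm (fconst TYPE('a))"
  have c: "c > 0" by (simp add: c_def)
  show ?thesis
  proof (rule that)
    show "c * 2 ^ DIM('a) * K > 0" using c K by simp
    fix j f x assume f: "f \<in> (schwartz :: ('a \<Rightarrow> complex) set)"
    let ?k = "\<lambda>y. of_real ((2 ^ Suc j) ^ DIM('a)) * inv_fourier \<phi>0 ((2 ^ Suc j) *\<^sub>R (x - y))"
    note gS = block_schwartz[OF \<phi>S f, of j]
    have k: "norm (?k y) \<le> 2 ^ DIM('a) * (2 ^ j) ^ DIM('a) * K * weight j x y ^ N" for y
    proof -
      have "norm (inv_fourier \<phi>0 ((2 ^ Suc j) *\<^sub>R (x - y))) \<le> K / (1 + norm ((2 ^ Suc j) *\<^sub>R (x - y))) ^ N"
        by (rule K)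
      also have "\<dots> \<le> K / (1 + 2 ^ j * norm (x - y)) ^ N"
        using K(1) by (intro divide_left_mono power_mono mult_pos_pos) (simp_all add: add_pos_nonneg)
      also have "\<dots> = K * weight j x y ^ N" by (simp add: weight_def power_one_over)
      finally have "norm (inv_fourier \<phi>0 ((2 ^ Suc j) *\<^sub>R (x - y))) \<le> K * weight j x y ^ N" .
      from mult_left_mono[OF this, of "(2 ^ Suc j) ^ DIM('a)"]
      show ?thesis by (simp add: norm_mult norm_power power_mult_distrib mult_ac)
    qed
    have "norm (\<integral>y. block \<phi>0 j f y * ?k y \<partial>lborel)
      \<le> (\<integral>y. (2 ^ DIM('a) * (2 ^ j) ^ DIM('a) * K) * (norm (block \<phi>0 j f y) * weight j x y ^ N) \<partial>lborel)"
    proof (rule Bochner_Integration.integral_norm_bound_integral)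
      show "integrable lborel (\<lambda>y. (2 ^ DIM('a) * (2 ^ j) ^ DIM('a) * K) * (norm (block \<phi>0 j f y) * weight j x y ^ N))"
        by (intro integrable_mult_right integrable_weight_mult integrable_norm schwartz_integrable gS)
      have "(\<lambda>y. inv_fourier \<phi>0 ((- (2 ^ Suc j)) *\<^sub>R y + (2 ^ Suc j) *\<^sub>R x)) \<in> schwartz"
        by (intro schwartz_affine inv_fourier_schwartz \<phi>S) simp
      then have "(\<lambda>y. inv_fourier \<phi>0 ((2 ^ Suc j) *\<^sub>R (x - y))) \<in> schwartz"
        by (simp add: scaleR_diff_right)
      then show "integrable lborel (\<lambda>y. block \<phi>0 j f y * ?k y)"
        by (intro schwartz_integrable schwartz_mult schwartz_cmult gS)
      fix y
      have "norm (block \<phi>0 j f y) * norm (?k y) \<le> norm (block \<phi>0 j f y) * (2 ^ DIM('a) * (2 ^ j) ^ DIM('a) * K * weight j x y ^ N)"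
        by (intro mult_left_mono k) simp
      then show "norm (block \<phi>0 j f y * ?k y) \<le> (2 ^ DIM('a) * (2 ^ j) ^ DIM('a) * K) * (norm (block \<phi>0 j f y) * weight j x y ^ N)"
        by (simp only: norm_mult mult_ac)
    qed
    from mult_left_mono[OF this, of c]
    have "norm (block \<phi>0 j f x) \<le> c * (\<integral>y. (2 ^ DIM('a) * (2 ^ j) ^ DIM('a) * K) * (norm (block \<phi>0 j f y) * weight j x y ^ N) \<partial>lborel)"
      by (subst block_reproducing[OF \<phi> f]) (simp only: norm_mult c_def norm_ge_zero)
    then show "norm (block \<phi>0 j f x) \<le> c * 2 ^ DIM('a) * K * (2 ^ j) ^ DIM('a) * (\<integral>y. norm (block \<phi>0 j f y) * weight j x y ^ N \<partial>lborel)"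
      by (simp only: integral_mult_right_zero) (simp add: mult_ac)
  qed
qed

lemma integral_weight_power:
  fixes x :: "'a::euclidean_space"
  shows "(2 ^ j) ^ DIM('a) * (\<integral>y. weight j x y ^ N \<partial>lborel) = (\<integral>z. (1 / (1 + norm (z::'a))) ^ N \<partial>lborel)"
proof -
  have "(\<integral>z. (1 / (1 + norm (z::'a))) ^ N \<partial>lborel) = \<bar>2 ^ j\<bar> ^ DIM('a) *\<^sub>R (\<integral>y. (1 / (1 + norm (- ((2 ^ j) *\<^sub>R x) + (2 ^ j) *\<^sub>R y))) ^ N \<partial>lborel)"
    by (rule lborel_integral_affine) simp_all
  moreover have "norm (- ((2 ^ j) *\<^sub>R x) + (2 ^ j) *\<^sub>R y) = 2 ^ j * norm (x - y)" for y
  proof -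
    have "- ((2 ^ j) *\<^sub>R x) + (2 ^ j) *\<^sub>R y = (2 ^ j) *\<^sub>R (y - x)" by (simp add: scaleR_diff_right)
    then show ?thesis by (simp add: norm_minus_commute)
  qed
  ultimately show ?thesis by (simp add: weight_def)
qed

text \<open>Let \<open>g\<close> be the block. The supremum over \<open>y\<close> of \<open>norm (g y) * weight j x y powr (B / p)\<close>
  (Peetre's maximal function) is finite, and the submultiplicativity of the weight lets one absorb
  its power of exponent \<open>1 - p\<close>.\<close>

lemma block_local_estimate_small:
  fixes \<phi>0 :: "'a::euclidean_space \<Rightarrow> complex"
  assumes \<phi>: "resolution_generator \<phi>0" and p: "0 < p" "p \<le> 1"
  obtains C where "C > 0"
    "\<And>j f x. f \<in> schwartz \<Longrightarrow> norm (block \<phi>0 j f x) powr p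
      \<le> C * (2 ^ j) ^ DIM('a) * (\<integral>y. norm (block \<phi>0 j f y) powr p * weight j x y ^ B \<partial>lborel)"
proof -
  have \<phi>S: "\<phi>0 \<in> schwartz" using \<phi> by (auto simp: resolution_generator_def)
  obtain N :: nat where N: "real B / p \<le> real N" using real_arch_simple by blast
  define \<beta> where "\<beta> = real B / p"
  have \<beta>: "\<beta> \<ge> 0" "\<beta> \<le> real N" using p N by (simp_all add: \<beta>_def)
  obtain C where C: "C > 0"
    "\<And>j f x. f \<in> schwartz \<Longrightarrow> norm (block \<phi>0 j f x)
      \<le> C * (2 ^ j) ^ DIM('a) * (\<integral>y. norm (block \<phi>0 j f y) * weight j x y ^ N \<partial>lborel)"
    using block_kernel_estimate[OF \<phi>, of N] by metis
  show ?thesis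
  proof (rule that[OF C(1)])
    fix j f x assume f: "f \<in> (schwartz :: ('a \<Rightarrow> complex) set)"
    define g where "g = block \<phi>0 j f"
    have gS: "g \<in> schwartz" unfolding g_def by (rule block_schwartz[OF \<phi>S f])
    obtain K where K: "\<And>y. norm (g y) \<le> K" using schwartz_bounded[OF gS] by metis
    define G where "G y = norm (g y) * weight j x y powr \<beta>" for y
    define M where "M = (SUP y. G y)"
    have w1: "weight j x y powr \<beta> \<le> 1" for x y :: 'a
      using powr_mono2[OF \<beta>(1) less_imp_le[OF weight_pos] weight_le_1] by simp
    have "G y \<le> K * 1" for y
      unfolding G_def by (intro mult_mono K w1 order_trans[OF norm_ge_zero K]) simp_all
    then have bdd: "bdd_above (range G)" by (auto simp: bdd_above_def)
    have GM: "G y \<le> M" for y unfolding M_def by (rule cSUP_upper[OF _ bdd]) simp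
    have G0: "G y \<ge> 0" for y by (simp add: G_def)
    define D where "D = (2 ^ j :: real) ^ DIM('a)"
    have D: "D > 0" by (simp add: D_def)
    define I where "I = (\<integral>y. norm (g y) powr p * weight j x y ^ B \<partial>lborel)"
    have int: "integrable lborel (\<lambda>y. norm (g y) powr p * weight j x y ^ B)"
      by (intro integrable_weight_mult schwartz_powr_integrable gS p)
    have pw: "norm (g z) * weight j y z ^ N * weight j x y powr \<beta> \<le> M powr (1 - p) * (norm (g z) powr p * weight j x z ^ B)" for y z
    proof -
      have "weight j y z ^ N = weight j y z powr real N" by (simp add: powr_realpow weight_pos)
      also have "\<dots> \<le> weight j y z powr \<beta>"
        by (intro powr_mono' \<beta> weight_le_1 less_imp_le[OF weight_pos])
      finally have "weight j y z ^ N * weight j x y powr \<beta> \<le> weight j y z powr \<beta> * weight j x y powr \<beta>"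
        by (intro mult_right_mono) simp_all
      also have "\<dots> = (weight j x y * weight j y z) powr \<beta>"
        by (simp add: powr_mult weight_pos less_imp_le mult.commute)
      also have "\<dots> \<le> weight j x z powr \<beta>"
        by (intro powr_mono2 \<beta> weight_triangle mult_nonneg_nonneg less_imp_le[OF weight_pos])
      finally have "norm (g z) * (weight j y z ^ N * weight j x y powr \<beta>) \<le> norm (g z) * weight j x z powr \<beta>"
        by (intro mult_left_mono) simp_all
      \<comment> \<open>The factor \<open>G z powr p\<close> carries the wanted \<open>p\<close>-th
        power, as \<open>\<beta> * p = B\<close>; the other factor is bounded by a power of the
        supremum.\<close>
      also have "\<dots> = G z powr p * G z powr (1 - p)"
        by (cases "G z = 0") (simp_all add: G_def powr_add[symmetric])
      also have "\<dots> \<le> G z powr p * M powr (1 - p)"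
        using p by (intro mult_left_mono powr_mono2 G0 GM) simp_all
      also have "G z powr p = norm (g z) powr p * weight j x z ^ B"
        using p by (simp add: G_def powr_mult weight_pos less_imp_le powr_powr \<beta>_def powr_realpow)
      finally show ?thesis by (simp add: mult_ac)
    qed
    have "G y \<le> C * D * M powr (1 - p) * I" for y
    proof -
      have "norm (g y) \<le> C * D * (\<integral>z. norm (g z) * weight j y z ^ N \<partial>lborel)"
        unfolding g_def D_def by (rule C(2)[OF f])
      then have "G y \<le> C * D * (\<integral>z. norm (g z) * weight j y z ^ N \<partial>lborel) * weight j x y powr \<beta>"
        unfolding G_def by (intro mult_right_mono) simp_all
      also have "\<dots> = C * D * (\<integral>z. norm (g z) * weight j y z ^ N * weight j x y powr \<beta> \<partial>lborel)"
        by simp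
      also have "\<dots> \<le> C * D * (\<integral>z. M powr (1 - p) * (norm (g z) powr p * weight j x z ^ B) \<partial>lborel)"
        using C(1) D
        by (intro mult_left_mono integral_mono pw integrable_mult_right int integrable_mult_left
            integrable_weight_mult integrable_norm schwartz_integrable gS) simp_all
      finally show ?thesis by (simp add: I_def mult_ac)
    qed
    \<comment> \<open>An inequality with the supremum on both sides: as \<open>M\<close> is finite,
      \<open>M powr (1 - p)\<close> can be cancelled when \<open>M\<close> is positive.\<close>
    then have M: "M \<le> C * D * M powr (1 - p) * I" unfolding M_def by (intro cSUP_least) simp_all
    have I0: "I \<ge> 0" unfolding I_def by (intro integral_nonneg_AE AE_I2) (simp add: weight_pos less_imp_le)
    \<comment> \<open>At the centre the weight is 1, so the supremum dominates the value to be
      estimated.\<close>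
    have "G x = norm (g x)" by (simp add: G_def weight_def)
    then have gM: "norm (g x) \<le> M" using GM[of x] by simp
    have "norm (g x) powr p \<le> C * D * I"
    proof (cases "M > 0")
      case True
      have "M powr p * M powr (1 - p) = M" using True by (simp add: powr_add[symmetric])
      then have "M powr p * M powr (1 - p) \<le> (C * D * I) * M powr (1 - p)" using M by (simp add: mult_ac)
      then have "M powr p \<le> C * D * I" using True by (simp add: mult_le_cancel_right)
      moreover have "norm (g x) powr p \<le> M powr p" using p by (intro powr_mono2 gM) simp_all
      ultimately show ?thesis by simp
    next
      case False
      then have "norm (g x) = 0" using gM norm_ge_zero[of "g x"] by linarith
      then show ?thesis using C(1) D I0 by simp
    qed
    then show "norm (block \<phi>0 j f x) powr p \<le> C * (2 ^ j) ^ DIM('a) * (\<integral>y. norm (block \<phi>0 j f y) powr p * weight j x y ^ B \<partial>lborel)"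
      by (simp add: g_def D_def I_def)
  qed
qed

text \<open>Either \<open>s\<close> is below the threshold, or
  \<open>s = s powr p * s powr (1 - p)\<close>, where the second factor decreases in
  \<open>s\<close>. With a good choice of \<open>t\<close> this replaces Hoelder's inequality at the
  cost of a constant.\<close>

lemma le_powr_split:
  fixes s t p :: real
  assumes "s \<ge> 0" "t > 0" "p \<ge> 1"
  shows "s \<le> t powr (1 - p) * s powr p + t"
proof (cases "s \<le> t")
  case False
  then have "s = s powr p * s powr (1 - p)" using assms by (simp add: powr_add[symmetric])
  also have "\<dots> \<le> s powr p * t powr (1 - p)"
    using False assms by (intro mult_left_mono powr_mono2') simp_all
  finally show ?thesis using assms by (simp add: mult.commute)
qed (use assms in \<open>simp add: add_increasing\<close>)

text \<open>The kernel estimate is split at a threshold \<open>t\<close> proportional to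
  \<open>norm (g x)\<close>. Values below it contribute at most half of \<open>norm (g x)\<close>
  and are absorbed on the left; values above it contribute the integral of the \<open>p\<close>-th
  power.\<close>

lemma block_local_estimate_large:
  fixes \<phi>0 :: "'a::euclidean_space \<Rightarrow> complex"
  assumes \<phi>: "resolution_generator \<phi>0" and p: "1 \<le> p"
  obtains C where "C > 0"
    "\<And>j f x. f \<in> schwartz \<Longrightarrow> norm (block \<phi>0 j f x) powr p
      \<le> C * (2 ^ j) ^ DIM('a) * (\<integral>y. norm (block \<phi>0 j f y) powr p * weight j x y ^ B \<partial>lborel)"
proof -
  have \<phi>S: "\<phi>0 \<in> schwartz" using \<phi> by (auto simp: resolution_generator_def)
  \<comment> \<open>\<open>B\<close> powers of the weight are kept for the conclusion, the remaining
    \<open>2 * DIM('a)\<close> make it integrable.\<close>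
  define N where "N = B + 2 * DIM('a)"
  obtain C where C: "C > 0"
    "\<And>j f x. f \<in> schwartz \<Longrightarrow> norm (block \<phi>0 j f x)
      \<le> C * (2 ^ j) ^ DIM('a) * (\<integral>y. norm (block \<phi>0 j f y) * weight j x y ^ N \<partial>lborel)"
    using block_kernel_estimate[OF \<phi>, of N] by metis
  define c where "c = (\<integral>z. (1 / (1 + norm (z::'a))) ^ N \<partial>lborel) + 1"
  have c: "c > 0" unfolding c_def
    by (intro add_nonneg_pos integral_nonneg_AE AE_I2) (simp_all add: add_nonneg_nonneg)
  show ?thesis
  proof (rule that)
    show "2 * C * (2 * C * c) powr (p - 1) > 0" using C(1) c by simp
    fix j f x assume f: "f \<in> (schwartz :: ('a \<Rightarrow> complex) set)"
    define g where "g = block \<phi>0 j f"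
    have gS: "g \<in> schwartz" unfolding g_def by (rule block_schwartz[OF \<phi>S f])
    define D where "D = (2 ^ j :: real) ^ DIM('a)"
    have D: "D > 0" by (simp add: D_def)
    define I where "I = (\<integral>y. norm (g y) powr p * weight j x y ^ B \<partial>lborel)"
    have I0: "I \<ge> 0" unfolding I_def by (intro integral_nonneg_AE AE_I2) (simp add: weight_pos less_imp_le)
    have int: "integrable lborel (\<lambda>y. norm (g y) powr p * weight j x y ^ k)" for k
      using p by (intro integrable_weight_mult schwartz_powr_integrable gS) simp
    have intw: "integrable lborel (\<lambda>y. weight j x y ^ N)"
    proof -
      have "integrable lborel (\<lambda>z::'a. 1 / (1 + norm z) ^ (2 * DIM('a)))" by (rule integrable_inverse_power_weight)
      from lborel_integrable_affine[OF this, of "2 ^ j" "- ((2 ^ j) *\<^sub>R x)"]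
      have "integrable lborel (\<lambda>y. 1 / (1 + norm (- ((2 ^ j) *\<^sub>R x) + (2 ^ j) *\<^sub>R y)) ^ (2 * DIM('a)))" by simp
      moreover have "norm (- ((2 ^ j) *\<^sub>R x) + (2 ^ j) *\<^sub>R y) = 2 ^ j * norm (x - y)" for y
      proof -
        have "- ((2 ^ j) *\<^sub>R x) + (2 ^ j) *\<^sub>R y = (2 ^ j) *\<^sub>R (y - x)" by (simp add: scaleR_diff_right)
        then show ?thesis by (simp add: norm_minus_commute)
      qed
      ultimately have "integrable lborel (\<lambda>y. weight j x y ^ (2 * DIM('a)))"
        by (simp add: weight_def power_one_over)
      from integrable_weight_mult[OF this, of j x B]
      show ?thesis by (simp add: N_def power_add mult.commute)
    qed
    show "norm (block \<phi>0 j f x) powr p \<le> 2 * C * (2 * C * c) powr (p - 1) * (2 ^ j) ^ DIM('a) * (\<integral>y. norm (block \<phi>0 j f y) powr p * weight j x y ^ B \<partial>lborel)"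
    proof (cases "g x = 0")
      case True
      then show ?thesis using C(1) D I0 p by (simp add: g_def D_def I_def)
    next
      case False
      \<comment> \<open>With this choice \<open>C * t * c\<close> is exactly half of
        \<open>norm (g x)\<close>.\<close>
      define t where "t = norm (g x) / (2 * C * c)"
      have t: "t > 0" using False C(1) c by (simp add: t_def)
      have "norm (g x) \<le> C * D * (\<integral>y. norm (g y) * weight j x y ^ N \<partial>lborel)"
        unfolding g_def D_def by (rule C(2)[OF f])
      also have "\<dots> \<le> C * D * (\<integral>y. t powr (1 - p) * (norm (g y) powr p * weight j x y ^ B) + t * weight j x y ^ N \<partial>lborel)"
      proof (intro mult_left_mono integral_mono)
        show "integrable lborel (\<lambda>y. norm (g y) * weight j x y ^ N)"
          by (intro integrable_weight_mult integrable_norm schwartz_integrable gS)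
        show "integrable lborel (\<lambda>y. t powr (1 - p) * (norm (g y) powr p * weight j x y ^ B) + t * weight j x y ^ N)"
          by (intro Bochner_Integration.integrable_add integrable_mult_right int intw)
        fix y
        have "norm (g y) * weight j x y ^ N \<le> (t powr (1 - p) * norm (g y) powr p + t) * weight j x y ^ N"
          using t p by (intro mult_right_mono le_powr_split) (simp_all add: weight_pos less_imp_le)
        moreover have "weight j x y ^ N \<le> weight j x y ^ B"
          by (intro power_decreasing less_imp_le[OF weight_pos] weight_le_1) (simp add: N_def)
        then have "t powr (1 - p) * norm (g y) powr p * weight j x y ^ N \<le> t powr (1 - p) * norm (g y) powr p * weight j x y ^ B"
          by (intro mult_left_mono) simp_all
        ultimately show "norm (g y) * weight j x y ^ N \<le> t powr (1 - p) * (norm (g y) powr p * weight j x y ^ B) + t * weight j x y ^ N"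
          by (simp add: algebra_simps)
      qed (use C(1) D in simp)
      also have "\<dots> = C * D * t powr (1 - p) * I + C * t * (D * (\<integral>y. weight j x y ^ N \<partial>lborel))"
        using int[of B] intw by (simp add: I_def algebra_simps)
      also have "D * (\<integral>y. weight j x y ^ N \<partial>lborel) = c - 1"
        unfolding D_def c_def by (simp add: integral_weight_power)
      also have "C * t * (c - 1) \<le> C * t * c" using C(1) t by (intro mult_left_mono) simp_all
      also have "C * t * c = norm (g x) / 2" using C(1) c by (simp add: t_def)
      finally have "norm (g x) / 2 \<le> C * D * t powr (1 - p) * I" by simp
      then have "norm (g x) / 2 * t powr (p - 1) \<le> C * D * t powr (1 - p) * I * t powr (p - 1)"
        by (intro mult_right_mono) simp_all
      also have "\<dots> = C * D * I" using t by (simp add: powr_add[symmetric] mult_ac)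
      finally have "norm (g x) * t powr (p - 1) \<le> 2 * (C * D * I)" by simp
      moreover have "t powr (p - 1) = norm (g x) powr (p - 1) / (2 * C * c) powr (p - 1)"
        unfolding t_def by (rule powr_divide)
      moreover have "norm (g x) * norm (g x) powr (p - 1) = norm (g x) powr p"
        using False by (simp add: powr_mult_base)
      ultimately have "norm (g x) powr p \<le> 2 * (C * D * I) * (2 * C * c) powr (p - 1)"
        using C(1) c by (simp add: divide_le_eq)
      then show ?thesis by (simp add: g_def D_def I_def mult_ac)
    qed
  qed
qed

lemma block_local_estimate:
  fixes \<phi>0 :: "'a::euclidean_space \<Rightarrow> complex"
  assumes "resolution_generator \<phi>0" and "0 < p"
  obtains C where "C > 0"
    "\<And>j f x. f \<in> schwartz \<Longrightarrow> norm (block \<phi>0 j f x) powr p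
      \<le> C * (2 ^ j) ^ DIM('a) * (\<integral>y. norm (block \<phi>0 j f y) powr p * weight j x y ^ B \<partial>lborel)"
proof (cases "p \<le> 1")
  case True
  show ?thesis using block_local_estimate_small[OF assms True] that by blast
next
  case False
  then have "1 \<le> p" by simp
  from block_local_estimate_large[OF assms(1) this] show ?thesis using that by blast
qed

section \<open>Geometry of h-sets\<close>

lemma ennreal_le_suminf: "f k \<le> (\<Sum>k. f k :: ennreal)"
  using sum_le_suminf[OF summableI, of "{k}" f] by simp

locale h_regular =
  fixes h :: "real \<Rightarrow> real" and \<Gamma> :: "'a::euclidean_space set" and \<mu> :: "'a measure" and c1 c2 :: real
  assumes gauge: "h \<in> gauge_class" and compact: "compact \<Gamma>" and nonempty: "\<Gamma> \<noteq> {}"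
    and finite: "finite_measure \<mu>" and sets_mu [measurable_cong]: "sets \<mu> = sets borel" and support: "measure_support \<mu> = \<Gamma>"
    and c1: "c1 > 0" and c2: "c2 > 0"
    and ball_lower: "\<And>r \<gamma>. 0 < r \<Longrightarrow> r \<le> 1 \<Longrightarrow> \<gamma> \<in> \<Gamma> \<Longrightarrow> c1 * h r \<le> measure \<mu> (cball \<gamma> r)"
    and ball_upper: "\<And>r \<gamma>. 0 < r \<Longrightarrow> r \<le> 1 \<Longrightarrow> \<gamma> \<in> \<Gamma> \<Longrightarrow> measure \<mu> (cball \<gamma> r) \<le> c2 * h r"
begin

sublocale finite_measure \<mu> by (rule finite)

lemma dyadic_eq: "dyadic h j = h (1 / 2 ^ j)"
  by (simp add: dyadic_def two_powr_minus_of_nat divide_inverse)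

lemma gauge_pos: "0 < r \<Longrightarrow> r \<le> 1 \<Longrightarrow> h r > 0"
  using gauge by (auto simp: gauge_class_def)

lemma gauge_mono: "0 < r \<Longrightarrow> r \<le> s \<Longrightarrow> s \<le> 1 \<Longrightarrow> h r \<le> h s"
  using gauge by (auto simp: gauge_class_def mono_on_def)

lemma dyadic_pos: "dyadic h j > 0"
  unfolding dyadic_eq by (rule gauge_pos) simp_all

lemma dyadic_antimono: "i \<le> j \<Longrightarrow> dyadic h j \<le> dyadic h i"
  unfolding dyadic_eq by (rule gauge_mono) (simp_all add: divide_left_mono power_increasing)

text \<open>Every point outside the support has an open null neighbourhood, and by Lindeloef's
  theorem countably many of them cover the complement.\<close>

lemma complement_null: "- \<Gamma> \<in> null_sets \<mu>"
proof -
  have "\<exists>U. open U \<and> x \<in> U \<and> emeasure \<mu> U = 0" if "x \<in> - \<Gamma>" for x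
    using that unfolding support[symmetric] measure_support_def by (auto simp: not_gr_zero)
  then obtain U where U: "\<And>x. x \<in> - \<Gamma> \<Longrightarrow> open (U x) \<and> x \<in> U x \<and> emeasure \<mu> (U x) = 0" by metis
  have "\<And>S. S \<in> U ` (- \<Gamma>) \<Longrightarrow> open S" using U by blast
  then obtain F where F: "F \<subseteq> U ` (- \<Gamma>)" "countable F" "\<Union>F = \<Union>(U ` (- \<Gamma>))" by (rule Lindelof)
  have "(\<Union>S\<in>F. S) \<in> null_sets \<mu>"
  proof (rule null_sets_UN'[OF F(2)])
    fix S assume "S \<in> F"
    then obtain x where "x \<in> - \<Gamma>" "S = U x" using F(1) by blast
    then show "S \<in> null_sets \<mu>" using U[of x] by (auto simp: null_sets_def sets_mu)
  qed
  moreover have "- \<Gamma> \<subseteq> \<Union>F" unfolding F(3) using U by blast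
  moreover have "- \<Gamma> \<in> sets \<mu>" using compact_imp_closed[OF compact] by (simp add: sets_mu borel_comp)
  ultimately show ?thesis by (auto intro: null_sets_subset)
qed

lemma sets_closed: "closed S \<Longrightarrow> S \<in> sets \<mu>"
  by (simp add: sets_mu)

text \<open>The ball condition only concerns centres in \<open>\<Gamma>\<close>. A ball with another
  centre either misses \<open>\<Gamma>\<close> and is null, or lies in a ball of twice the radius
  centred in \<open>\<Gamma>\<close>.\<close>

lemma cball_measure_le:
  assumes "0 < r" "2 * r \<le> 1"
  shows "measure \<mu> (cball y r) \<le> c2 * h (2 * r)"
proof (cases "cball y r \<inter> \<Gamma> = {}")
  case True
  then have "cball y r \<in> null_sets \<mu>"
    by (intro null_sets_subset[OF complement_null] sets_closed) auto
  then have "measure \<mu> (cball y r) = 0" by (simp add: measure_eq_0_null_sets)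
  then show ?thesis using c2 gauge_pos[of "2 * r"] assms by simp
next
  case False
  then obtain \<gamma> where \<gamma>: "\<gamma> \<in> \<Gamma>" "dist y \<gamma> \<le> r" by auto
  have "dist \<gamma> z \<le> 2 * r" if "dist y z \<le> r" for z
    using dist_triangle3[of \<gamma> z y] \<gamma>(2) that by simp
  then have "measure \<mu> (cball y r) \<le> measure \<mu> (cball \<gamma> (2 * r))"
    by (intro finite_measure_mono sets_closed) auto
  also have "\<dots> \<le> c2 * h (2 * r)" using assms \<gamma> by (intro ball_upper) simp_all
  finally show ?thesis .
qed

text \<open>A ball of radius \<open>r\<close> is covered by balls of radius \<open>r / 4\<close>
  whose number depends on the dimension only, by scaling a cover of the unit ball. Since their
  centres may lie outside \<open>\<Gamma>\<close>, each has measure at most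
  \<open>c2 * h (r / 2)\<close>. Comparison with the lower bound for the large ball gives the
  doubling constant.\<close>

lemma dyadic_doubling:
  obtains K where "K \<ge> 1" "\<And>j. dyadic h j \<le> K * dyadic h (Suc j)"
proof -
  have "\<exists>F. finite F \<and> F \<subseteq> cball (0::'a) 1 \<and> cball 0 1 \<subseteq> (\<Union>z\<in>F. ball z (1 / 4))"
    by (rule compactE_image[of "cball (0::'a) 1" "cball 0 1" "\<lambda>z. ball z (1/4)"]) auto
  then obtain F where F: "finite F" "cball (0::'a) 1 \<subseteq> (\<Union>z\<in>F. ball z (1 / 4))" by blast
  obtain \<gamma> where \<gamma>: "\<gamma> \<in> \<Gamma>" using nonempty by blast
  define K where "K = real (card F) * c2 / c1 + 1"
  show ?thesis
  proof (rule that)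
    show "K \<ge> 1" using c1 c2 by (simp add: K_def)
    fix j
    define r :: real where "r = 1 / 2 ^ j"
    have r: "0 < r" "r \<le> 1" by (simp_all add: r_def)
    have hr: "h (r / 2) > 0" using r by (intro gauge_pos) simp_all
    have "cball \<gamma> r \<subseteq> (\<Union>z\<in>F. cball (\<gamma> + r *\<^sub>R z) (r / 4))"
    proof
      fix x assume x: "x \<in> cball \<gamma> r"
      have "norm ((1 / r) *\<^sub>R (x - \<gamma>)) \<le> 1" using x r by (simp add: dist_norm norm_minus_commute divide_simps)
      then have "(1 / r) *\<^sub>R (x - \<gamma>) \<in> cball 0 1" by simp
      then have "(1 / r) *\<^sub>R (x - \<gamma>) \<in> (\<Union>z\<in>F. ball z (1 / 4))" using F(2) by blast
      then obtain z where z: "z \<in> F" "dist z ((1 / r) *\<^sub>R (x - \<gamma>)) < 1 / 4"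
        unfolding UN_iff mem_ball by blast
      have "r *\<^sub>R ((1 / r) *\<^sub>R (x - \<gamma>)) = x - \<gamma>" using r by simp
      then have "(\<gamma> + r *\<^sub>R z) - x = r *\<^sub>R (z - (1 / r) *\<^sub>R (x - \<gamma>))"
        by (simp only: scaleR_diff_right[of r z]) simp
      then have "dist (\<gamma> + r *\<^sub>R z) x = norm (r *\<^sub>R (z - (1 / r) *\<^sub>R (x - \<gamma>)))"
        by (simp only: dist_norm)
      also have "\<dots> = r * dist z ((1 / r) *\<^sub>R (x - \<gamma>))"
        using r(1) by (simp only: norm_scaleR abs_of_pos dist_norm)
      also have "\<dots> \<le> r * (1 / 4)" using z r by (intro mult_left_mono) simp_all
      finally show "x \<in> (\<Union>z\<in>F. cball (\<gamma> + r *\<^sub>R z) (r / 4))" using z by auto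
    qed
    then have "measure \<mu> (cball \<gamma> r) \<le> measure \<mu> (\<Union>z\<in>F. cball (\<gamma> + r *\<^sub>R z) (r / 4))"
      using F(1) by (intro finite_measure_mono sets.finite_UN sets_closed) auto
    also have "\<dots> \<le> (\<Sum>z\<in>F. measure \<mu> (cball (\<gamma> + r *\<^sub>R z) (r / 4)))"
      using F(1) by (intro finite_measure_subadditive_finite) (auto intro: sets_closed)
    also have "\<dots> \<le> (\<Sum>z\<in>F. c2 * h (2 * (r / 4)))"
      using r by (intro sum_mono cball_measure_le) simp_all
    also have "\<dots> = real (card F) * c2 * h (r / 2)" by simp
    finally have "c1 * h r \<le> real (card F) * c2 * h (r / 2)"
      using ball_lower[OF r \<gamma>] by simp
    then have "h r \<le> (real (card F) * c2 / c1) * h (r / 2)" using c1 by (simp add: field_simps)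
    also have "\<dots> \<le> K * h (r / 2)" using hr by (intro mult_right_mono) (simp_all add: K_def)
    finally show "dyadic h j \<le> K * dyadic h (Suc j)" unfolding dyadic_eq r_def by (simp add: mult.commute)
  qed
qed

lemma dyadic_doubling_power:
  assumes "K \<ge> 1" "\<And>j. dyadic h j \<le> K * dyadic h (Suc j)"
  shows "dyadic h j \<le> K ^ k * dyadic h (j + k)"
proof (induction k)
  case (Suc k)
  have "K ^ k * dyadic h (j + k) \<le> K ^ k * (K * dyadic h (Suc (j + k)))"
    using assms by (intro mult_left_mono) simp_all
  then show ?case using Suc by (simp add: mult_ac)
qed simp

text \<open>For \<open>k < j\<close> the doubled radius is at most 1 and the ball condition applies.
  For larger \<open>k\<close> only the total mass is available; it is a multiple of
  \<open>dyadic h 0\<close>, and \<open>K ^ k\<close> is then large enough to compensate for the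
  decrease down to \<open>dyadic h j\<close>.\<close>

lemma cball_measure_dyadic:
  obtains C K where "C > 0" "K \<ge> 1" "\<And>j k y. measure \<mu> (cball y (2 ^ k / 2 ^ j)) \<le> C * K ^ k * dyadic h j"
proof -
  obtain K where K: "K \<ge> 1" "\<And>j. dyadic h j \<le> K * dyadic h (Suc j)" by (rule dyadic_doubling) blast
  define m where "m = measure \<mu> (space \<mu>) / dyadic h 0"
  have m: "m \<ge> 0" using dyadic_pos[of 0] by (simp add: m_def)
  show ?thesis
  proof (rule that[of "c2 * K + m"])
    show "c2 * K + m > 0" using c2 K m by (simp add: add_pos_nonneg)
    fix j k and y :: 'a
    have Kd: "K ^ k * dyadic h j \<ge> 0" using K(1) dyadic_pos[of j] by simp
    show "measure \<mu> (cball y (2 ^ k / 2 ^ j)) \<le> (c2 * K + m) * K ^ k * dyadic h j"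
    proof (cases "k < j")
      case True
      then obtain i where i: "j = i + Suc k" by (metis add.commute add_Suc_right less_imp_Suc_add)
      have e: "2 ^ k / 2 ^ j = (1 / 2 ^ Suc i :: real)" unfolding i by (simp add: power_add)
      have "measure \<mu> (cball y (2 ^ k / 2 ^ j)) \<le> c2 * h (2 * (1 / 2 ^ Suc i))"
        unfolding e by (rule cball_measure_le) simp_all
      also have "\<dots> = c2 * dyadic h i" by (simp add: dyadic_eq)
      also have "\<dots> \<le> c2 * (K ^ Suc k * dyadic h j)"
        unfolding i using c2 by (intro mult_left_mono dyadic_doubling_power K) simp_all
      also have "\<dots> = (c2 * K) * (K ^ k * dyadic h j)" by simp
      also have "\<dots> \<le> (c2 * K + m) * (K ^ k * dyadic h j)"
        using m Kd by (intro mult_right_mono) simp_all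
      finally show ?thesis by (simp add: mult.assoc)
    next
      case False
      have "measure \<mu> (cball y (2 ^ k / 2 ^ j)) \<le> measure \<mu> (space \<mu>)" by (rule bounded_measure)
      also have "\<dots> = m * dyadic h 0" using dyadic_pos[of 0] by (simp add: m_def)
      also have "\<dots> \<le> m * (K ^ j * dyadic h (0 + j))"
        using m by (intro mult_left_mono dyadic_doubling_power K) simp_all
      also have "\<dots> \<le> m * (K ^ k * dyadic h j)"
        using m False dyadic_pos[of j] power_increasing[OF _ K(1), of j k]
        by (intro mult_left_mono mult_right_mono) simp_all
      also have "\<dots> \<le> (c2 * K + m) * (K ^ k * dyadic h j)"
        using c2 K(1) Kd by (intro mult_right_mono) simp_all
      finally show ?thesis by (simp add: mult.assoc)
    qed
  qed (rule K(1))
qed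

text \<open>The least \<open>k\<close> with \<open>2 ^ j * norm (x - y) \<le> 2 ^ k\<close> serves:
  for positive \<open>k\<close> minimality bounds the distance from below. Powers of the weight are
  thus dominated by a series of indicators of dyadic balls.\<close>

lemma weight_le_dyadic:
  fixes x y :: 'a
  shows "\<exists>k. x \<in> cball y (2 ^ k / 2 ^ j) \<and> weight j x y \<le> 2 * (1 / 2) ^ k"
proof -
  define t where "t = 2 ^ j * norm (x - y)"
  have t: "t \<ge> 0" by (simp add: t_def)
  obtain n where n: "t < 2 ^ n" using real_arch_pow[of 2 t] by auto
  define k where "k = (LEAST k. t \<le> 2 ^ k)"
  have k: "t \<le> 2 ^ k" unfolding k_def by (rule LeastI[of _ n]) (use n in simp)
  have w: "weight j x y = 1 / (1 + t)" by (simp add: weight_def t_def)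
  have "weight j x y \<le> 2 * (1 / 2) ^ k"
  proof (cases k)
    case 0
    then show ?thesis using weight_le_1[of j x y] by simp
  next
    case (Suc i)
    have "\<not> t \<le> 2 ^ i" using not_less_Least[of i "\<lambda>k. t \<le> 2 ^ k"] Suc by (simp add: k_def)
    then have "1 / (1 + t) \<le> 1 / 2 ^ i" using t by (intro divide_left_mono mult_pos_pos) simp_all
    then show ?thesis unfolding w Suc by (simp add: power_one_over)
  qed
  moreover have "x \<in> cball y (2 ^ k / 2 ^ j)"
    using k unfolding t_def by (simp add: dist_norm norm_minus_commute field_simps)
  ultimately show ?thesis by blast
qed

lemma weight_integral:
  obtains B C where "C > 0" "\<And>j y. (\<integral>\<^sup>+x. ennreal (weight j x y ^ B) \<partial>\<mu>) \<le> ennreal (C * dyadic h j)"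
proof -
  obtain C K where CK: "C > 0" "K \<ge> 1" "\<And>j k y. measure \<mu> (cball y (2 ^ k / 2 ^ j)) \<le> C * K ^ k * dyadic h j"
    by (rule cball_measure_dyadic) blast
  \<comment> \<open>The \<open>k\<close>-th ball has measure of order \<open>K ^ k\<close>, while
    the weight to the power \<open>B\<close> contributes \<open>(1 / 2) ^ (k * B)\<close>; this
    choice of \<open>B\<close> leaves a geometric series of ratio \<open>1 / 2\<close>.\<close>
  obtain B where B: "2 * K < 2 ^ B" using real_arch_pow[of 2 "2 * K"] by auto
  show ?thesis
  proof (rule that)
    show "2 ^ B * C * 2 > 0" using CK by simp
    fix j and y :: 'a
    let ?t = "\<lambda>k x. ennreal ((2 * (1 / 2) ^ k) ^ B) * indicator (cball y (2 ^ k / 2 ^ j)) x"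
    have "ennreal (weight j x y ^ B) \<le> (\<Sum>k. ?t k x)" for x
    proof -
      obtain k where k: "x \<in> cball y (2 ^ k / 2 ^ j)" "weight j x y \<le> 2 * (1 / 2) ^ k"
        using weight_le_dyadic by blast
      have "weight j x y ^ B \<le> (2 * (1 / 2) ^ k) ^ B"
        by (intro power_mono k less_imp_le[OF weight_pos])
      then have "ennreal (weight j x y ^ B) \<le> ?t k x" using k(1) by (simp add: ennreal_leI)
      also have "\<dots> \<le> (\<Sum>k. ?t k x)" by (rule ennreal_le_suminf)
      finally show ?thesis .
    qed
    then have "(\<integral>\<^sup>+x. ennreal (weight j x y ^ B) \<partial>\<mu>) \<le> (\<integral>\<^sup>+x. (\<Sum>k. ?t k x) \<partial>\<mu>)"
      by (intro nn_integral_mono) simp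
    also have "\<dots> = (\<Sum>k. \<integral>\<^sup>+x. ?t k x \<partial>\<mu>)"
      by (intro nn_integral_suminf borel_measurable_times_ennreal borel_measurable_const borel_measurable_indicator
          sets_closed closed_cball)
    also have "\<dots> \<le> (\<Sum>k. ennreal (2 ^ B * C * dyadic h j * (1 / 2) ^ k))"
    proof (intro suminf_le summableI)
      fix k
      have "(\<integral>\<^sup>+x. ?t k x \<partial>\<mu>) = ennreal ((2 * (1 / 2) ^ k) ^ B) * emeasure \<mu> (cball y (2 ^ k / 2 ^ j))"
        by (intro nn_integral_cmult_indicator sets_closed closed_cball)
      also have "\<dots> = ennreal ((2 * (1 / 2) ^ k) ^ B * measure \<mu> (cball y (2 ^ k / 2 ^ j)))"
        by (simp add: emeasure_eq_measure ennreal_mult)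
      also have "\<dots> \<le> ennreal (2 ^ B * C * dyadic h j * (1 / 2) ^ k)"
      proof (rule ennreal_leI)
        have Kp: "K ^ k \<le> (2 ^ B / 2) ^ k" using B CK(2) by (intro power_mono) simp_all
        have "(2 * (1 / 2) ^ k) ^ B * measure \<mu> (cball y (2 ^ k / 2 ^ j)) \<le> (2 * (1 / 2) ^ k) ^ B * (C * K ^ k * dyadic h j)"
          by (intro mult_left_mono CK) simp
        also have "\<dots> \<le> (2 * (1 / 2) ^ k) ^ B * (C * (2 ^ B / 2) ^ k * dyadic h j)"
          using CK(1) dyadic_pos[of j] by (intro mult_left_mono mult_right_mono Kp) simp_all
        also have "\<dots> = 2 ^ B * C * dyadic h j * (((1 / 2) ^ k) ^ B * (2 ^ B / 2) ^ k)"
        proof -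
          have "(2 * a) ^ B * (C * b * d) = 2 ^ B * C * d * (a ^ B * b)" for a b d :: real
            by (simp add: power_mult_distrib mult_ac)
          then show ?thesis by blast
        qed
        also have "((1 / 2) ^ k) ^ B * (2 ^ B / 2) ^ k = (1 / 2 :: real) ^ k"
        proof -
          have "((1 / 2) ^ k) ^ B = ((1 / 2 :: real) ^ B) ^ k" by (simp only: power_mult[symmetric] mult.commute)
          then have "((1 / 2) ^ k) ^ B * (2 ^ B / 2) ^ k = ((1 / 2) ^ B * (2 ^ B / 2) :: real) ^ k"
            by (simp only: power_mult_distrib)
          also have "(1 / 2) ^ B * (2 ^ B / 2) = (1 / 2 :: real)" by (simp add: power_one_over)
          finally show ?thesis .
        qed
        finally show "(2 * (1 / 2) ^ k) ^ B * measure \<mu> (cball y (2 ^ k / 2 ^ j)) \<le> 2 ^ B * C * dyadic h j * (1 / 2) ^ k" .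
      qed
      finally show "(\<integral>\<^sup>+x. ?t k x \<partial>\<mu>) \<le> ennreal (2 ^ B * C * dyadic h j * (1 / 2) ^ k)" .
    qed
    also have "\<dots> = ennreal (2 ^ B * C * dyadic h j * 2)"
    proof (rule suminf_ennreal_eq)
      have "(\<lambda>k. (1 / 2 :: real) ^ k) sums 2" using geometric_sums[of "1 / 2 :: real"] by simp
      then show "(\<lambda>k. 2 ^ B * C * dyadic h j * (1 / 2) ^ k) sums (2 ^ B * C * dyadic h j * 2)" by (rule sums_mult)
      show "0 \<le> 2 ^ B * C * dyadic h j * (1 / 2) ^ k" for k using CK(1) dyadic_pos[of j] by simp
    qed
    also have "\<dots> = ennreal (2 ^ B * C * 2 * dyadic h j)" by (simp add: mult_ac)
    finally show "(\<integral>\<^sup>+x. ennreal (weight j x y ^ B) \<partial>\<mu>) \<le> ennreal (2 ^ B * C * 2 * dyadic h j)" .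
  qed
qed

text \<open>The local estimate is integrated over \<open>\<mu>\<close> by Tonelli, and integrating
  the weight produces \<open>dyadic h j\<close>. This treats the \<open>p\<close>-th power; the
  remaining exponent \<open>r - p\<close> is paid by a uniform bound, which is where
  \<open>p \<le> r\<close> enters.\<close>

lemma block_trace_estimate:
  fixes \<phi>0 :: "'a \<Rightarrow> complex"
  assumes \<phi>: "resolution_generator \<phi>0" and p: "0 < p" "p \<le> r"
  obtains C where "C > 0"
    "\<And>j f. f \<in> schwartz \<Longrightarrow> (\<integral>\<^sup>+x. ennreal (norm (block \<phi>0 j f x) powr r) \<partial>\<mu>)
      \<le> ennreal (C * dyadic h j * ((2 ^ j) ^ DIM('a) * (\<integral>y. norm (block \<phi>0 j f y) powr p \<partial>lborel)) powr (r / p))"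
proof -
  have \<phi>S: "\<phi>0 \<in> schwartz" using \<phi> by (auto simp: resolution_generator_def)
  obtain B C' where BC: "C' > 0" "\<And>j y. (\<integral>\<^sup>+x. ennreal (weight j x y ^ B) \<partial>\<mu>) \<le> ennreal (C' * dyadic h j)"
    by (rule weight_integral) blast
  obtain C where C: "C > 0"
    "\<And>j f x. f \<in> schwartz \<Longrightarrow> norm (block \<phi>0 j f x) powr p
      \<le> C * (2 ^ j) ^ DIM('a) * (\<integral>y. norm (block \<phi>0 j f y) powr p * weight j x y ^ B \<partial>lborel)"
    by (rule block_local_estimate[OF \<phi> p(1), of B]) blast
  interpret P: pair_sigma_finite \<mu> "lborel :: 'a measure"
    by (intro pair_sigma_finite.intro sigma_finite_lborel sigma_finite_measure_axioms)
  show ?thesis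
  proof (rule that)
    show "C powr (r / p) * C' > 0" using C(1) BC(1) by simp
    fix j f assume f: "f \<in> (schwartz :: ('a \<Rightarrow> complex) set)"
    define g where "g = block \<phi>0 j f"
    have gS: "g \<in> schwartz" unfolding g_def by (rule block_schwartz[OF \<phi>S f])
    have [measurable]: "g \<in> borel_measurable borel" by (rule schwartz_measurable[OF gS])
    define D where "D = (2 ^ j :: real) ^ DIM('a)"
    have D: "D > 0" by (simp add: D_def)
    define A where "A = (\<integral>y. norm (g y) powr p \<partial>lborel)"
    have A: "A \<ge> 0" unfolding A_def by (intro integral_nonneg_AE AE_I2) simp
    have intg: "integrable lborel (\<lambda>y. norm (g y) powr p)" by (rule schwartz_powr_integrable[OF gS p(1)])
    have intw: "integrable lborel (\<lambda>y. norm (g y) powr p * weight j x y ^ B)" for x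
      by (rule integrable_weight_mult[OF intg])
    have loc: "norm (g x) powr p \<le> C * D * (\<integral>y. norm (g y) powr p * weight j x y ^ B \<partial>lborel)" for x
      unfolding g_def D_def by (rule C(2)[OF f])
    \<comment> \<open>Dropping the weight from the local estimate gives Nikolskii's inequality: the
      supremum of a block is controlled by its integral norm.\<close>
    have sup: "norm (g x) powr p \<le> C * D * A" for x
    proof -
      have "(\<integral>y. norm (g y) powr p * weight j x y ^ B \<partial>lborel) \<le> A"
        unfolding A_def
        by (intro integral_mono intw intg mult_left_le power_le_one weight_le_1 less_imp_le[OF weight_pos]) simp
      from order_trans[OF loc[of x] mult_left_mono[OF this, of "C * D"]] show ?thesis using C(1) D by simp
    qed
    have intp: "(\<integral>\<^sup>+x. ennreal (norm (g x) powr p) \<partial>\<mu>) \<le> ennreal (C * D) * (ennreal A * ennreal (C' * dyadic h j))"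
    proof -
      have "(\<integral>\<^sup>+x. ennreal (norm (g x) powr p) \<partial>\<mu>)
        \<le> (\<integral>\<^sup>+x. ennreal (C * D) * (\<integral>\<^sup>+y. ennreal (norm (g y) powr p) * ennreal (weight j x y ^ B) \<partial>lborel) \<partial>\<mu>)"
      proof (rule nn_integral_mono)
        fix x
        have "(\<integral>\<^sup>+y. ennreal (norm (g y) powr p) * ennreal (weight j x y ^ B) \<partial>lborel)
            = ennreal (\<integral>y. norm (g y) powr p * weight j x y ^ B \<partial>lborel)"
          by (subst nn_integral_eq_integral[OF intw, symmetric])
            (auto simp: weight_pos less_imp_le ennreal_mult)
        then show "ennreal (norm (g x) powr p) \<le> ennreal (C * D) * (\<integral>\<^sup>+y. ennreal (norm (g y) powr p) * ennreal (weight j x y ^ B) \<partial>lborel)"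
          using loc[of x] C(1) D
          by (simp add: ennreal_leI ennreal_mult[symmetric] integral_nonneg_AE weight_pos less_imp_le)
      qed
      also have "\<dots> = ennreal (C * D) * (\<integral>\<^sup>+x. (\<integral>\<^sup>+y. ennreal (norm (g y) powr p) * ennreal (weight j x y ^ B) \<partial>lborel) \<partial>\<mu>)"
        unfolding weight_def by (intro nn_integral_cmult) measurable
      also have "(\<integral>\<^sup>+x. (\<integral>\<^sup>+y. ennreal (norm (g y) powr p) * ennreal (weight j x y ^ B) \<partial>lborel) \<partial>\<mu>)
          = (\<integral>\<^sup>+y. (\<integral>\<^sup>+x. ennreal (norm (g y) powr p) * ennreal (weight j x y ^ B) \<partial>\<mu>) \<partial>lborel)"
        unfolding weight_def by (rule P.Fubini'[symmetric]) measurable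
      also have "\<dots> = (\<integral>\<^sup>+y. ennreal (norm (g y) powr p) * (\<integral>\<^sup>+x. ennreal (weight j x y ^ B) \<partial>\<mu>) \<partial>lborel)"
        unfolding weight_def by (intro nn_integral_cong nn_integral_cmult) measurable
      also have "\<dots> \<le> (\<integral>\<^sup>+y. ennreal (norm (g y) powr p) * ennreal (C' * dyadic h j) \<partial>lborel)"
        by (intro nn_integral_mono mult_left_mono BC) simp
      also have "\<dots> = (\<integral>\<^sup>+y. ennreal (norm (g y) powr p) \<partial>lborel) * ennreal (C' * dyadic h j)"
        by (intro nn_integral_multc) measurable
      also have "(\<integral>\<^sup>+y. ennreal (norm (g y) powr p) \<partial>lborel) = ennreal A"
        unfolding A_def by (intro nn_integral_eq_integral intg) simp
      finally show ?thesis by (simp add: mult_left_mono)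
    qed
    have "ennreal (norm (g x) powr r) \<le> ennreal ((C * D * A) powr (r / p - 1)) * ennreal (norm (g x) powr p)" for x
    proof -
      have "norm (g x) powr r = (norm (g x) powr p) powr (r / p - 1) * norm (g x) powr p"
      proof (cases "g x = 0")
        case False
        then show ?thesis using p by (simp add: powr_powr powr_add[symmetric] field_simps)
      qed (use p in simp)
      also have "\<dots> \<le> (C * D * A) powr (r / p - 1) * norm (g x) powr p"
        using p by (intro mult_right_mono powr_mono2 sup) (simp_all add: field_simps)
      finally show ?thesis by (simp add: ennreal_leI flip: ennreal_mult)
    qed
    then have "(\<integral>\<^sup>+x. ennreal (norm (g x) powr r) \<partial>\<mu>) \<le> (\<integral>\<^sup>+x. ennreal ((C * D * A) powr (r / p - 1)) * ennreal (norm (g x) powr p) \<partial>\<mu>)"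
      by (intro nn_integral_mono)
    also have "\<dots> = ennreal ((C * D * A) powr (r / p - 1)) * (\<integral>\<^sup>+x. ennreal (norm (g x) powr p) \<partial>\<mu>)"
      by (intro nn_integral_cmult) measurable
    also have "\<dots> \<le> ennreal ((C * D * A) powr (r / p - 1)) * (ennreal (C * D) * (ennreal A * ennreal (C' * dyadic h j)))"
      by (intro mult_left_mono intp) simp
    also have "ennreal ((C * D * A) powr (r / p - 1)) * (ennreal (C * D) * (ennreal A * ennreal (C' * dyadic h j)))
        = ennreal ((C * D * A) powr (r / p - 1) * (C * D * (A * (C' * dyadic h j))))"
      using C(1) D A BC(1) dyadic_pos[of j] by (simp add: ennreal_mult)
    also have "(C * D * A) powr (r / p - 1) * (C * D * (A * (C' * dyadic h j))) = ((C * D * A) * (C * D * A) powr (r / p - 1)) * (C' * dyadic h j)"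
      by (simp add: mult_ac)
    also have "(C * D * A) * (C * D * A) powr (r / p - 1) = (C * D * A) powr (r / p)"
      using C(1) D A by (subst powr_mult_base) simp_all
    also have "\<dots> = C powr (r / p) * (D * A) powr (r / p)"
      using C(1) D A by (simp add: powr_mult mult.assoc)
    finally show "(\<integral>\<^sup>+x. ennreal (norm (block \<phi>0 j f x) powr r) \<partial>\<mu>)
      \<le> ennreal (C powr (r / p) * C' * dyadic h j * ((2 ^ j) ^ DIM('a) * (\<integral>y. norm (block \<phi>0 j f y) powr p \<partial>lborel)) powr (r / p))"
      by (simp add: g_def D_def A_def mult_ac)
  qed
qed

end

section \<open>Sufficiency\<close>

lemma epowr_ennreal: "x \<ge> 0 \<Longrightarrow> epowr (ennreal x) a = ennreal (x powr a)"
  by (simp add: epowr_def)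

lemma epowr_mono: "a \<ge> 0 \<Longrightarrow> s \<le> t \<Longrightarrow> epowr s a \<le> epowr t a"
  unfolding epowr_def by (auto intro!: ennreal_leI powr_mono2 enn2real_mono simp: top_unique less_top)

text \<open>The common core of the cases \<open>r \<le> 1\<close> and \<open>r \<ge> 1\<close>,
  which differ only in the coefficients \<open>k j\<close>. As these are nonnegative, the limit is
  dominated pointwise by the full series, and the series can be integrated term by term.\<close>

lemma nn_integral_limit_of_sums:
  fixes g :: "nat \<Rightarrow> 'b \<Rightarrow> complex"
  assumes [measurable]: "\<And>j. g j \<in> borel_measurable M"
    and lim: "\<And>x. (\<lambda>J. \<Sum>j\<le>J. g j x) \<longlonglongrightarrow> f x" and r: "r > 0"
    and le: "\<And>J x. norm (\<Sum>j\<le>J. g j x) powr r \<le> (\<Sum>j\<le>J. k j * norm (g j x) powr r)" and k: "\<And>j. k j \<ge> 0"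
    and int: "\<And>j. (\<integral>\<^sup>+x. ennreal (norm (g j x) powr r) \<partial>M) \<le> ennreal (c j)" and c: "\<And>j. c j \<ge> 0"
    and S: "\<And>j. k j * c j \<le> d j" "d sums S"
  shows "(\<integral>\<^sup>+x. ennreal (norm (f x) powr r) \<partial>M) \<le> ennreal S"
proof -
  have pw: "ennreal (norm (f x) powr r) \<le> (\<Sum>j. ennreal (k j) * ennreal (norm (g j x) powr r))" for x
  proof (rule LIMSEQ_le_const2)
    have "(\<lambda>J. norm (\<Sum>j\<le>J. g j x) powr r) \<longlonglongrightarrow> norm (f x) powr r"
    proof (rule tendsto_powr2[OF tendsto_norm[OF lim] tendsto_const])
      show "\<forall>\<^sub>F J in sequentially. 0 \<le> norm (\<Sum>j\<le>J. g j x)" by simp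
    qed (rule r)
    then show "(\<lambda>J. ennreal (norm (\<Sum>j\<le>J. g j x) powr r)) \<longlonglongrightarrow> ennreal (norm (f x) powr r)"
      by (rule tendsto_ennrealI)
    have "ennreal (norm (\<Sum>j\<le>J. g j x) powr r) \<le> (\<Sum>j. ennreal (k j) * ennreal (norm (g j x) powr r))" for J
    proof -
      have "ennreal (norm (\<Sum>j\<le>J. g j x) powr r) \<le> ennreal (\<Sum>j\<le>J. k j * norm (g j x) powr r)"
        by (rule ennreal_leI[OF le])
      also have "\<dots> = (\<Sum>j\<le>J. ennreal (k j) * ennreal (norm (g j x) powr r))"
        using k by (simp add: sum_ennreal[symmetric] ennreal_mult)
      also have "\<dots> \<le> (\<Sum>j. ennreal (k j) * ennreal (norm (g j x) powr r))"
        by (intro sum_le_suminf summableI) simp_all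
      finally show ?thesis .
    qed
    then show "\<exists>N. \<forall>J\<ge>N. ennreal (norm (\<Sum>j\<le>J. g j x) powr r) \<le> (\<Sum>j. ennreal (k j) * ennreal (norm (g j x) powr r))"
      by blast
  qed
  have "(\<integral>\<^sup>+x. ennreal (norm (f x) powr r) \<partial>M) \<le> (\<integral>\<^sup>+x. (\<Sum>j. ennreal (k j) * ennreal (norm (g j x) powr r)) \<partial>M)"
    by (intro nn_integral_mono pw)
  also have "\<dots> = (\<Sum>j. \<integral>\<^sup>+x. ennreal (k j) * ennreal (norm (g j x) powr r) \<partial>M)"
    by (rule nn_integral_suminf) measurable
  also have "\<dots> = (\<Sum>j. ennreal (k j) * (\<integral>\<^sup>+x. ennreal (norm (g j x) powr r) \<partial>M))"
    by (intro suminf_cong nn_integral_cmult) measurable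
  also have "\<dots> \<le> (\<Sum>j. ennreal (d j))"
  proof (intro suminf_le summableI)
    fix j
    have "ennreal (k j) * (\<integral>\<^sup>+x. ennreal (norm (g j x) powr r) \<partial>M) \<le> ennreal (k j) * ennreal (c j)"
      by (intro mult_left_mono int) simp
    also have "\<dots> = ennreal (k j * c j)" using k c by (simp add: ennreal_mult)
    also have "\<dots> \<le> ennreal (d j)" by (intro ennreal_leI S)
    finally show "ennreal (k j) * (\<integral>\<^sup>+x. ennreal (norm (g j x) powr r) \<partial>M) \<le> ennreal (d j)" .
  qed
  also have "\<dots> = ennreal S"
    by (rule suminf_ennreal_eq[OF _ S(2)]) (rule order_trans[OF mult_nonneg_nonneg[OF k c] S(1)])
  finally show ?thesis .
qed

text \<open>After division by \<open>x + y\<close> both summands lie in the unit interval, where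
  raising to a power \<open>r \<le> 1\<close> does not decrease them.\<close>

lemma powr_add_le:
  fixes x y r :: real
  assumes "x \<ge> 0" "y \<ge> 0" "0 < r" "r \<le> 1"
  shows "(x + y) powr r \<le> x powr r + y powr r"
proof (cases "x + y = 0")
  case False
  define u v where "u = x / (x + y)" and "v = y / (x + y)"
  have pos: "x + y > 0" using False assms by simp
  have uv: "0 \<le> u" "u \<le> 1" "0 \<le> v" "v \<le> 1" "u + v = 1"
    using assms pos by (auto simp: u_def v_def add_divide_distrib[symmetric])
  have "u powr 1 \<le> u powr r" using uv assms by (intro powr_mono') simp_all
  moreover have "v powr 1 \<le> v powr r" using uv assms by (intro powr_mono') simp_all
  ultimately have "1 \<le> u powr r + v powr r" using uv by simp
  then have "(x + y) powr r * 1 \<le> (x + y) powr r * (u powr r + v powr r)"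
    by (intro mult_left_mono) simp_all
  also have "\<dots> = ((x + y) * u) powr r + ((x + y) * v) powr r"
    using pos uv by (simp add: powr_mult distrib_left)
  also have "\<dots> = x powr r + y powr r" using pos by (simp add: u_def v_def)
  finally show ?thesis by simp
qed (use assms in simp)

lemma norm_sum_powr_le:
  fixes z :: "nat \<Rightarrow> complex"
  assumes "0 < r" "r \<le> 1"
  shows "norm (\<Sum>j\<le>J. z j) powr r \<le> (\<Sum>j\<le>J. norm (z j) powr r)"
proof (induction J)
  case (Suc J)
  have "norm (\<Sum>j\<le>Suc J. z j) powr r \<le> (norm (\<Sum>j\<le>J. z j) + norm (z (Suc J))) powr r"
    using assms by (intro powr_mono2) (simp_all add: norm_triangle_ineq)
  also have "\<dots> \<le> norm (\<Sum>j\<le>J. z j) powr r + norm (z (Suc J)) powr r"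
    using assms by (intro powr_add_le) simp_all
  finally show ?case using Suc by simp
qed simp

text \<open>A pointwise substitute for Minkowski's inequality. The \<open>j\<close>-th term is split
  at the threshold \<open>e j * t\<close>; with \<open>t = y / (2 * E)\<close> the thresholds add up
  to at most half of the left-hand side \<open>y\<close> and are absorbed.\<close>

lemma norm_sum_powr_le_weighted:
  fixes z :: "nat \<Rightarrow> complex"
  assumes r: "1 \<le> r" and e: "\<And>j. e j > 0" and E: "(\<Sum>j\<le>J. e j) \<le> E"
  shows "norm (\<Sum>j\<le>J. z j) powr r \<le> (\<Sum>j\<le>J. 2 * (2 * E) powr (r - 1) * e j powr (1 - r) * norm (z j) powr r)"
proof (cases "(\<Sum>j\<le>J. z j) = 0")
  case True
  then show ?thesis by (auto intro!: sum_nonneg)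
next
  case False
  define y where "y = norm (\<Sum>j\<le>J. z j)"
  have y: "y > 0" using False by (simp add: y_def)
  have "(\<Sum>j\<le>J. e j) > 0" using e by (intro sum_pos) auto
  then have Epos: "E > 0" using E by simp
  define t where "t = y / (2 * E)"
  have t: "t > 0" using y Epos by (simp add: t_def)
  define Z where "Z = (\<Sum>j\<le>J. e j powr (1 - r) * norm (z j) powr r)"
  have "y \<le> (\<Sum>j\<le>J. norm (z j))" unfolding y_def by (rule norm_sum)
  also have "\<dots> \<le> (\<Sum>j\<le>J. (e j * t) powr (1 - r) * norm (z j) powr r + e j * t)"
    using e t r by (intro sum_mono le_powr_split) simp_all
  also have "\<dots> = t powr (1 - r) * Z + (\<Sum>j\<le>J. e j) * t"
    using e t by (simp add: Z_def powr_mult less_imp_le sum.distrib sum_distrib_left sum_distrib_right mult_ac)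
  also have "\<dots> \<le> t powr (1 - r) * Z + E * t" using E t by (intro add_left_mono mult_right_mono) simp_all
  also have "E * t = y / 2" using Epos by (simp add: t_def)
  finally have "y / 2 \<le> t powr (1 - r) * Z" by simp
  then have "y / 2 * t powr (r - 1) \<le> t powr (1 - r) * Z * t powr (r - 1)" by (intro mult_right_mono) simp_all
  also have "\<dots> = Z" using t by (simp add: powr_add[symmetric] mult_ac)
  finally have le: "y * t powr (r - 1) \<le> 2 * Z" by simp
  have "y powr r = y * y powr (r - 1)" using y by (simp add: powr_mult_base)
  also have "y powr (r - 1) = (2 * E) powr (r - 1) * t powr (r - 1)"
    using Epos y by (simp add: t_def powr_mult[symmetric])
  also have "y * ((2 * E) powr (r - 1) * t powr (r - 1)) \<le> (2 * E) powr (r - 1) * (2 * Z)"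
    using mult_left_mono[OF le, of "(2 * E) powr (r - 1)"] by (simp add: mult_ac)
  finally show ?thesis by (simp add: y_def Z_def sum_distrib_left mult_ac)
qed

text \<open>For \<open>r \<ge> 1\<close> the constant \<open>2 powr r\<close> is not optimal; the summands \<open>\<epsilon> / 2\<^sup>j\<^sup>+\<^sup>1\<close> in the proof
  only serve to keep the weights positive.\<close>

lemma nn_integral_series_powr_le:
  fixes g :: "nat \<Rightarrow> 'b \<Rightarrow> complex"
  assumes g: "\<And>j. g j \<in> borel_measurable M"
    and lim: "\<And>x. (\<lambda>J. \<Sum>j\<le>J. g j x) \<longlonglongrightarrow> f x" and r: "r > 0"
    and b: "\<And>j. b j \<ge> 0" and int: "\<And>j. (\<integral>\<^sup>+x. ennreal (norm (g j x) powr r) \<partial>M) \<le> ennreal (b j powr r)"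
    and s: "s = min r 1" and sum: "summable (\<lambda>j. b j powr s)"
  shows "(\<integral>\<^sup>+x. ennreal (norm (f x) powr r) \<partial>M) \<le> ennreal (2 powr r * (\<Sum>j. b j powr s) powr (r / s))"
proof (cases "r \<le> 1")
  case True
  then have sr: "s = r" using s by simp
  have "(\<integral>\<^sup>+x. ennreal (norm (f x) powr r) \<partial>M) \<le> ennreal (\<Sum>j. b j powr s)"
  proof (rule nn_integral_limit_of_sums[OF g lim r, where k = "\<lambda>_. 1" and c = "\<lambda>j. b j powr r" and d = "\<lambda>j. b j powr s"])
    show "norm (\<Sum>j\<le>J. g j x) powr r \<le> (\<Sum>j\<le>J. 1 * norm (g j x) powr r)" for J x
      using norm_sum_powr_le[OF r True] by simp
  qed (use int sum sr in \<open>auto simp: summable_sums\<close>)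
  also have "\<dots> \<le> ennreal (2 powr r * (\<Sum>j. b j powr s) powr (r / s))"
  proof (rule ennreal_leI)
    have S0: "(\<Sum>j. b j powr s) \<ge> 0" by (intro suminf_nonneg sum) simp
    have "(1::real) \<le> 2 powr r" using r by (simp add: ge_one_powr_ge_zero)
    then have "1 * (\<Sum>j. b j powr s) \<le> 2 powr r * (\<Sum>j. b j powr s)" using S0 by (rule mult_right_mono)
    then show "(\<Sum>j. b j powr s) \<le> 2 powr r * (\<Sum>j. b j powr s) powr (r / s)" using sr r S0 by simp
  qed
  finally show ?thesis .
next
  case False
  then have s1: "s = 1" and r1: "1 \<le> r" using s by simp_all
  have bs: "summable b" using sum b by (simp add: s1)
  define B where "B = suminf b"
  have B: "B \<ge> 0" unfolding B_def by (intro suminf_nonneg bs b)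
  have bound: "(\<integral>\<^sup>+x. ennreal (norm (f x) powr r) \<partial>M) \<le> ennreal ((2 * (B + \<epsilon>)) powr r)" if "\<epsilon> > 0" for \<epsilon>
  proof -
    define e where "e j = b j + \<epsilon> * (1 / 2) ^ Suc j" for j
    have e: "e j > 0" for j using b[of j] that by (simp add: e_def add_nonneg_pos)
    have E: "e sums (B + \<epsilon>)"
      unfolding e_def B_def using summable_sums[OF bs] sums_mult[OF power_half_series, of \<epsilon>] by (intro sums_add) simp_all
    have le: "(\<Sum>j\<le>J. e j) \<le> B + \<epsilon>" for J
      using sum_le_suminf[OF sums_summable[OF E], of "{..J}"] e sums_unique[OF E] by (simp add: less_imp_le)
    have Epos: "B + \<epsilon> > 0" using B that by simp
    have "(\<integral>\<^sup>+x. ennreal (norm (f x) powr r) \<partial>M) \<le> ennreal (2 * (2 * (B + \<epsilon>)) powr (r - 1) * (B + \<epsilon>))"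
    proof (rule nn_integral_limit_of_sums[OF g lim r, where k = "\<lambda>j. 2 * (2 * (B + \<epsilon>)) powr (r - 1) * e j powr (1 - r)"
          and c = "\<lambda>j. b j powr r" and d = "\<lambda>j. 2 * (2 * (B + \<epsilon>)) powr (r - 1) * e j"])
      show "norm (\<Sum>j\<le>J. g j x) powr r \<le> (\<Sum>j\<le>J. 2 * (2 * (B + \<epsilon>)) powr (r - 1) * e j powr (1 - r) * norm (g j x) powr r)" for J x
        by (rule norm_sum_powr_le_weighted[OF r1 e le])
      show "(\<lambda>j. 2 * (2 * (B + \<epsilon>)) powr (r - 1) * e j) sums (2 * (2 * (B + \<epsilon>)) powr (r - 1) * (B + \<epsilon>))"
        by (rule sums_mult[OF E])
      fix j
      have "b j powr r \<le> e j powr r" using b[of j] that r by (intro powr_mono2) (simp_all add: e_def)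
      then have "e j powr (1 - r) * b j powr r \<le> e j powr (1 - r) * e j powr r" by (intro mult_left_mono) simp_all
      also have "\<dots> = e j" using e[of j] by (simp add: powr_add[symmetric])
      finally show "2 * (2 * (B + \<epsilon>)) powr (r - 1) * e j powr (1 - r) * b j powr r \<le> 2 * (2 * (B + \<epsilon>)) powr (r - 1) * e j"
        by (simp add: mult.assoc mult_left_mono)
    qed (use int in auto)
    also have "2 * (2 * (B + \<epsilon>)) powr (r - 1) * (B + \<epsilon>) = (2 * (B + \<epsilon>)) * (2 * (B + \<epsilon>)) powr (r - 1)" by simp
    also have "\<dots> = (2 * (B + \<epsilon>)) powr r" using Epos by (subst powr_mult_base) simp_all
    finally show ?thesis .
  qed
  \<comment> \<open>The left-hand side does not depend on \<open>\<epsilon>\<close>, so the bound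
    passes to the limit along \<open>\<epsilon> = 1 / (n + 1)\<close>.\<close>
  have "(\<lambda>n. ennreal ((2 * (B + inverse (real (Suc n)))) powr r)) \<longlonglongrightarrow> ennreal ((2 * (B + 0)) powr r)"
  proof (intro tendsto_ennrealI tendsto_powr2 tendsto_const tendsto_mult tendsto_add LIMSEQ_inverse_real_of_nat r)
    show "\<forall>\<^sub>F n in sequentially. 0 \<le> 2 * (B + inverse (real (Suc n)))" using B by (intro always_eventually) simp
  qed
  then have "(\<integral>\<^sup>+x. ennreal (norm (f x) powr r) \<partial>M) \<le> ennreal ((2 * (B + 0)) powr r)"
    by (rule LIMSEQ_le_const) (use bound in auto)
  also have "(2 * (B + 0)) powr r = 2 powr r * (\<Sum>j. b j powr s) powr (r / s)"
    using B b by (simp add: powr_mult s1 B_def)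
  finally show ?thesis .
qed

section \<open>From an inequality between sequences to a bounded trace\<close>

lemma Lp_norm_schwartz:
  assumes "f \<in> schwartz" "p > 0"
  shows "Lp_norm lborel p f = ennreal ((\<integral>x. norm (f x) powr p \<partial>lborel) powr (1 / p))"
proof -
  have "(\<integral>\<^sup>+x. ennreal (norm (f x) powr p) \<partial>lborel) = ennreal (\<integral>x. norm (f x) powr p \<partial>lborel)"
    by (intro nn_integral_eq_integral schwartz_powr_integrable assms) simp
  then show ?thesis unfolding Lp_norm_def by (simp add: epowr_ennreal integral_nonneg_AE)
qed

definition block_norm :: "('a::euclidean_space \<Rightarrow> complex) \<Rightarrow> real \<Rightarrow> nat \<Rightarrow> ('a \<Rightarrow> complex) \<Rightarrow> real" where
  "block_norm \<phi>0 p j f = (\<integral>x. norm (block \<phi>0 j f x) powr p \<partial>lborel) powr (1 / p)"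

lemma besov_norm_schwartz:
  assumes \<phi>: "resolution_generator \<phi>0" and f: "f \<in> schwartz" and p: "0 < p" and \<rho>: "\<And>j. \<rho> j > 0"
  shows "besov_norm \<phi>0 \<rho> p q (regular_distr f) = epowr (\<Sum>j. ennreal ((\<rho> j * block_norm \<phi>0 p j f) powr q)) (1 / q)"
proof -
  have \<phi>S: "\<phi>0 \<in> schwartz" using \<phi> by (auto simp: resolution_generator_def)
  have "ennreal (\<rho> j powr q) * epowr (Lp_norm lborel p (block \<phi>0 j f)) q = ennreal ((\<rho> j * block_norm \<phi>0 p j f) powr q)" for j
  proof -
    have L: "Lp_norm lborel p (block \<phi>0 j f) = ennreal (block_norm \<phi>0 p j f)"
      by (simp add: Lp_norm_schwartz[OF block_schwartz[OF \<phi>S f] p] block_norm_def)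
    have "block_norm \<phi>0 p j f \<ge> 0" by (simp add: block_norm_def)
    then show ?thesis using \<rho>[of j] by (simp add: L epowr_ennreal powr_mult ennreal_mult)
  qed
  then show ?thesis unfolding besov_norm_regular[OF \<phi> f] by (simp only:)
qed

context h_regular begin

lemma Lp_norm_restrict_le:
  assumes "f \<in> schwartz" "r > 0" "(\<integral>\<^sup>+x. ennreal (norm (f x) powr r) \<partial>\<mu>) \<le> ennreal (c powr r)" "c \<ge> 0"
  shows "Lp_norm (restrict_space \<mu> \<Gamma>) r f \<le> ennreal c"
proof -
  have "(\<integral>\<^sup>+x. ennreal (norm (f x) powr r) \<partial>restrict_space \<mu> \<Gamma>) = (\<integral>\<^sup>+x. ennreal (norm (f x) powr r) * indicator \<Gamma> x \<partial>\<mu>)"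
    using compact_imp_closed[OF compact] sets_eq_imp_space_eq[OF sets_mu] by (intro nn_integral_restrict_space) (simp add: sets_mu)
  also have "\<dots> \<le> (\<integral>\<^sup>+x. ennreal (norm (f x) powr r) \<partial>\<mu>)"
    by (intro nn_integral_mono) (auto split: split_indicator)
  also have "\<dots> \<le> ennreal (c powr r)" by (rule assms)
  finally have "Lp_norm (restrict_space \<mu> \<Gamma>) r f \<le> epowr (ennreal (c powr r)) (1 / r)"
    unfolding Lp_norm_def using assms(2) by (intro epowr_mono) simp_all
  also have "\<dots> = ennreal c" using assms by (simp add: epowr_ennreal powr_powr)
  finally show ?thesis .
qed

text \<open>Only a mapping property of sequences is left to check: multiplication by
  \<open>\<tau>\<close> must map the sequence space with exponent \<open>q\<close> boundedly into
  that with exponent \<open>min r 1\<close>. Here \<open>a j\<close> is the \<open>j\<close>-th term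
  of the Besov norm, and the hypothesis on \<open>\<tau> j * \<rho> j\<close> makes
  \<open>\<tau> j * a j\<close> the bound for the trace of the \<open>j\<close>-th block, up to a
  constant.\<close>

lemma bounded_trace_if_sequence_bound:
  fixes \<phi>0 :: "'a \<Rightarrow> complex"
  assumes \<phi>: "resolution_generator \<phi>0" and p: "0 < p" "p \<le> r" and q: "0 < q"
    and \<rho>: "\<And>j. \<rho> j > 0" and \<tau>: "\<And>j. \<tau> j \<ge> 0"
    and \<tau>\<rho>: "\<And>j. \<tau> j * \<rho> j = dyadic h j powr (1 / r) * 2 powr (real j * real DIM('a) / p)"
    and s: "s = min r 1" and C': "C' > 0"
    and sum: "\<And>a. (\<And>j. a j \<ge> 0) \<Longrightarrow> summable (\<lambda>j. a j powr q) \<Longrightarrow> summable (\<lambda>j. (\<tau> j * a j) powr s)"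
    and sum_le: "\<And>a. (\<And>j. a j \<ge> 0) \<Longrightarrow> summable (\<lambda>j. a j powr q) \<Longrightarrow>
        (\<Sum>j. (\<tau> j * a j) powr s) \<le> C' * (\<Sum>j. a j powr q) powr (s / q)"
  shows "bounded_trace \<phi>0 \<rho> p q \<Gamma> \<mu> r"
proof -
  have \<phi>S: "\<phi>0 \<in> schwartz" using \<phi> by (auto simp: resolution_generator_def)
  have r: "r > 0" using p by simp
  have s0: "s > 0" using r s by simp
  obtain C where C: "C > 0"
    "\<And>j f. f \<in> schwartz \<Longrightarrow> (\<integral>\<^sup>+x. ennreal (norm (block \<phi>0 j f x) powr r) \<partial>\<mu>)
      \<le> ennreal (C * dyadic h j * ((2 ^ j) ^ DIM('a) * (\<integral>y. norm (block \<phi>0 j f y) powr p \<partial>lborel)) powr (r / p))"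
    by (rule block_trace_estimate[OF \<phi> p]) blast
  define c where "c = 2 * C powr (1 / r) * C' powr (1 / s)"
  have c: "c > 0" using C(1) C' by (simp add: c_def)
  have "Lp_norm (restrict_space \<mu> \<Gamma>) r f \<le> ennreal c * besov_norm \<phi>0 \<rho> p q (regular_distr f)" if f: "f \<in> schwartz" for f
  proof -
    define a where "a j = \<rho> j * block_norm \<phi>0 p j f" for j
    have a: "a j \<ge> 0" for j using \<rho>[of j] by (simp add: a_def block_norm_def)
    have bn: "besov_norm \<phi>0 \<rho> p q (regular_distr f) = epowr (\<Sum>j. ennreal (a j powr q)) (1 / q)"
      using besov_norm_schwartz[OF \<phi> f p(1), where \<rho> = \<rho> and q = q] \<rho> by (simp only: a_def)
    show ?thesis
    proof (cases "summable (\<lambda>j. a j powr q)")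
      case False
      \<comment> \<open>Here the Besov norm is infinite, and the claim is trivial because
        \<open>c\<close> is positive.\<close>
      have top: "(\<Sum>j. ennreal (a j powr q)) = top"
      proof (rule ccontr)
        assume "(\<Sum>j. ennreal (a j powr q)) \<noteq> top"
        then have "summable (\<lambda>j. a j powr q)" by (intro summable_suminf_not_top) simp_all
        then show False using False by blast
      qed
      show ?thesis unfolding bn top using c by (simp add: epowr_def ennreal_mult_top)
    next
      case True
      define S where "S = (\<Sum>j. a j powr q)"
      have S: "S \<ge> 0" unfolding S_def by (intro suminf_nonneg True) simp
      have bnS: "besov_norm \<phi>0 \<rho> p q (regular_distr f) = ennreal (S powr (1 / q))"
        unfolding bn by (subst suminf_ennreal2) (simp_all add: True S_def[symmetric] S epowr_ennreal)
      define b where "b j = C powr (1 / r) * (\<tau> j * a j)" for j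
      have b: "b j \<ge> 0" for j using \<tau> a by (simp add: b_def)
      have b_powr: "b j powr t = C powr (t / r) * (\<tau> j * a j) powr t" for j t
        using \<tau>[of j] a[of j] C(1) by (simp add: b_def powr_mult powr_powr)
      have int: "(\<integral>\<^sup>+x. ennreal (norm (block \<phi>0 j f x) powr r) \<partial>\<mu>) \<le> ennreal (b j powr r)" for j
      proof -
        define A where "A = (\<integral>y. norm (block \<phi>0 j f y) powr p \<partial>lborel)"
        have A: "A \<ge> 0" unfolding A_def by (intro integral_nonneg_AE AE_I2) simp
        have "\<tau> j * a j = (dyadic h j powr (1 / r) * 2 powr (real j * real DIM('a) / p)) * A powr (1 / p)"
          unfolding \<tau>\<rho>[symmetric] by (simp add: a_def block_norm_def A_def)
        then have "(\<tau> j * a j) powr r = dyadic h j * 2 powr (real j * real DIM('a) / p * r) * A powr (r / p)"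
          using dyadic_pos[of j] r A by (simp add: powr_mult powr_powr)
        also have "2 powr (real j * real DIM('a) / p * r) = ((2 ^ j) ^ DIM('a)) powr (r / p)"
          by (simp add: powr_realpow[symmetric] powr_powr mult.commute)
        finally have "b j powr r = C * dyadic h j * ((2 ^ j) ^ DIM('a) * A) powr (r / p)"
          using C(1) r A unfolding b_powr by (simp add: powr_mult)
        then show ?thesis using C(2)[OF f, of j] unfolding A_def by simp
      qed
      have sumb: "summable (\<lambda>j. b j powr s)"
        unfolding b_powr by (intro summable_mult sum a True)
      have "(\<integral>\<^sup>+x. ennreal (norm (f x) powr r) \<partial>\<mu>) \<le> ennreal (2 powr r * (\<Sum>j. b j powr s) powr (r / s))"
      proof (rule nn_integral_series_powr_le[OF _ block_sum_tendsto[OF \<phi> f] r b int s sumb])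
        show "block \<phi>0 j f \<in> borel_measurable \<mu>" for j
          using schwartz_measurable[OF block_schwartz[OF \<phi>S f]] by (simp cong: measurable_cong_sets[OF sets_mu refl])
      qed
      also have "2 powr r * (\<Sum>j. b j powr s) powr (r / s) \<le> (c * S powr (1 / q)) powr r"
      proof -
        have "(\<Sum>j. b j powr s) = C powr (s / r) * (\<Sum>j. (\<tau> j * a j) powr s)"
          unfolding b_powr by (intro suminf_mult sum a True)
        also have "\<dots> \<le> C powr (s / r) * (C' * S powr (s / q))"
          unfolding S_def by (intro mult_left_mono sum_le a True) simp
        finally have "(\<Sum>j. b j powr s) powr (r / s) \<le> (C powr (s / r) * (C' * S powr (s / q))) powr (r / s)"
          using r s0 sumb by (intro powr_mono2 suminf_nonneg) simp_all
        also have "\<dots> = C * (C' powr (r / s) * S powr (r / q))"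
          using C(1) C' S r s0 by (simp add: powr_mult powr_powr)
        finally have "2 powr r * (\<Sum>j. b j powr s) powr (r / s) \<le> 2 powr r * (C * (C' powr (r / s) * S powr (r / q)))"
          by (intro mult_left_mono) simp_all
        also have "\<dots> = (c * S powr (1 / q)) powr r"
          using C(1) C' S r by (simp add: c_def powr_mult powr_powr)
        finally show ?thesis .
      qed
      finally have "Lp_norm (restrict_space \<mu> \<Gamma>) r f \<le> ennreal (c * S powr (1 / q))"
        using c by (intro Lp_norm_restrict_le f r) (simp_all add: ennreal_leI)
      then show ?thesis unfolding bnS using c by (simp add: ennreal_mult)
    qed
  qed
  then show ?thesis unfolding bounded_trace_def using c by blast
qed

end

section \<open>The two inequalities between sequences\<close>

lemma sequence_bound_ell_infty:
  fixes \<tau> a :: "nat \<Rightarrow> real"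
  assumes \<tau>: "\<And>j. \<tau> j \<ge> 0" "\<And>j. \<tau> j \<le> T" and q: "0 < q" "q \<le> s" and a: "\<And>j. a j \<ge> 0" and sum: "summable (\<lambda>j. a j powr q)"
  shows "summable (\<lambda>j. (\<tau> j * a j) powr s)"
    and "(\<Sum>j. (\<tau> j * a j) powr s) \<le> (T + 1) powr s * (\<Sum>j. a j powr q) powr (s / q)"
proof -
  define S where "S = (\<Sum>j. a j powr q)"
  have S: "S \<ge> 0" unfolding S_def by (intro suminf_nonneg sum) simp
  have T: "T \<ge> 0" using \<tau>[of 0] by linarith
  \<comment> \<open>A single term \<open>a j powr q\<close> is at most the whole sum
    \<open>S\<close>; its surplus power \<open>s / q - 1\<close>, nonnegative as
    \<open>q \<le> s\<close>, is replaced by the same power of \<open>S\<close>.\<close>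
  have le: "(\<tau> j * a j) powr s \<le> (T + 1) powr s * S powr (s / q - 1) * a j powr q" for j
  proof -
    have "a j powr q = sum (\<lambda>j. a j powr q) {j}" by simp
    also have "\<dots> \<le> S" unfolding S_def by (intro sum_le_suminf sum) simp_all
    finally have "(a j powr q) powr (s / q - 1) \<le> S powr (s / q - 1)"
      using q by (intro powr_mono2) simp_all
    then have "(a j powr q) powr (s / q - 1) * a j powr q \<le> S powr (s / q - 1) * a j powr q"
      by (intro mult_right_mono) simp_all
    moreover have "(a j powr q) powr (s / q - 1) * a j powr q = a j powr s"
      using q by (simp add: powr_powr powr_add[symmetric] right_diff_distrib)
    ultimately have "a j powr s \<le> S powr (s / q - 1) * a j powr q" by simp
    moreover have "\<tau> j powr s \<le> (T + 1) powr s" using \<tau>[of j] q by (intro powr_mono2) simp_all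
    ultimately have "\<tau> j powr s * a j powr s \<le> (T + 1) powr s * (S powr (s / q - 1) * a j powr q)"
      by (intro mult_mono) simp_all
    then show ?thesis using \<tau>[of j] a[of j] by (simp add: powr_mult mult.assoc)
  qed
  have sm: "summable (\<lambda>j. (T + 1) powr s * S powr (s / q - 1) * a j powr q)" by (intro summable_mult sum)
  show 1: "summable (\<lambda>j. (\<tau> j * a j) powr s)"
    by (rule summable_comparison_test'[OF sm, of 0]) (use le in auto)
  have "(\<Sum>j. (\<tau> j * a j) powr s) \<le> (\<Sum>j. (T + 1) powr s * S powr (s / q - 1) * a j powr q)"
    by (rule suminf_le[OF le 1 sm])
  also have "\<dots> = (T + 1) powr s * (S * S powr (s / q - 1))"
    unfolding S_def by (subst suminf_mult[OF sum]) simp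
  also have "\<dots> = (T + 1) powr s * S powr (s / q)" using S by (subst powr_mult_base) simp_all
  finally show "(\<Sum>j. (\<tau> j * a j) powr s) \<le> (T + 1) powr s * (\<Sum>j. a j powr q) powr (s / q)" by (simp add: S_def)
qed

text \<open>Young's inequality with constant 1: with \<open>m\<close> the larger of the two powers,
  the factors are at most \<open>m powr (1 / \<alpha>)\<close> and
  \<open>m powr (1 / \<beta>)\<close>, and these exponents add up to 1.\<close>

lemma mult_le_powr_add_powr:
  fixes u w :: real
  assumes "u \<ge> 0" "w \<ge> 0" "\<alpha> > 0" "\<beta> > 0" "1 / \<alpha> + 1 / \<beta> = 1"
  shows "u * w \<le> u powr \<alpha> + w powr \<beta>"
proof -
  define m where "m = max (u powr \<alpha>) (w powr \<beta>)"
  have m: "m \<ge> 0" by (simp add: m_def le_max_iff_disj)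
  have "u = (u powr \<alpha>) powr (1 / \<alpha>)" using assms by (simp add: powr_powr)
  also have "\<dots> \<le> m powr (1 / \<alpha>)" using assms by (intro powr_mono2) (simp_all add: m_def)
  finally have u: "u \<le> m powr (1 / \<alpha>)" .
  have "w = (w powr \<beta>) powr (1 / \<beta>)" using assms by (simp add: powr_powr)
  also have "\<dots> \<le> m powr (1 / \<beta>)" using assms by (intro powr_mono2) (simp_all add: m_def)
  finally have w: "w \<le> m powr (1 / \<beta>)" .
  have "u * w \<le> m powr (1 / \<alpha>) * m powr (1 / \<beta>)" using assms by (intro mult_mono u w) simp_all
  also have "\<dots> = m" using m assms by (simp add: powr_add[symmetric])
  also have "\<dots> \<le> u powr \<alpha> + w powr \<beta>" by (simp add: m_def)
  finally show ?thesis .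
qed

text \<open>Hoelder's inequality with the exponents \<open>v / r\<close> and \<open>q / r\<close>:
  normalise \<open>a\<close>, apply Young's inequality termwise and sum. The \<open>+ 1\<close> in
  the constant is the contribution of the normalised sequence, and the case \<open>S = 0\<close>,
  where normalisation fails, is trivial.\<close>

lemma sequence_bound_ell:
  fixes \<tau> a :: "nat \<Rightarrow> real"
  assumes \<tau>: "\<And>j. \<tau> j \<ge> 0" "summable (\<lambda>j. \<tau> j powr v)" and r: "0 < r" "r < q" and v: "v > 0" "1 / v = 1 / r - 1 / q"
    and a: "\<And>j. a j \<ge> 0" and sum: "summable (\<lambda>j. a j powr q)"
  shows "summable (\<lambda>j. (\<tau> j * a j) powr r)"
    and "(\<Sum>j. (\<tau> j * a j) powr r) \<le> ((\<Sum>j. \<tau> j powr v) + 1) * (\<Sum>j. a j powr q) powr (r / q)"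
proof -
  have q: "q > 0" using r by simp
  define S where "S = (\<Sum>j. a j powr q)"
  define P where "P = (\<Sum>j. \<tau> j powr v)"
  have S: "S \<ge> 0" unfolding S_def by (intro suminf_nonneg sum) simp
  have P: "P \<ge> 0" unfolding P_def by (intro suminf_nonneg \<tau>) simp
  have "summable (\<lambda>j. (\<tau> j * a j) powr r) \<and> (\<Sum>j. (\<tau> j * a j) powr r) \<le> (P + 1) * S powr (r / q)"
  proof (cases "S = 0")
    case True
    then have "a j powr q = 0" for j using suminf_eq_zero_iff[OF sum] by (simp add: S_def)
    then have "a j = 0" for j by simp
    then show ?thesis using P by simp
  next
    case False
    then have Spos: "S > 0" using S by simp
    have le: "(\<tau> j * a j) powr r \<le> S powr (r / q) * (\<tau> j powr v + a j powr q / S)" for j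
    proof -
      define y where "y = a j / S powr (1 / q)"
      have y: "y \<ge> 0" using a[of j] by (simp add: y_def)
      have yq: "y powr q = a j powr q / S" using q Spos by (simp add: y_def powr_divide powr_powr)
      have ay: "a j = S powr (1 / q) * y" using Spos by (simp add: y_def)
      have "\<tau> j powr r * y powr r \<le> (\<tau> j powr r) powr (v / r) + (y powr r) powr (q / r)"
      proof (rule mult_le_powr_add_powr)
        have "r / v = r * (1 / v)" by simp
        also have "\<dots> = r * (1 / r - 1 / q)" by (simp only: v(2))
        also have "\<dots> = 1 - r / q" using r by (simp add: right_diff_distrib)
        finally have "r / v + r / q = 1" by simp
        then show "1 / (v / r) + 1 / (q / r) = 1" by simp
      qed (use r q v in simp_all)
      also have "\<dots> = \<tau> j powr v + y powr q" using r by (simp add: powr_powr)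
      finally have "S powr (r / q) * (\<tau> j powr r * y powr r) \<le> S powr (r / q) * (\<tau> j powr v + a j powr q / S)"
        unfolding yq by (intro mult_left_mono) simp_all
      moreover have "(\<tau> j * a j) powr r = S powr (r / q) * (\<tau> j powr r * y powr r)"
        unfolding ay using \<tau>(1)[of j] y by (simp add: powr_mult powr_powr)
      ultimately show ?thesis by simp
    qed
    have sm: "(\<lambda>j. S powr (r / q) * (\<tau> j powr v + a j powr q / S)) sums (S powr (r / q) * (P + S / S))"
      unfolding P_def S_def by (intro sums_mult sums_add sums_divide summable_sums \<tau> sum)
    have 1: "summable (\<lambda>j. (\<tau> j * a j) powr r)"
      by (rule summable_comparison_test'[OF sums_summable[OF sm], of 0]) (use le in auto)
    have "(\<Sum>j. (\<tau> j * a j) powr r) \<le> S powr (r / q) * (P + S / S)"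
      using suminf_le[OF le 1 sums_summable[OF sm]] sums_unique[OF sm] by simp
    then show ?thesis using 1 Spos by (simp add: mult.commute)
  qed
  then show "summable (\<lambda>j. (\<tau> j * a j) powr r)"
    and "(\<Sum>j. (\<tau> j * a j) powr r) \<le> ((\<Sum>j. \<tau> j powr v) + 1) * (\<Sum>j. a j powr q) powr (r / q)"
    by (simp_all add: P_def S_def)
qed

section \<open>Test functions\<close>

lemma resolution_one_nonzero_bounds:
  assumes \<phi>: "resolution_generator \<phi>0" and "resolution \<phi>0 1 \<xi> \<noteq> 0"
  shows "1 < norm \<xi>" "norm \<xi> \<le> 4"
proof -
  have \<phi>1: "\<And>x. norm x \<le> 1 \<Longrightarrow> \<phi>0 x = 1" using \<phi> by (auto simp: resolution_generator_def)
  show "norm \<xi> \<le> 4" using resolution_nonzero_le[OF assms] by simp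
  show "1 < norm \<xi>"
  proof (rule ccontr)
    assume "\<not> 1 < norm \<xi>"
    then have "norm ((2 powr (- 1)) *\<^sub>R \<xi>) \<le> 1" "norm \<xi> \<le> 1" by (simp_all add: powr_minus)
    then have "resolution \<phi>0 1 \<xi> = 0" using \<phi>1 by (simp add: resolution_def)
    then show False using assms(2) by blast
  qed
qed

text \<open>The inverse transform of \<open>resolution \<phi>0 1\<close> has its spectrum in the
  annulus. It is not identically zero, since otherwise \<open>\<phi>0\<close> would be invariant
  under halving, while it is 1 at norm 1 and 0 at norm 4. Translating a point of nonvanishing to the
  origin only modulates the transform, and division normalises the value.\<close>

lemma band_limited_bump:
  fixes \<phi>0 :: "'a::euclidean_space \<Rightarrow> complex"
  assumes \<phi>: "resolution_generator \<phi>0"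
  obtains \<Psi> :: "'a \<Rightarrow> complex" where "\<Psi> \<in> schwartz" "\<Psi> 0 = 1"
    "\<And>\<xi>. fourier \<Psi> \<xi> \<noteq> 0 \<Longrightarrow> 1 < norm \<xi> \<and> norm \<xi> \<le> 4"
proof -
  have \<phi>S: "\<phi>0 \<in> schwartz" and \<phi>1: "\<And>x. norm x \<le> 1 \<Longrightarrow> \<phi>0 x = 1"
    and \<phi>supp: "\<And>x. \<phi>0 x \<noteq> 0 \<Longrightarrow> norm x \<le> 2"
    using \<phi> closure_subset[of "{x. \<phi>0 x \<noteq> 0}"] by (auto simp: resolution_generator_def)
  define \<Phi> where "\<Phi> = inv_fourier (resolution \<phi>0 1)"
  note RS = resolution_schwartz[OF \<phi>S, of 1]
  have \<Phi>S: "\<Phi> \<in> schwartz" unfolding \<Phi>_def by (intro inv_fourier_schwartz RS)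
  have f\<Phi>: "fourier \<Phi> \<xi> = resolution \<phi>0 1 \<xi>" for \<xi>
    unfolding \<Phi>_def by (rule fourier_inv_fourier[OF RS])
  have "\<exists>x0. \<Phi> x0 \<noteq> 0"
  proof (rule ccontr)
    assume "\<not> ?thesis"
    then have "\<Phi> = (\<lambda>x. 0)" by auto
    then have R0: "resolution \<phi>0 1 \<xi> = 0" for \<xi> using f\<Phi>[of \<xi>] by (simp add: fourier_def)
    have "2 powr (- real 1) = (1 / 2 :: real)" "2 powr (- real 1 + 1) = (1 :: real)"
      by (simp_all add: powr_minus_divide)
    then have eq: "\<phi>0 ((1 / 2) *\<^sub>R \<xi>) = \<phi>0 \<xi>" for \<xi>
      using R0[of \<xi>] by (simp only: resolution_def) simp
    obtain b :: 'a where b: "b \<in> Basis" using nonempty_Basis by (meson ex_in_conv)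
    have "\<phi>0 ((1 / 2) *\<^sub>R (1 / 2) *\<^sub>R 4 *\<^sub>R b) = \<phi>0 (4 *\<^sub>R b)" by (simp only: eq)
    moreover have "\<phi>0 ((1 / 2) *\<^sub>R (1 / 2) *\<^sub>R 4 *\<^sub>R b) = 1" using b by (intro \<phi>1) simp
    moreover have "\<phi>0 (4 *\<^sub>R b) = 0" using \<phi>supp[of "4 *\<^sub>R b"] b by auto
    ultimately show False by simp
  qed
  then obtain x0 where x0: "\<Phi> x0 \<noteq> 0" by blast
  define \<Psi> where "\<Psi> = (\<lambda>x. (1 / \<Phi> x0) * \<Phi> (x0 + 1 *\<^sub>R x))"
  have "(\<lambda>x. (1 / \<Phi> x0) * \<Phi> (1 *\<^sub>R x + x0)) \<in> schwartz"
    by (intro schwartz_cmult schwartz_affine \<Phi>S) simp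
  then have 1: "\<Psi> \<in> schwartz" unfolding \<Psi>_def by (simp add: add.commute)
  have 2: "\<Psi> 0 = 1" using x0 by (simp add: \<Psi>_def)
  have "1 < norm \<xi> \<and> norm \<xi> \<le> 4" if "fourier \<Psi> \<xi> \<noteq> 0" for \<xi>
  proof -
    have "fourier (\<lambda>x. \<Phi> (x0 + 1 *\<^sub>R x)) \<xi> = of_real (1 / \<bar>1\<bar> ^ DIM('a)) * (wave (- x0) (\<xi> /\<^sub>R 1) * fourier \<Phi> (\<xi> /\<^sub>R 1))"
      by (rule fourier_affine[OF schwartz_measurable[OF \<Phi>S]]) simp
    then have "fourier \<Psi> \<xi> = (1 / \<Phi> x0) * (wave (- x0) \<xi> * resolution \<phi>0 1 \<xi>)"
      unfolding \<Psi>_def fourier_cmult by (simp add: f\<Phi>)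
    then have "resolution \<phi>0 1 \<xi> \<noteq> 0" using that by auto
    then show ?thesis using resolution_one_nonzero_bounds[OF \<phi>] by blast
  qed
  then show ?thesis using that 1 2 by blast
qed

lemma resolution_nonzero_gt:
  assumes \<phi>: "resolution_generator \<phi>0" and "resolution \<phi>0 (Suc k) \<xi> \<noteq> 0"
  shows "2 ^ k < norm \<xi>"
proof (rule ccontr)
  have \<phi>1: "\<And>x. norm x \<le> 1 \<Longrightarrow> \<phi>0 x = 1" using \<phi> by (auto simp: resolution_generator_def)
  have e: "2 powr (- real (Suc k) + 1) = inverse (2 ^ k)"
    unfolding two_powr_minus_of_nat[symmetric] by simp
  assume "\<not> 2 ^ k < norm \<xi>"
  then have le: "norm \<xi> \<le> 2 ^ k" by simp
  then have "norm \<xi> \<le> 2 ^ Suc k" by (rule order_trans) simp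
  then have "norm (inverse (2 ^ Suc k) *\<^sub>R \<xi>) \<le> 1" by (simp add: divide_simps)
  moreover have "norm (inverse (2 ^ k) *\<^sub>R \<xi>) \<le> 1" using le by (simp add: divide_simps)
  ultimately have "resolution \<phi>0 (Suc k) \<xi> = 0"
    unfolding resolution_def e two_powr_minus_of_nat using \<phi>1 by simp
  then show False using assms(2) by blast
qed

section \<open>Bumps at dyadic scales and their Besov norm\<close>

definition dilate :: "('a::euclidean_space \<Rightarrow> complex) \<Rightarrow> 'a \<Rightarrow> nat \<Rightarrow> 'a \<Rightarrow> complex" where
  "dilate \<Psi> \<gamma> j x = \<Psi> ((2 ^ j) *\<^sub>R (x - \<gamma>))"

lemma dilate_eq: "dilate \<Psi> \<gamma> j = (\<lambda>x. \<Psi> (- ((2 ^ j) *\<^sub>R \<gamma>) + (2 ^ j) *\<^sub>R x))"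
  by (simp add: dilate_def[abs_def] scaleR_diff_right)

lemma dilate_schwartz: "\<Psi> \<in> schwartz \<Longrightarrow> dilate \<Psi> \<gamma> j \<in> schwartz"
  using schwartz_affine[of \<Psi> "2 ^ j" "- ((2 ^ j) *\<^sub>R \<gamma>)"] by (simp add: dilate_eq add.commute)

lemma fourier_dilate:
  fixes \<Psi> :: "'a::euclidean_space \<Rightarrow> complex"
  assumes "\<Psi> \<in> schwartz"
  shows "fourier (dilate \<Psi> \<gamma> j) \<xi> = of_real (1 / (2 ^ j) ^ DIM('a)) *
    (wave ((2 ^ j) *\<^sub>R \<gamma>) (\<xi> /\<^sub>R 2 ^ j) * fourier \<Psi> (\<xi> /\<^sub>R 2 ^ j))"
proof -
  have "fourier (\<lambda>x. \<Psi> (- ((2 ^ j) *\<^sub>R \<gamma>) + (2 ^ j) *\<^sub>R x)) \<xi> = of_real (1 / \<bar>2 ^ j\<bar> ^ DIM('a)) *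
    (wave (- (- ((2 ^ j) *\<^sub>R \<gamma>))) (\<xi> /\<^sub>R 2 ^ j) * fourier \<Psi> (\<xi> /\<^sub>R 2 ^ j))"
    by (rule fourier_affine[OF schwartz_measurable[OF assms]]) simp
  then show ?thesis by (simp only: dilate_eq minus_minus abs_power2 power_abs abs_numeral)
qed

text \<open>The dilate has frequencies in \<open>2 ^ j < norm \<xi> \<le> 4 * 2 ^ j\<close>, and the
  block \<open>k > 0\<close> sees \<open>2 ^ (k - 1) < norm \<xi> \<le> 2 ^ (k + 1)\<close>. The
  strict lower bounds are what exclude the borderline blocks \<open>j - 1\<close> and
  \<open>j + 3\<close>, so only three blocks remain.\<close>

lemma block_dilate_eq_0:
  fixes \<phi>0 \<Psi> :: "'a::euclidean_space \<Rightarrow> complex"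
  assumes \<phi>: "resolution_generator \<phi>0" and \<Psi>: "\<Psi> \<in> schwartz"
    and spec: "\<And>\<xi>. fourier \<Psi> \<xi> \<noteq> 0 \<Longrightarrow> 1 < norm \<xi> \<and> norm \<xi> \<le> 4"
    and k: "k < j \<or> j + 2 < k"
  shows "block \<phi>0 k (dilate \<Psi> \<gamma> j) x = 0"
proof -
  have "(\<lambda>\<xi>. resolution \<phi>0 k \<xi> * fourier (dilate \<Psi> \<gamma> j) \<xi>) = (\<lambda>\<xi>. 0)"
  proof (rule ext, rule ccontr)
    fix \<xi> assume nz: "resolution \<phi>0 k \<xi> * fourier (dilate \<Psi> \<gamma> j) \<xi> \<noteq> 0"
    then have "fourier \<Psi> (\<xi> /\<^sub>R 2 ^ j) \<noteq> 0" by (auto simp: fourier_dilate[OF \<Psi>])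
    from spec[OF this] have "1 < norm (\<xi> /\<^sub>R 2 ^ j)" "norm (\<xi> /\<^sub>R 2 ^ j) \<le> 4" by blast+
    then have \<xi>: "2 ^ j < norm \<xi>" "norm \<xi> \<le> 4 * 2 ^ j" by (simp_all add: divide_simps mult.commute)
    have rk: "resolution \<phi>0 k \<xi> \<noteq> 0" using nz by auto
    show False
    proof (cases "k < j")
      case True
      then have "(2::real) ^ Suc k \<le> 2 ^ j" by (intro power_increasing) simp_all
      then show False using resolution_nonzero_le[OF \<phi> rk] \<xi>(1) by linarith
    next
      case False
      then obtain i where i: "k = Suc (j + 2 + i)" using k by (metis add_Suc_right less_iff_Suc_add)
      have "(2::real) ^ (j + 2) \<le> 2 ^ (j + 2 + i)" by (intro power_increasing) simp_all
      then have "4 * (2::real) ^ j \<le> 2 ^ (j + 2 + i)" by (simp add: power_add mult_ac)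
      then show False using resolution_nonzero_gt[OF \<phi> rk[unfolded i]] \<xi>(2) by linarith
    qed
  qed
  then have "block \<phi>0 k (dilate \<Psi> \<gamma> j) = inv_fourier (\<lambda>\<xi>. 0)" by (simp only: block_def)
  then show ?thesis by (simp add: inv_fourier_def)
qed

text \<open>The symbol of the block \<open>j + i\<close> of a bump of scale \<open>j\<close>,
  rescaled to unit scale and without the translation. It no longer depends on
  \<open>j\<close>.\<close>

definition dilate_multiplier :: "('a::euclidean_space \<Rightarrow> complex) \<Rightarrow> ('a \<Rightarrow> complex) \<Rightarrow> nat \<Rightarrow> 'a \<Rightarrow> complex" where
  "dilate_multiplier \<phi>0 \<Psi> i \<eta> = (\<phi>0 (inverse (2 ^ i) *\<^sub>R \<eta>) - \<phi>0 ((2 * inverse (2 ^ i)) *\<^sub>R \<eta>)) * fourier \<Psi> \<eta>"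

lemma dilate_multiplier_schwartz:
  "\<phi>0 \<in> schwartz \<Longrightarrow> \<Psi> \<in> schwartz \<Longrightarrow> dilate_multiplier \<phi>0 \<Psi> i \<in> schwartz"
  unfolding dilate_multiplier_def[abs_def]
  by (intro schwartz_mult schwartz_diff schwartz_scale fourier_schwartz) simp_all

text \<open>The scale \<open>j = 0\<close> is excluded because \<open>resolution \<phi>0 0\<close>
  is the generator itself and not a difference of two dilates.\<close>

lemma block_dilate:
  fixes \<phi>0 \<Psi> :: "'a::euclidean_space \<Rightarrow> complex"
  assumes \<phi>S: "\<phi>0 \<in> schwartz" and \<Psi>: "\<Psi> \<in> schwartz" and j: "j \<ge> 1"
  shows "block \<phi>0 (j + i) (dilate \<Psi> \<gamma> j) x = dilate (inv_fourier (dilate_multiplier \<phi>0 \<Psi> i)) \<gamma> j x"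
proof -
  note mS = dilate_multiplier_schwartz[OF \<phi>S \<Psi>, of i]
  define H where "H = inv_fourier (dilate_multiplier \<phi>0 \<Psi> i)"
  have HS: "H \<in> schwartz" unfolding H_def by (rule inv_fourier_schwartz[OF mS])
  have "resolution \<phi>0 (j + i) \<xi> * fourier (dilate \<Psi> \<gamma> j) \<xi> = fourier (dilate H \<gamma> j) \<xi>" for \<xi>
  proof -
    have e: "2 powr (- real (j + i) + 1) = 2 * inverse (2 ^ (j + i))"
      unfolding two_powr_minus_of_nat[symmetric] by (simp add: powr_add)
    have "resolution \<phi>0 (j + i) \<xi> = \<phi>0 (inverse (2 ^ i) *\<^sub>R (\<xi> /\<^sub>R 2 ^ j)) - \<phi>0 ((2 * inverse (2 ^ i)) *\<^sub>R (\<xi> /\<^sub>R 2 ^ j))"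
      unfolding resolution_def e two_powr_minus_of_nat using j by (simp add: power_add mult_ac)
    moreover have "fourier H \<eta> = dilate_multiplier \<phi>0 \<Psi> i \<eta>" for \<eta>
      unfolding H_def by (rule fourier_inv_fourier[OF mS])
    ultimately show ?thesis
      unfolding fourier_dilate[OF \<Psi>] fourier_dilate[OF HS] dilate_multiplier_def by (simp only: mult_ac)
  qed
  then have "block \<phi>0 (j + i) (dilate \<Psi> \<gamma> j) x = inv_fourier (fourier (dilate H \<gamma> j)) x"
    unfolding block_def by (simp only:)
  then show ?thesis using fourier_inversion[OF dilate_schwartz[OF HS]] by (simp add: H_def)
qed

lemma integral_dilate_powr:
  fixes H :: "'a::euclidean_space \<Rightarrow> complex"
  assumes "H \<in> schwartz"
  shows "(\<integral>x. norm (dilate H \<gamma> j x) powr p \<partial>lborel) = (\<integral>x. norm (H x) powr p \<partial>lborel) / (2 ^ j) ^ DIM('a)"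
proof -
  note [measurable] = schwartz_measurable[OF assms]
  have "(\<integral>x. norm (H x) powr p \<partial>lborel) = \<bar>2 ^ j\<bar> ^ DIM('a) *\<^sub>R (\<integral>x. norm (H (- ((2 ^ j) *\<^sub>R \<gamma>) + (2 ^ j) *\<^sub>R x)) powr p \<partial>lborel)"
    by (rule lborel_integral_affine) simp_all
  then show ?thesis by (simp add: dilate_eq)
qed

text \<open>By scaling, every nonzero block of a bump is a dilate of one of the three profiles
  \<open>H 0\<close>, \<open>H 1\<close>, \<open>H 2\<close>, so one constant serves for all scales
  and centres.\<close>

lemma block_norm_dilate_le:
  fixes \<phi>0 \<Psi> :: "'a::euclidean_space \<Rightarrow> complex"
  assumes \<phi>: "resolution_generator \<phi>0" and \<Psi>: "\<Psi> \<in> schwartz"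
    and spec: "\<And>\<xi>. fourier \<Psi> \<xi> \<noteq> 0 \<Longrightarrow> 1 < norm \<xi> \<and> norm \<xi> \<le> 4" and p: "p > 0"
  shows "\<exists>L>0. \<forall>j k \<gamma>. j \<ge> 1 \<longrightarrow> block_norm \<phi>0 p k (dilate \<Psi> \<gamma> j) \<le> L * 2 powr (- (real j * real DIM('a) / p))"
proof -
  have \<phi>S: "\<phi>0 \<in> schwartz" using \<phi> by (auto simp: resolution_generator_def)
  define H where "H i = inv_fourier (dilate_multiplier \<phi>0 \<Psi> i)" for i
  have HS: "H i \<in> schwartz" for i unfolding H_def by (intro inv_fourier_schwartz dilate_multiplier_schwartz \<phi>S \<Psi>)
  define l where "l i = (\<integral>x. norm (H i x) powr p \<partial>lborel) powr (1 / p)" for i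
  have l: "l i \<ge> 0" for i by (simp add: l_def)
  show ?thesis
  proof (intro exI conjI allI impI)
    show "(\<Sum>i\<le>2. l i) + 1 > 0" using l by (simp add: add_nonneg_pos sum_nonneg)
    fix j k :: nat and \<gamma> :: 'a assume j: "j \<ge> 1"
    show "block_norm \<phi>0 p k (dilate \<Psi> \<gamma> j) \<le> ((\<Sum>i\<le>2. l i) + 1) * 2 powr (- (real j * real DIM('a) / p))"
    proof (cases "k < j \<or> j + 2 < k")
      case True
      then show ?thesis using l by (simp add: block_norm_def block_dilate_eq_0[OF \<phi> \<Psi> spec True] add_nonneg_nonneg sum_nonneg)
    next
      case False
      then obtain i where i: "k = j + i" "i \<le> 2" by (metis add_le_cancel_left le_iff_add not_less)
      define A where "A = (\<integral>x. norm (H i x) powr p \<partial>lborel)"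
      have A: "A \<ge> 0" unfolding A_def by (intro integral_nonneg_AE AE_I2) simp
      have "block_norm \<phi>0 p k (dilate \<Psi> \<gamma> j) = (A / (2 ^ j) ^ DIM('a)) powr (1 / p)"
        unfolding block_norm_def i(1) block_dilate[OF \<phi>S \<Psi> j] H_def[symmetric] integral_dilate_powr[OF HS] A_def ..
      also have "\<dots> = l i * 2 powr (- (real j * real DIM('a) / p))"
        by (simp add: powr_divide l_def A_def powr_realpow[symmetric] powr_powr powr_minus_divide)
      also have "\<dots> \<le> ((\<Sum>i\<le>2. l i) + 1) * 2 powr (- (real j * real DIM('a) / p))"
      proof (intro mult_right_mono)
        have "l i = sum l {i}" by simp
        also have "\<dots> \<le> (\<Sum>i\<le>2. l i)" using i(2) l by (intro sum_mono2) auto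
        finally show "l i \<le> (\<Sum>i\<le>2. l i) + 1" by simp
      qed simp
      finally show ?thesis .
    qed
  qed
qed

lemma block_linear_sum:
  assumes \<phi>S: "\<phi>0 \<in> schwartz" and F: "\<And>j. j \<in> S \<Longrightarrow> F j \<in> schwartz"
  shows "block \<phi>0 k (\<lambda>x. \<Sum>j\<in>S. c j * F j x) x = (\<Sum>j\<in>S. c j * block \<phi>0 k (F j) x)"
proof -
  have "resolution \<phi>0 k \<xi> * fourier (\<lambda>x. \<Sum>j\<in>S. c j * F j x) \<xi> = (\<Sum>j\<in>S. c j * (resolution \<phi>0 k \<xi> * fourier (F j) \<xi>))" for \<xi>
    using F by (subst fourier_sum) (auto simp: sum_distrib_left mult_ac schwartz_integrable)
  then show ?thesis
    unfolding block_def inv_fourier_eq_fourier using F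
    by (simp only:) (intro fourier_sum schwartz_integrable schwartz_mult resolution_schwartz \<phi>S fourier_schwartz)
qed

definition bump_sum :: "('a::euclidean_space \<Rightarrow> complex) \<Rightarrow> 'a \<Rightarrow> nat set \<Rightarrow> (nat \<Rightarrow> real) \<Rightarrow> 'a \<Rightarrow> complex" where
  "bump_sum \<Psi> \<gamma> S a x = (\<Sum>j\<in>S. complex_of_real (a j) * dilate \<Psi> \<gamma> j x)"

lemma bump_sum_schwartz: "\<Psi> \<in> schwartz \<Longrightarrow> bump_sum \<Psi> \<gamma> S a \<in> schwartz"
  unfolding bump_sum_def[abs_def] by (intro schwartz_sum schwartz_cmult dilate_schwartz)

definition spaced :: "nat \<Rightarrow> nat set \<Rightarrow> bool" where
  "spaced M S \<longleftrightarrow> (\<forall>i\<in>S. \<forall>j\<in>S. i < j \<longrightarrow> i + M \<le> j)"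

text \<open>Spacing 3 makes the windows \<open>{j..j + 2}\<close> disjoint, so the norm of the sum
  decouples. In the constant, 3 counts the blocks of a window, \<open>\<kappa> ^ 2\<close> bounds
  the growth of \<open>\<rho>\<close> inside it, and \<open>L\<close> comes from a single
  bump.\<close>

lemma besov_norm_bump_sum_le:
  fixes \<phi>0 \<Psi> :: "'a::euclidean_space \<Rightarrow> complex"
  assumes \<phi>: "resolution_generator \<phi>0" and \<Psi>: "\<Psi> \<in> schwartz"
    and spec: "\<And>\<xi>. fourier \<Psi> \<xi> \<noteq> 0 \<Longrightarrow> 1 < norm \<xi> \<and> norm \<xi> \<le> 4" and p: "p > 0" and q: "q > 0"
    and \<rho>: "\<And>j. \<rho> j > 0" "\<And>j. \<rho> (Suc j) \<le> \<kappa> * \<rho> j" and \<kappa>: "\<kappa> \<ge> 1"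
  shows "\<exists>C>0. \<forall>S a \<gamma>. finite S \<longrightarrow> spaced 3 S \<longrightarrow> 0 \<notin> S \<longrightarrow> (\<forall>j. a j > 0) \<longrightarrow>
      besov_norm \<phi>0 \<rho> p q (regular_distr (bump_sum \<Psi> \<gamma> S a))
        \<le> ennreal (C * (\<Sum>j\<in>S. (a j * \<rho> j * 2 powr (- (real j * real DIM('a) / p))) powr q) powr (1 / q))"
proof -
  have \<phi>S: "\<phi>0 \<in> schwartz" using \<phi> by (auto simp: resolution_generator_def)
  obtain L where L: "L > 0" "\<And>j k \<gamma>. j \<ge> 1 \<Longrightarrow> block_norm \<phi>0 p k (dilate \<Psi> \<gamma> j) \<le> L * 2 powr (- (real j * real DIM('a) / p))"
    using block_norm_dilate_le[OF \<phi> \<Psi> spec p] by blast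
  define C where "C = 3 powr (1 / q) * (\<kappa> ^ 2 * L)"
  show ?thesis
  proof (intro exI conjI allI impI)
    show "C > 0" using L \<kappa> by (simp add: C_def)
    fix S :: "nat set" and a :: "nat \<Rightarrow> real" and \<gamma> :: 'a
    assume S: "finite S" "spaced 3 S" "0 \<notin> S" and pos: "\<forall>j. a j > 0"
    have a: "a j > 0" for j using pos by blast
    define f where "f = bump_sum \<Psi> \<gamma> S a"
    have fS: "f \<in> schwartz" unfolding f_def by (rule bump_sum_schwartz[OF \<Psi>])
    define b where "b j = a j * \<rho> j * 2 powr (- (real j * real DIM('a) / p))" for j
    have b: "b j > 0" for j using a \<rho> by (simp add: b_def)
    have blk: "block \<phi>0 k f x = (\<Sum>j\<in>S. of_real (a j) * block \<phi>0 k (dilate \<Psi> \<gamma> j) x)" for k x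
      unfolding f_def bump_sum_def[abs_def] by (intro block_linear_sum \<phi>S dilate_schwartz \<Psi>)
    have blk1: "block \<phi>0 k f x = of_real (a j) * block \<phi>0 k (dilate \<Psi> \<gamma> j) x" if "j \<in> S" "k \<in> {j..j + 2}" for j k x
    proof -
      have "block \<phi>0 k (dilate \<Psi> \<gamma> i) x = 0" if "i \<in> S - {j}" for i
      proof (rule block_dilate_eq_0[OF \<phi> \<Psi> spec])
        have "i + 3 \<le> j \<or> j + 3 \<le> i" using S(2) that \<open>j \<in> S\<close> unfolding spaced_def
          by (metis DiffE insertI1 linorder_neqE_nat)
        then show "k < i \<or> i + 2 < k" using \<open>k \<in> {j..j + 2}\<close> by auto
      qed
      then show ?thesis unfolding blk by (subst sum.remove[OF S(1) that(1)]) simp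
    qed
    have blk0: "block_norm \<phi>0 p k f = 0" if "k \<notin> (\<Union>j\<in>S. {j..j + 2})" for k
    proof -
      have "block \<phi>0 k (dilate \<Psi> \<gamma> j) x = 0" if "j \<in> S" for j x
        using \<open>k \<notin> (\<Union>j\<in>S. {j..j + 2})\<close> that by (intro block_dilate_eq_0[OF \<phi> \<Psi> spec]) auto
      then have "block \<phi>0 k f x = 0" for x unfolding blk by simp
      then show ?thesis by (simp add: block_norm_def)
    qed
    have bn: "\<rho> k * block_norm \<phi>0 p k f \<le> \<kappa> ^ 2 * L * b j" if j: "j \<in> S" "k \<in> {j..j + 2}" for j k
    proof -
      have "j \<ge> 1" using S(3) j(1) by (cases j) auto
      have "block_norm \<phi>0 p k f = a j * block_norm \<phi>0 p k (dilate \<Psi> \<gamma> j)"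
        unfolding block_norm_def blk1[OF j] using a[of j] p
        by (simp add: norm_mult powr_mult powr_powr integral_nonneg_AE)
      also have "\<dots> \<le> a j * (L * 2 powr (- (real j * real DIM('a) / p)))"
        using a[of j] L(2)[OF \<open>j \<ge> 1\<close>] by (intro mult_left_mono) simp_all
      finally have 1: "block_norm \<phi>0 p k f \<le> a j * (L * 2 powr (- (real j * real DIM('a) / p)))" .
      have "\<rho> (j + i) \<le> \<kappa> ^ i * \<rho> j" for i
      proof (induction i)
        case (Suc i)
        have "\<rho> (j + Suc i) \<le> \<kappa> * \<rho> (j + i)" using \<rho>(2)[of "j + i"] by simp
        also have "\<dots> \<le> \<kappa> * (\<kappa> ^ i * \<rho> j)" using \<kappa> Suc by (intro mult_left_mono) simp_all
        finally show ?case by simp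
      qed simp
      from this[of "k - j"] have "\<rho> k \<le> \<kappa> ^ (k - j) * \<rho> j" using j(2) by simp
      also have "\<dots> \<le> \<kappa> ^ 2 * \<rho> j"
        using j(2) \<kappa> \<rho>(1)[of j] by (intro mult_right_mono power_increasing) auto
      finally have "\<rho> k * block_norm \<phi>0 p k f \<le> (\<kappa> ^ 2 * \<rho> j) * (a j * (L * 2 powr (- (real j * real DIM('a) / p))))"
        using 1 \<kappa> \<rho>(1)[of j] by (intro mult_mono) (simp_all add: block_norm_def)
      then show ?thesis by (simp add: b_def mult_ac)
    qed
    define T where "T = (\<Union>j\<in>S. {j..j + 2})"
    have "(\<Sum>k. ennreal ((\<rho> k * block_norm \<phi>0 p k f) powr q)) = (\<Sum>k\<in>T. ennreal ((\<rho> k * block_norm \<phi>0 p k f) powr q))"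
      using S(1) blk0 by (intro suminf_finite) (auto simp: T_def)
    also have "\<dots> = ennreal (\<Sum>k\<in>T. (\<rho> k * block_norm \<phi>0 p k f) powr q)" by (rule sum_ennreal) simp
    also have "(\<Sum>k\<in>T. (\<rho> k * block_norm \<phi>0 p k f) powr q) = (\<Sum>j\<in>S. \<Sum>k\<in>{j..j + 2}. (\<rho> k * block_norm \<phi>0 p k f) powr q)"
      unfolding T_def
    proof (intro sum.UNION_disjoint ballI impI S)
      fix i j assume ij: "i \<in> S" "j \<in> S" "i \<noteq> j"
      then have "i + 3 \<le> j \<or> j + 3 \<le> i" using S(2) unfolding spaced_def by (metis linorder_neqE_nat)
      then show "{i..i + 2} \<inter> {j..j + 2} = {}" by auto
    qed simp
    also have "ennreal \<dots> \<le> ennreal (3 * (\<kappa> ^ 2 * L) powr q * (\<Sum>j\<in>S. b j powr q))"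
    proof (rule ennreal_leI)
      have "(\<Sum>k\<in>{j..j + 2}. (\<rho> k * block_norm \<phi>0 p k f) powr q) \<le> 3 * ((\<kappa> ^ 2 * L) powr q * b j powr q)" if "j \<in> S" for j
      proof -
        have "(\<Sum>k\<in>{j..j + 2}. (\<rho> k * block_norm \<phi>0 p k f) powr q) \<le> (\<Sum>k\<in>{j..j + 2}. (\<kappa> ^ 2 * L * b j) powr q)"
        proof (rule sum_mono)
          fix k assume k: "k \<in> {j..j + 2}"
          have "\<rho> k * block_norm \<phi>0 p k f \<ge> 0" using \<rho>(1)[of k] by (simp add: block_norm_def)
          then show "(\<rho> k * block_norm \<phi>0 p k f) powr q \<le> (\<kappa> ^ 2 * L * b j) powr q"
            using q bn[OF that k] by (intro powr_mono2) simp_all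
        qed
        also have "\<dots> = 3 * ((\<kappa> ^ 2 * L) powr q * b j powr q)"
          using b[of j] L(1) by (simp add: powr_mult)
        finally show ?thesis .
      qed
      then have "(\<Sum>j\<in>S. \<Sum>k\<in>{j..j + 2}. (\<rho> k * block_norm \<phi>0 p k f) powr q) \<le> (\<Sum>j\<in>S. 3 * ((\<kappa> ^ 2 * L) powr q * b j powr q))"
        by (rule sum_mono)
      then show "(\<Sum>j\<in>S. \<Sum>k\<in>{j..j + 2}. (\<rho> k * block_norm \<phi>0 p k f) powr q) \<le> 3 * (\<kappa> ^ 2 * L) powr q * (\<Sum>j\<in>S. b j powr q)"
        by (simp add: sum_distrib_left mult.assoc)
    qed
    finally have "besov_norm \<phi>0 \<rho> p q (regular_distr f) \<le> epowr (ennreal (3 * (\<kappa> ^ 2 * L) powr q * (\<Sum>j\<in>S. b j powr q))) (1 / q)"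
      unfolding besov_norm_schwartz[OF \<phi> fS p \<rho>(1)] using q by (intro epowr_mono) simp_all
    also have "\<dots> = ennreal (C * (\<Sum>j\<in>S. b j powr q) powr (1 / q))"
      using q L(1) \<kappa> by (subst epowr_ennreal) (simp_all add: sum_nonneg powr_mult powr_powr C_def)
    finally show "besov_norm \<phi>0 \<rho> p q (regular_distr (bump_sum \<Psi> \<gamma> S a))
        \<le> ennreal (C * (\<Sum>j\<in>S. (a j * \<rho> j * 2 powr (- (real j * real DIM('a) / p))) powr q) powr (1 / q))"
      by (simp add: f_def b_def)
  qed
qed

section \<open>Necessity\<close>

lemma sum_half_powers_le:
  fixes S :: "nat set"
  assumes "finite S" "\<And>i. i \<in> S \<Longrightarrow> j + M \<le> i"
  shows "(\<Sum>i\<in>S. (1 / 2 :: real) ^ (i - j)) \<le> 2 * (1 / 2) ^ M"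
proof -
  have "(\<Sum>i\<in>S. (1 / 2 :: real) ^ (i - j)) = (\<Sum>i\<in>S. (1 / 2) ^ M * (1 / 2) ^ (i - (j + M)))"
  proof (rule sum.cong[OF refl])
    fix i assume "i \<in> S"
    then have "i - j = M + (i - (j + M))" using assms(2)[of i] by simp
    then show "(1 / 2 :: real) ^ (i - j) = (1 / 2) ^ M * (1 / 2) ^ (i - (j + M))" by (simp only: power_add)
  qed
  also have "\<dots> = (1 / 2) ^ M * (\<Sum>d\<in>(\<lambda>i. i - (j + M)) ` S. (1 / 2) ^ d)"
  proof -
    have "inj_on (\<lambda>i. i - (j + M)) S" using assms(2) by (auto simp: inj_on_def) (metis eq_diff_iff)
    then show ?thesis by (simp add: sum.reindex sum_distrib_left)
  qed
  also have "(\<Sum>d\<in>(\<lambda>i. i - (j + M)) ` S. (1 / 2 :: real) ^ d) \<le> (\<Sum>d. (1 / 2) ^ d)"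
    using assms(1) by (intro sum_le_suminf summable_geometric) simp_all
  also have "(\<Sum>d. (1 / 2 :: real) ^ d) = 2" by (subst suminf_geometric) simp_all
  finally show ?thesis by simp
qed

lemma growth_power:
  fixes a :: "nat \<Rightarrow> real"
  assumes "\<And>j. a (Suc j) \<le> D * a j" "D \<ge> 0"
  shows "a (j + d) \<le> D ^ d * a j"
proof (induction d)
  case (Suc d)
  have "a (j + Suc d) \<le> D * a (j + d)" using assms(1)[of "j + d"] by simp
  also have "\<dots> \<le> D * (D ^ d * a j)" by (intro mult_left_mono Suc assms)
  finally show ?case by simp
qed simp

text \<open>On the annulus of scale \<open>j\<close> around \<open>\<gamma>\<close> the summands of coarser scale have positive real part,
  and those of finer scale are small by the decay of \<open>\<Psi>\<close> once the scales are far apart.\<close>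

lemma bump_sum_lower_bound:
  fixes \<Psi> :: "'a::euclidean_space \<Rightarrow> complex"
  assumes \<Psi>: "\<Psi> \<in> schwartz" "\<Psi> 0 = 1"
  obtains s where "\<And>m D. D > 0 \<Longrightarrow> \<exists>M\<ge>m + 3. \<forall>S a \<gamma> x j. finite S \<longrightarrow> spaced M S \<longrightarrow> (\<forall>j. a j > 0) \<longrightarrow>
    (\<forall>j. a (Suc j) \<le> D * a j) \<longrightarrow> j \<in> S \<longrightarrow> norm (x - \<gamma>) \<le> 1 / 2 ^ (s + j) \<longrightarrow> 1 / 2 ^ (s + j + m) < norm (x - \<gamma>) \<longrightarrow>
    a j / 4 \<le> norm (bump_sum \<Psi> \<gamma> S a x)"
proof -
  have "isCont \<Psi> 0" using schwartz_continuous[OF \<Psi>(1), of UNIV] by (simp add: continuous_on_eq_continuous_at)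
  then obtain \<delta> where \<delta>: "\<delta> > 0" "\<And>y. dist y 0 < \<delta> \<Longrightarrow> dist (\<Psi> y) (\<Psi> 0) < 1 / 2"
    unfolding continuous_at_eps_delta by (metis half_gt_zero zero_less_one)
  \<comment> \<open>A radius on which \<open>\<Psi>\<close> stays within \<open>1 / 2\<close> of its
    value 1 at the origin; it depends on \<open>\<Psi>\<close> alone.\<close>
  obtain s where s: "(1 / 2 :: real) ^ s < \<delta>" using real_arch_pow_inv[of \<delta> "1 / 2"] \<delta>(1) by auto
  have near: "1 / 2 \<le> Re (\<Psi> y)" if "norm y \<le> 1 / 2 ^ s" for y
  proof -
    have "norm (\<Psi> y - 1) < 1 / 2" using \<delta>(2)[of y] s that by (simp add: \<Psi>(2) dist_norm power_one_over)
    then have "\<bar>Re (\<Psi> y - 1)\<bar> < 1 / 2" using abs_Re_le_cmod[of "\<Psi> y - 1"] by linarith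
    then have "\<bar>Re (\<Psi> y) - 1\<bar> < 1 / 2" by simp
    then show ?thesis by linarith
  qed
  show ?thesis
  proof (rule that[of s])
    fix m and D :: real assume D: "D > 0"
    \<comment> \<open>The order of decay must beat the growth of the coefficients: each step to a
      finer scale costs \<open>D / 2 ^ N\<close>, which is at most \<open>1 / 2\<close>.\<close>
    obtain N where N: "2 * D < 2 ^ N" using real_arch_pow[of 2 "2 * D"] by auto
    obtain C where C: "C > 0" "\<And>x. norm (\<Psi> x) \<le> C / (1 + norm x) ^ N"
      using rapid_bound_weight[OF schwartz_rapid[OF \<Psi>(1)]] by blast
    \<comment> \<open>The point may be as close to \<open>\<gamma>\<close> as
      \<open>1 / 2 ^ (s + j + m)\<close>; the extra factor pays for the scales on which the decay
      has not set in yet.\<close>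
    define C' where "C' = C * (2 ^ (s + m)) ^ N"
    have C': "C' > 0" using C by (simp add: C'_def)
    \<comment> \<open>The finer scales may consume at most \<open>a j / 4\<close> of the
      \<open>a j / 2\<close> that the coarser ones guarantee. The summand \<open>m + 3\<close> in
      \<open>M\<close> is for the disjointness of annuli and of windows of blocks.\<close>
    obtain M1 where M1: "(1 / 2 :: real) ^ M1 < 1 / (8 * C')" using real_arch_pow_inv[of "1 / (8 * C')" "1 / 2"] C' by auto
    define M where "M = M1 + m + 3"
    have "(1 / 2 :: real) ^ M \<le> (1 / 2) ^ M1" by (intro power_decreasing) (simp_all add: M_def)
    then have "(1 / 2 :: real) ^ M \<le> 1 / (8 * C')" using M1 by linarith
    then have "C' * (2 * (1 / 2) ^ M) \<le> C' * (2 * (1 / (8 * C')))"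
      using C' by (intro mult_left_mono) simp_all
    then have M: "C' * (2 * (1 / 2) ^ M) \<le> 1 / 4" using C' by simp
    show "\<exists>M\<ge>m + 3. \<forall>S a \<gamma> x j. finite S \<longrightarrow> spaced M S \<longrightarrow> (\<forall>j. a j > 0) \<longrightarrow>
      (\<forall>j. a (Suc j) \<le> D * a j) \<longrightarrow> j \<in> S \<longrightarrow> norm (x - \<gamma>) \<le> 1 / 2 ^ (s + j) \<longrightarrow> 1 / 2 ^ (s + j + m) < norm (x - \<gamma>) \<longrightarrow>
      a j / 4 \<le> norm (bump_sum \<Psi> \<gamma> S a x)"
    proof (intro exI[of _ M] conjI allI impI)
      show "M \<ge> m + 3" by (simp add: M_def)
      fix S :: "nat set" and a :: "nat \<Rightarrow> real" and \<gamma> x :: 'a and j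
      assume S: "finite S" "spaced M S" and a: "\<forall>j. a j > 0" and grow: "\<forall>j. a (Suc j) \<le> D * a j" and j: "j \<in> S"
        and le: "norm (x - \<gamma>) \<le> 1 / 2 ^ (s + j)" and gt: "1 / 2 ^ (s + j + m) < norm (x - \<gamma>)"
      define t where "t i = a i * Re (dilate \<Psi> \<gamma> i x)" for i
      have coarse: "a i / 2 \<le> t i" if "i \<le> j" for i
      proof -
        have "2 ^ i * norm (x - \<gamma>) \<le> 2 ^ j * (1 / 2 ^ (s + j))"
          using that le by (intro mult_mono power_increasing) simp_all
        also have "\<dots> = 1 / 2 ^ s" by (simp add: power_add)
        finally have "1 / 2 \<le> Re (dilate \<Psi> \<gamma> i x)" unfolding dilate_def by (intro near) simp
        from mult_left_mono[OF this, of "a i"] show ?thesis using a by (simp add: t_def less_imp_le)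
      qed
      have fine: "- (a j * (C' * (1 / 2) ^ (i - j))) \<le> t i" if ji: "j < i" for i
      proof -
        obtain d where d: "i = j + d" using less_imp_add_positive[OF ji] by blast
        have z: "2 ^ d / 2 ^ (s + m) \<le> 2 ^ i * norm (x - \<gamma>)"
        proof -
          have "2 ^ i * (1 / 2 ^ (s + j + m)) \<le> 2 ^ i * norm (x - \<gamma>)" using gt by (intro mult_left_mono) simp_all
          moreover have "2 ^ i * (1 / 2 ^ (s + j + m)) = (2 ^ d / 2 ^ (s + m) :: real)" by (simp add: d power_add)
          ultimately show ?thesis by simp
        qed
        have "norm (dilate \<Psi> \<gamma> i x) \<le> C / (1 + 2 ^ i * norm (x - \<gamma>)) ^ N"
          using C(2)[of "(2 ^ i) *\<^sub>R (x - \<gamma>)"] by (simp add: dilate_def)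
        also have "\<dots> \<le> C / (2 ^ d / 2 ^ (s + m)) ^ N"
          using z C(1) by (intro divide_left_mono power_mono mult_pos_pos zero_less_power) (auto intro: add_pos_nonneg)
        also have "\<dots> = C' * (1 / 2 ^ N) ^ d"
          by (simp add: C'_def power_divide power_mult[symmetric] mult.commute[of d N])
        finally have nd: "norm (dilate \<Psi> \<gamma> i x) \<le> C' * (1 / 2 ^ N) ^ d" .
        have "a i \<le> D ^ d * a j" unfolding d using grow D by (intro growth_power) simp_all
        then have "a i * norm (dilate \<Psi> \<gamma> i x) \<le> (D ^ d * a j) * (C' * (1 / 2 ^ N) ^ d)"
          using a[rule_format, of i] nd C' by (intro mult_mono) simp_all
        also have "\<dots> = a j * (C' * (D / 2 ^ N) ^ d)" by (simp add: power_divide)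
        also have "\<dots> \<le> a j * (C' * (1 / 2) ^ d)"
          using a[rule_format, of j] C' N D by (intro mult_left_mono power_mono) (simp_all add: divide_le_eq)
        finally have "a i * norm (dilate \<Psi> \<gamma> i x) \<le> a j * (C' * (1 / 2) ^ (i - j))" by (simp add: d)
        moreover have "a i * - norm (dilate \<Psi> \<gamma> i x) \<le> t i"
          unfolding t_def using a[rule_format, of i] abs_Re_le_cmod[of "dilate \<Psi> \<gamma> i x"] by (intro mult_left_mono) simp_all
        ultimately show ?thesis by simp
      qed
      define S1 S2 where "S1 = {i \<in> S. i \<le> j}" and "S2 = {i \<in> S. j < i}"
      have S12: "finite S1" "finite S2" "S1 \<inter> S2 = {}" "S = S1 \<union> S2" "j \<in> S1"
        using S(1) j by (auto simp: S1_def S2_def)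
      have "a j / 2 \<le> t j" using coarse by simp
      also have "t j \<le> (\<Sum>i\<in>S1. t i)"
      proof (rule member_le_sum[OF S12(5) _ S12(1)])
        fix i assume "i \<in> S1 - {j}"
        then have "a i / 2 \<le> t i" by (intro coarse) (simp add: S1_def)
        then show "0 \<le> t i" using a[rule_format, of i] by simp
      qed
      finally have 1: "a j / 2 \<le> (\<Sum>i\<in>S1. t i)" .
      have "(\<Sum>i\<in>S2. (1 / 2 :: real) ^ (i - j)) \<le> 2 * (1 / 2) ^ M"
      proof (rule sum_half_powers_le[OF S12(2)])
        fix i assume "i \<in> S2"
        then show "j + M \<le> i" using S(2) j unfolding S2_def spaced_def by blast
      qed
      then have "C' * (\<Sum>i\<in>S2. (1 / 2) ^ (i - j)) \<le> C' * (2 * (1 / 2) ^ M)" using C' by (intro mult_left_mono) simp_all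
      then have "a j * (C' * (\<Sum>i\<in>S2. (1 / 2) ^ (i - j))) \<le> a j * (1 / 4)"
        using M a[rule_format, of j] by (intro mult_left_mono) simp_all
      then have "- (a j / 4) \<le> (\<Sum>i\<in>S2. - (a j * (C' * (1 / 2) ^ (i - j))))"
        by (simp add: sum_distrib_left sum_negf)
      also have "\<dots> \<le> (\<Sum>i\<in>S2. t i)" by (intro sum_mono fine) (simp add: S2_def)
      finally have 2: "- (a j / 4) \<le> (\<Sum>i\<in>S2. t i)" .
      have "Re (bump_sum \<Psi> \<gamma> S a x) = (\<Sum>i\<in>S. t i)" by (simp add: bump_sum_def t_def)
      also have "\<dots> = (\<Sum>i\<in>S1. t i) + (\<Sum>i\<in>S2. t i)" unfolding S12(4) by (rule sum.union_disjoint[OF S12(1-3)])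
      finally have "a j / 4 \<le> Re (bump_sum \<Psi> \<gamma> S a x)" using 1 2 by simp
      then show "a j / 4 \<le> norm (bump_sum \<Psi> \<gamma> S a x)" using complex_Re_le_cmod order_trans by blast
    qed
  qed
qed

context h_regular begin

text \<open>The geometric decay of \<open>h\<close> ensures that a ball \<open>m\<close> scales
  smaller carries at most half of the guaranteed mass, so the annulus between them keeps a fixed
  share. On disjoint annuli the integral is bounded below by a sum over the scales.\<close>

lemma bump_sum_integral_lower_bound:
  fixes \<Psi> :: "'a \<Rightarrow> complex"
  assumes \<Psi>: "\<Psi> \<in> schwartz" "\<Psi> 0 = 1" and \<gamma>: "\<gamma> \<in> \<Gamma>" and r: "r > 0" and D: "D > 0"
    and \<theta>: "0 < \<theta>" "\<theta> < 1" "\<forall>j\<ge>J0. dyadic h (Suc j) \<le> \<theta> * dyadic h j"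
  shows "\<exists>c M. c > 0 \<and> M \<ge> 3 \<and> (\<forall>S a. finite S \<longrightarrow> spaced M S \<longrightarrow> (\<forall>j\<in>S. j \<ge> J0) \<longrightarrow> (\<forall>j. a j > 0) \<longrightarrow>
    (\<forall>j. a (Suc j) \<le> D * a j) \<longrightarrow>
    ennreal (c * (\<Sum>j\<in>S. a j powr r * dyadic h j)) \<le> (\<integral>\<^sup>+x. ennreal (norm (bump_sum \<Psi> \<gamma> S a x) powr r) \<partial>\<mu>))"
proof -
  obtain s where s: "\<And>m D. D > 0 \<Longrightarrow> \<exists>M\<ge>m + 3. \<forall>S a \<gamma> x j. finite S \<longrightarrow> spaced M S \<longrightarrow> (\<forall>j. a j > 0) \<longrightarrow>
    (\<forall>j. a (Suc j) \<le> D * a j) \<longrightarrow> j \<in> S \<longrightarrow> norm (x - \<gamma>) \<le> 1 / 2 ^ (s + j) \<longrightarrow> 1 / 2 ^ (s + j + m) < norm (x - \<gamma>) \<longrightarrow>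
    a j / 4 \<le> norm (bump_sum \<Psi> \<gamma> S a x)"
    by (rule bump_sum_lower_bound[OF \<Psi>]) (rule that)
  obtain K where K: "K \<ge> 1" "\<And>j. dyadic h j \<le> K * dyadic h (Suc j)" by (rule dyadic_doubling) blast
  \<comment> \<open>The inner ball has mass at most \<open>c2 * \<theta> ^ m\<close> times the gauge
    of the outer one; \<open>m\<close> is taken so large that this is at most \<open>c1 / 2\<close>
    times that gauge.\<close>
  obtain m where m: "\<theta> ^ m < c1 / (2 * c2)" using real_arch_pow_inv[of "c1 / (2 * c2)" \<theta>] \<theta> c1 c2 by auto
  then have m': "c2 * \<theta> ^ m \<le> c1 / 2" using c2 by (simp add: field_simps)
  obtain M where M: "M \<ge> m + 3" and low: "\<And>S a \<gamma> x j. finite S \<Longrightarrow> spaced M S \<Longrightarrow> (\<forall>j. a j > 0) \<Longrightarrow>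
    (\<forall>j. a (Suc j) \<le> D * a j) \<Longrightarrow> j \<in> S \<Longrightarrow> norm (x - \<gamma>) \<le> 1 / 2 ^ (s + j) \<Longrightarrow> 1 / 2 ^ (s + j + m) < norm (x - \<gamma>) \<Longrightarrow>
    a j / 4 \<le> norm (bump_sum \<Psi> \<gamma> S a x)"
    using s[OF D, of m] by blast
  define A where "A j = cball \<gamma> (1 / 2 ^ (s + j)) - cball \<gamma> (1 / 2 ^ (s + j + m))" for j
  have A_sets: "A j \<in> sets \<mu>" for j unfolding A_def by (intro sets.Diff sets_closed closed_cball)
  have A_measure: "c1 / (2 * K ^ s) * dyadic h j \<le> measure \<mu> (A j)" if "j \<ge> J0" for j
  proof -
    have "dyadic h (s + j + i) \<le> \<theta> ^ i * dyadic h (s + j)" for i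
    proof (induction i)
      case (Suc i)
      have "dyadic h (s + j + Suc i) \<le> \<theta> * dyadic h (s + j + i)" using \<theta>(3)[rule_format, of "s + j + i"] that by simp
      also have "\<dots> \<le> \<theta> * (\<theta> ^ i * dyadic h (s + j))" using \<theta>(1) Suc by (intro mult_left_mono) simp_all
      finally show ?case by simp
    qed simp
    then have dm: "c2 * dyadic h (s + j + m) \<le> c2 * (\<theta> ^ m * dyadic h (s + j))" using c2 by (intro mult_left_mono) simp_all
    have "dyadic h j \<le> K ^ s * dyadic h (j + s)" by (rule dyadic_doubling_power[OF K])
    then have "c1 / (2 * K ^ s) * dyadic h j \<le> c1 / (2 * K ^ s) * (K ^ s * dyadic h (s + j))"
      using c1 K(1) by (intro mult_left_mono) (simp_all add: add.commute)
    also have "\<dots> = c1 * dyadic h (s + j) - c1 / 2 * dyadic h (s + j)" using K(1) by simp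
    also have "\<dots> \<le> c1 * dyadic h (s + j) - c2 * \<theta> ^ m * dyadic h (s + j)"
      using m' dyadic_pos[of "s + j"] by (intro diff_left_mono mult_right_mono) simp_all
    also have "\<dots> \<le> c1 * dyadic h (s + j) - c2 * dyadic h (s + j + m)" using dm by simp
    also have "\<dots> \<le> measure \<mu> (cball \<gamma> (1 / 2 ^ (s + j))) - measure \<mu> (cball \<gamma> (1 / 2 ^ (s + j + m)))"
      unfolding dyadic_eq by (intro diff_mono ball_lower ball_upper \<gamma>) simp_all
    also have "\<dots> = measure \<mu> (A j)"
      unfolding A_def
    proof (rule finite_measure_Diff[symmetric])
      show "cball \<gamma> (1 / 2 ^ (s + j + m)) \<subseteq> cball \<gamma> (1 / 2 ^ (s + j))"
        by (intro subset_cball divide_left_mono power_increasing) simp_all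
    qed (intro sets_closed closed_cball)+
    finally show ?thesis .
  qed
  \<comment> \<open>The first factor stems from the pointwise bound \<open>a j / 4\<close>, the
    second from the mass of the annulus; \<open>K ^ s\<close> is the price for its outer radius
    being \<open>s\<close> scales finer than \<open>j\<close>.\<close>
  define c where "c = (1 / 4) powr r * (c1 / (2 * K ^ s))"
  have "ennreal (c * (\<Sum>j\<in>S. a j powr r * dyadic h j)) \<le> (\<integral>\<^sup>+x. ennreal (norm (bump_sum \<Psi> \<gamma> S a x) powr r) \<partial>\<mu>)"
    if S: "finite S" "spaced M S" "\<forall>j\<in>S. j \<ge> J0" and a: "\<forall>j. a j > 0" "\<forall>j. a (Suc j) \<le> D * a j" for S a
  proof -
    have disj: "x \<notin> A i" if "i \<in> S" "j \<in> S" "i \<noteq> j" "x \<in> A j" for i j x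
    proof -
      have *: "False" if "i \<in> S" "j \<in> S" "i < j" "x \<in> A i" "x \<in> A j" for i j
      proof -
        \<comment> \<open>Because the spacing exceeds \<open>m\<close>, the annulus of the finer
          scale fits into the ball removed at the coarser scale.\<close>
        have "i + m \<le> j" using S(2) that M unfolding spaced_def by force
        then have "(1::real) / 2 ^ (s + j) \<le> 1 / 2 ^ (s + i + m)" by (intro divide_left_mono power_increasing) simp_all
        then show False using that(4,5) by (auto simp: A_def)
      qed
      show ?thesis using that *[of i j] *[of j i] by (meson linorder_neqE_nat)
    qed
    have pw: "(\<Sum>j\<in>S. ennreal ((a j / 4) powr r) * indicator (A j) x) \<le> ennreal (norm (bump_sum \<Psi> \<gamma> S a x) powr r)" for x
    proof (cases "\<exists>j\<in>S. x \<in> A j")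
      case True
      then obtain j where j: "j \<in> S" "x \<in> A j" by blast
      have "(\<Sum>i\<in>S. ennreal ((a i / 4) powr r) * indicator (A i) x) = ennreal ((a j / 4) powr r) * indicator (A j) x"
        using disj[OF _ j(1) _ j(2)] by (subst sum.remove[OF S(1) j(1)]) (auto simp: sum.neutral)
      also have "\<dots> = ennreal ((a j / 4) powr r)" using j by simp
      also have "\<dots> \<le> ennreal (norm (bump_sum \<Psi> \<gamma> S a x) powr r)"
        using j a r by (intro ennreal_leI powr_mono2 low[OF S(1,2) a j(1)])
          (auto simp: A_def dist_norm norm_minus_commute less_imp_le)
      finally show ?thesis .
    qed (simp add: sum.neutral)
    have "ennreal (c * (\<Sum>j\<in>S. a j powr r * dyadic h j)) = (\<Sum>j\<in>S. ennreal (c * (a j powr r * dyadic h j)))"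
      using c1 K(1) dyadic_pos by (subst sum_ennreal) (simp_all add: sum_distrib_left c_def less_imp_le)
    also have "\<dots> \<le> (\<Sum>j\<in>S. ennreal ((a j / 4) powr r) * emeasure \<mu> (A j))"
    proof (rule sum_mono)
      fix j assume j: "j \<in> S"
      have "c * (a j powr r * dyadic h j) = (a j / 4) powr r * (c1 / (2 * K ^ s) * dyadic h j)"
        using a(1)[rule_format, of j] by (simp add: c_def powr_divide)
      also have "\<dots> \<le> (a j / 4) powr r * measure \<mu> (A j)"
        using S(3) j by (intro mult_left_mono A_measure) simp_all
      finally show "ennreal (c * (a j powr r * dyadic h j)) \<le> ennreal ((a j / 4) powr r) * emeasure \<mu> (A j)"
        by (simp add: emeasure_eq_measure ennreal_leI flip: ennreal_mult)
    qed
    also have "\<dots> = (\<Sum>j\<in>S. \<integral>\<^sup>+x. ennreal ((a j / 4) powr r) * indicator (A j) x \<partial>\<mu>)"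
      by (intro sum.cong refl nn_integral_cmult_indicator[symmetric] A_sets)
    also have "\<dots> = (\<integral>\<^sup>+x. (\<Sum>j\<in>S. ennreal ((a j / 4) powr r) * indicator (A j) x) \<partial>\<mu>)"
      by (intro nn_integral_sum[symmetric] borel_measurable_times_ennreal borel_measurable_const borel_measurable_indicator A_sets)
    also have "\<dots> \<le> (\<integral>\<^sup>+x. ennreal (norm (bump_sum \<Psi> \<gamma> S a x) powr r) \<partial>\<mu>)"
      by (intro nn_integral_mono pw)
    finally show ?thesis .
  qed
  moreover have "c > 0" using c1 K(1) by (simp add: c_def)
  moreover have "M \<ge> 3" using M by simp
  ultimately show ?thesis by blast
qed

text \<open>Restricting to \<open>\<Gamma>\<close> loses nothing of the integral, because the
  complement of the support is null.\<close>

lemma Lp_norm_restrict_ge: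
  assumes "r > 0" "ennreal c \<le> (\<integral>\<^sup>+x. ennreal (norm (f x) powr r) \<partial>\<mu>)" "c \<ge> 0"
  shows "ennreal (c powr (1 / r)) \<le> Lp_norm (restrict_space \<mu> \<Gamma>) r f"
proof -
  have "AE x in \<mu>. x \<in> \<Gamma>"
    by (rule AE_I'[OF complement_null]) auto
  then have "(\<integral>\<^sup>+x. ennreal (norm (f x) powr r) \<partial>\<mu>) = (\<integral>\<^sup>+x. ennreal (norm (f x) powr r) * indicator \<Gamma> x \<partial>\<mu>)"
    by (intro nn_integral_cong_AE) (auto elim!: eventually_mono)
  also have "\<dots> = (\<integral>\<^sup>+x. ennreal (norm (f x) powr r) \<partial>restrict_space \<mu> \<Gamma>)"
    using compact_imp_closed[OF compact] sets_eq_imp_space_eq[OF sets_mu]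
    by (intro nn_integral_restrict_space[symmetric]) (simp add: sets_mu)
  finally have "epowr (ennreal c) (1 / r) \<le> Lp_norm (restrict_space \<mu> \<Gamma>) r f"
    unfolding Lp_norm_def using assms by (intro epowr_mono) simp_all
  then show ?thesis using assms by (simp add: epowr_ennreal)
qed

text \<open>The trace inequality is tested with bump sums, after which only sequences remain.
  \<open>K\<close> and \<open>M\<close> do not depend on the finite set or on the coefficients, but
  may depend on \<open>D\<close>. Starting at \<open>Suc J0\<close> also keeps the scale 0
  away.\<close>

lemma sequence_bound_if_bounded_trace:
  fixes \<phi>0 :: "'a \<Rightarrow> complex"
  assumes \<phi>: "resolution_generator \<phi>0" and p: "p > 0" and q: "q > 0" and r: "r > 0" and D: "D > 0"
    and \<rho>: "\<And>j. \<rho> j > 0" "\<And>j. \<rho> (Suc j) \<le> \<kappa> * \<rho> j" and \<kappa>: "\<kappa> \<ge> 1"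
    and \<theta>: "0 < \<theta>" "\<theta> < 1" "\<forall>j\<ge>J0. dyadic h (Suc j) \<le> \<theta> * dyadic h j"
    and tr: "bounded_trace \<phi>0 \<rho> p q \<Gamma> \<mu> r"
  shows "\<exists>K M. K > 0 \<and> M > 0 \<and> (\<forall>S a. finite S \<longrightarrow> spaced M S \<longrightarrow> (\<forall>j\<in>S. j \<ge> Suc J0) \<longrightarrow> (\<forall>j. a j > 0) \<longrightarrow>
    (\<forall>j. a (Suc j) \<le> D * a j) \<longrightarrow>
    (\<Sum>j\<in>S. a j powr r * dyadic h j) powr (1 / r)
      \<le> K * (\<Sum>j\<in>S. (a j * \<rho> j * 2 powr (- (real j * real DIM('a) / p))) powr q) powr (1 / q))"
proof -
  obtain \<gamma> where \<gamma>: "\<gamma> \<in> \<Gamma>" using nonempty by blast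
  obtain \<Psi> :: "'a \<Rightarrow> complex" where \<Psi>: "\<Psi> \<in> schwartz" "\<Psi> 0 = 1"
    and spec: "\<And>\<xi>. fourier \<Psi> \<xi> \<noteq> 0 \<Longrightarrow> 1 < norm \<xi> \<and> norm \<xi> \<le> 4"
    by (rule band_limited_bump[OF \<phi>]) blast
  obtain c M where c: "c > 0" "M \<ge> 3" and low: "\<And>S a. finite S \<Longrightarrow> spaced M S \<Longrightarrow> (\<forall>j\<in>S. j \<ge> J0) \<Longrightarrow> (\<forall>j. a j > 0) \<Longrightarrow>
    (\<forall>j. a (Suc j) \<le> D * a j) \<Longrightarrow>
    ennreal (c * (\<Sum>j\<in>S. a j powr r * dyadic h j)) \<le> (\<integral>\<^sup>+x. ennreal (norm (bump_sum \<Psi> \<gamma> S a x) powr r) \<partial>\<mu>)"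
    using bump_sum_integral_lower_bound[OF \<Psi> \<gamma> r D \<theta>] by blast
  obtain C where C: "C > 0" and up: "\<And>S a \<gamma>. finite S \<Longrightarrow> spaced 3 S \<Longrightarrow> 0 \<notin> S \<Longrightarrow> (\<And>j. a j > 0) \<Longrightarrow>
      besov_norm \<phi>0 \<rho> p q (regular_distr (bump_sum \<Psi> \<gamma> S a))
        \<le> ennreal (C * (\<Sum>j\<in>S. (a j * \<rho> j * 2 powr (- (real j * real DIM('a) / p))) powr q) powr (1 / q))"
    using besov_norm_bump_sum_le[where \<rho> = \<rho> and \<kappa> = \<kappa>, OF \<phi> \<Psi>(1) spec p q \<rho> \<kappa>] by blast
  obtain c0 where c0: "c0 > 0" "\<And>f. f \<in> schwartz \<Longrightarrow> Lp_norm (restrict_space \<mu> \<Gamma>) r f \<le> ennreal c0 * besov_norm \<phi>0 \<rho> p q (regular_distr f)"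
    using tr unfolding bounded_trace_def by blast
  have "(\<Sum>j\<in>S. a j powr r * dyadic h j) powr (1 / r)
      \<le> (c0 * C / c powr (1 / r)) * (\<Sum>j\<in>S. (a j * \<rho> j * 2 powr (- (real j * real DIM('a) / p))) powr q) powr (1 / q)"
    if S: "finite S" "spaced M S" "\<forall>j\<in>S. j \<ge> Suc J0" and a: "\<forall>j. a j > 0" "\<forall>j. a (Suc j) \<le> D * a j" for S a
  proof -
    let ?f = "bump_sum \<Psi> \<gamma> S a"
    define X where "X = (\<Sum>j\<in>S. a j powr r * dyadic h j)"
    define Y where "Y = (\<Sum>j\<in>S. (a j * \<rho> j * 2 powr (- (real j * real DIM('a) / p))) powr q) powr (1 / q)"
    have X: "X \<ge> 0" unfolding X_def using dyadic_pos by (intro sum_nonneg mult_nonneg_nonneg) (simp_all add: less_imp_le)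
    have "\<forall>j\<in>S. j \<ge> J0" using S(3) by force
    from low[OF S(1,2) this a] have "ennreal ((c * X) powr (1 / r)) \<le> Lp_norm (restrict_space \<mu> \<Gamma>) r ?f"
      using X c(1) r by (intro Lp_norm_restrict_ge) (simp_all add: X_def)
    also have "\<dots> \<le> ennreal c0 * besov_norm \<phi>0 \<rho> p q (regular_distr ?f)"
      by (intro c0(2) bump_sum_schwartz \<Psi>)
    also have "\<dots> \<le> ennreal c0 * ennreal (C * Y)"
      unfolding Y_def
    proof (intro mult_left_mono up S(1))
      show "spaced 3 S" using S(2) c(2) unfolding spaced_def by fastforce
      show "0 \<notin> S" using S(3) by force
    qed (use a in simp_all)
    also have "\<dots> = ennreal (c0 * (C * Y))" using c0(1) C by (simp add: ennreal_mult Y_def)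
    finally have "(c * X) powr (1 / r) \<le> c0 * (C * Y)" using c0(1) C by (simp add: ennreal_le_iff Y_def)
    then have "X powr (1 / r) \<le> (c0 * C / c powr (1 / r)) * Y"
      using c(1) X by (simp add: powr_mult field_simps)
    then show ?thesis unfolding X_def Y_def .
  qed
  moreover have "c0 * C / c powr (1 / r) > 0" using c0(1) C c(1) by simp
  moreover have "M > 0" using c(2) by simp
  ultimately show ?thesis by blast
qed

end

text \<open>Any real \<open>y\<close> strictly between the limes superior and 0 yields the ratio
  \<open>2 powr y\<close> beyond some index.\<close>

lemma limsup_log_ratio_negative:
  fixes d :: "nat \<Rightarrow> real"
  assumes "limsup (\<lambda>j. ereal (log 2 (d (Suc j) / d j))) < 0" and d: "\<And>j. d j > 0"
  obtains \<theta> J where "0 < \<theta>" "\<theta> < 1" "\<forall>j\<ge>J. d (Suc j) \<le> \<theta> * d j"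
proof -
  obtain y where y: "limsup (\<lambda>j. ereal (log 2 (d (Suc j) / d j))) < ereal y" "ereal y < 0"
    using ereal_dense2[OF assms(1)] by blast
  have "\<forall>\<^sub>F j in sequentially. ereal (log 2 (d (Suc j) / d j)) < ereal y"
    using y(1) by (rule Limsup_lessD)
  then obtain J where J: "\<And>j. j \<ge> J \<Longrightarrow> log 2 (d (Suc j) / d j) < y"
    unfolding eventually_sequentially by auto
  show ?thesis
  proof (rule that)
    show "0 < (2::real) powr y" by simp
    show "(2::real) powr y < 1" using y(2) by (simp add: powr_less_one)
    show "\<forall>j\<ge>J. d (Suc j) \<le> 2 powr y * d j"
    proof (intro allI impI)
      fix j assume "j \<ge> J"
      then have "log 2 (d (Suc j) / d j) < y" by (rule J)
      then have "d (Suc j) / d j < 2 powr y" using d by (simp add: log_less_iff)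
      then show "d (Suc j) \<le> 2 powr y * d j" using d[of j] by (simp add: divide_less_eq less_imp_le)
    qed
  qed
qed

section \<open>The two equivalences for the weights of the theorem\<close>

context h_regular begin

context
  fixes \<sigma> :: "nat \<Rightarrow> real" and p :: real
  assumes \<sigma>: "admissible \<sigma>" and p: "p > 0"
begin

definition besov_weight :: "nat \<Rightarrow> real" where
  "besov_weight j = \<sigma> j * dyadic h j powr (1 / p) * 2 powr (real j * real DIM('a) / p)"

definition trace_weight :: "real \<Rightarrow> nat \<Rightarrow> real" where
  "trace_weight r j = inverse (\<sigma> j) * dyadic h j powr (1 / r - 1 / p)"

lemma \<sigma>_pos: "\<sigma> j > 0"
  using \<sigma> by (simp add: admissible_def)

lemma besov_weight_pos: "besov_weight j > 0"
  using \<sigma>_pos[of j] dyadic_pos[of j] by (simp add: besov_weight_def)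

lemma trace_weight_pos: "trace_weight r j > 0"
  using \<sigma>_pos[of j] dyadic_pos[of j] by (simp add: trace_weight_def)

lemma trace_weight_mult_besov_weight:
  "trace_weight r j * besov_weight j = dyadic h j powr (1 / r) * 2 powr (real j * real DIM('a) / p)"
proof -
  have "dyadic h j powr (1 / r - 1 / p) * dyadic h j powr (1 / p) = dyadic h j powr (1 / r)"
    by (simp add: powr_add[symmetric])
  then show ?thesis
    using \<sigma>_pos[of j] by (simp add: trace_weight_def besov_weight_def mult_ac)
qed

lemma besov_weight_normalised:
  "besov_weight j * 2 powr (- (real j * real DIM('a) / p)) = \<sigma> j * dyadic h j powr (1 / p)"
  by (simp add: besov_weight_def mult.assoc powr_add[symmetric])

lemma besov_weight_growth:
  obtains \<kappa> where "\<kappa> \<ge> 1" "\<And>j. besov_weight (Suc j) \<le> \<kappa> * besov_weight j"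
proof -
  obtain d1 where d1: "d1 > 0" "\<And>j. \<sigma> (Suc j) \<le> d1 * \<sigma> j" using \<sigma> unfolding admissible_def by blast
  define \<kappa> where "\<kappa> = 1 + d1 * 2 powr (real DIM('a) / p)"
  show ?thesis
  proof (rule that)
    show "\<kappa> \<ge> 1" using d1 by (simp add: \<kappa>_def)
    fix j
    have "dyadic h (Suc j) powr (1 / p) \<le> dyadic h j powr (1 / p)"
      using p dyadic_pos by (intro powr_mono2 dyadic_antimono) (simp_all add: less_imp_le)
    then have "\<sigma> (Suc j) * dyadic h (Suc j) powr (1 / p) \<le> (d1 * \<sigma> j) * dyadic h j powr (1 / p)"
      using d1 \<sigma>_pos by (intro mult_mono) (simp_all add: less_imp_le)
    then have "besov_weight (Suc j) \<le> ((d1 * \<sigma> j) * dyadic h j powr (1 / p)) * 2 powr (real (Suc j) * real DIM('a) / p)"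
      unfolding besov_weight_def by (intro mult_right_mono) simp_all
    also have "2 powr (real (Suc j) * real DIM('a) / p) = 2 powr (real DIM('a) / p) * 2 powr (real j * real DIM('a) / p)"
      by (simp add: powr_add[symmetric] add_divide_distrib[symmetric] algebra_simps)
    also have "(d1 * \<sigma> j) * dyadic h j powr (1 / p) * (2 powr (real DIM('a) / p) * 2 powr (real j * real DIM('a) / p))
        = (d1 * 2 powr (real DIM('a) / p)) * besov_weight j" by (simp add: besov_weight_def mult_ac)
    also have "\<dots> \<le> \<kappa> * besov_weight j" using besov_weight_pos[of j] by (intro mult_right_mono) (simp_all add: \<kappa>_def)
    finally show "besov_weight (Suc j) \<le> \<kappa> * besov_weight j" .
  qed
qed

lemma bounded_trace_iff_bounded:
  fixes \<phi>0 :: "'a \<Rightarrow> complex"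
  assumes \<phi>: "resolution_generator \<phi>0" and pr: "p \<le> r" and q: "0 < q" "q \<le> min r 1"
    and \<theta>: "0 < \<theta>" "\<theta> < 1" "\<forall>j\<ge>J0. dyadic h (Suc j) \<le> \<theta> * dyadic h j"
  shows "bounded_trace \<phi>0 besov_weight p q \<Gamma> \<mu> r \<longleftrightarrow> bounded (range (trace_weight r))"
proof
  have r: "r > 0" using p pr by simp
  assume "bounded (range (trace_weight r))"
  then obtain T where "\<And>j. norm (trace_weight r j) \<le> T" unfolding bounded_iff by blast
  then have T: "trace_weight r j \<le> T" for j by (metis abs_le_D1 real_norm_def)
  then have "T + 1 > 0" using trace_weight_pos[of r 0] T[of 0] by linarith
  then show "bounded_trace \<phi>0 besov_weight p q \<Gamma> \<mu> r"
    using sequence_bound_ell_infty[OF less_imp_le[OF trace_weight_pos] T q]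
    by (intro bounded_trace_if_sequence_bound[OF \<phi> p pr q(1) besov_weight_pos less_imp_le[OF trace_weight_pos]
          trace_weight_mult_besov_weight refl, where C' = "(T + 1) powr min r 1"]) simp_all
next
  have r: "r > 0" using p pr by simp
  assume tr: "bounded_trace \<phi>0 besov_weight p q \<Gamma> \<mu> r"
  obtain \<kappa> where \<kappa>: "\<kappa> \<ge> 1" "\<And>j. besov_weight (Suc j) \<le> \<kappa> * besov_weight j" by (rule besov_weight_growth) blast
  obtain K M where K: "K > 0" and seq: "\<And>S a. finite S \<Longrightarrow> spaced M S \<Longrightarrow> (\<forall>j\<in>S. j \<ge> Suc J0) \<Longrightarrow> (\<forall>j. a j > 0) \<Longrightarrow>
    (\<forall>j. a (Suc j) \<le> 1 * a j) \<Longrightarrow> (\<Sum>j\<in>S. a j powr r * dyadic h j) powr (1 / r)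
      \<le> K * (\<Sum>j\<in>S. (a j * besov_weight j * 2 powr (- (real j * real DIM('a) / p))) powr q) powr (1 / q)"
    using sequence_bound_if_bounded_trace[where \<rho> = besov_weight and \<kappa> = \<kappa>, OF \<phi> p q(1) r zero_less_one besov_weight_pos \<kappa>(2,1) \<theta> tr] by blast
  have le: "trace_weight r j \<le> K" if "j \<ge> Suc J0" for j
  proof -
    \<comment> \<open>A one-element set is spaced for every \<open>M\<close>, and the constant
      coefficients 1 satisfy the growth condition with \<open>D = 1\<close>.\<close>
    have "(\<Sum>j\<in>{j}. 1 powr r * dyadic h j) powr (1 / r)
      \<le> K * (\<Sum>j\<in>{j}. (1 * besov_weight j * 2 powr (- (real j * real DIM('a) / p))) powr q) powr (1 / q)"
      by (rule seq) (use that in \<open>auto simp: spaced_def\<close>)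
    then have "dyadic h j powr (1 / r) \<le> K * (\<sigma> j * dyadic h j powr (1 / p))"
      using q(1) \<sigma>_pos[of j] dyadic_pos[of j] by (simp add: besov_weight_normalised powr_powr)
    then have "dyadic h j powr (1 / r) / (\<sigma> j * dyadic h j powr (1 / p)) \<le> K"
      using \<sigma>_pos[of j] dyadic_pos[of j] by (simp add: divide_le_eq)
    moreover have "trace_weight r j = dyadic h j powr (1 / r) / (\<sigma> j * dyadic h j powr (1 / p))"
      by (simp add: trace_weight_def powr_diff divide_inverse mult_ac)
    ultimately show ?thesis by simp
  qed
  show "bounded (range (trace_weight r))"
  proof (rule boundedI)
    fix x assume "x \<in> range (trace_weight r)"
    then obtain j where x: "x = trace_weight r j" by blast
    have s0: "(\<Sum>i\<le>J0. trace_weight r i) \<ge> 0" by (intro sum_nonneg less_imp_le trace_weight_pos)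
    show "norm x \<le> K + (\<Sum>i\<le>J0. trace_weight r i)"
    proof (cases "j \<ge> Suc J0")
      case True
      then show ?thesis using le[OF True] s0 trace_weight_pos[of r j] by (simp add: x)
    next
      case False
      then have "trace_weight r j \<le> (\<Sum>i\<le>J0. trace_weight r i)"
        by (intro member_le_sum less_imp_le trace_weight_pos) simp_all
      then show ?thesis using K trace_weight_pos[of r j] by (simp add: x)
    qed
  qed
qed

lemma bounded_trace_iff_summable:
  fixes \<phi>0 :: "'a \<Rightarrow> complex"
  assumes \<phi>: "resolution_generator \<phi>0" and pr: "p \<le> r" and rq: "r < q" "r \<le> 1" and v: "v > 0" "1 / v = 1 / r - 1 / q"
    and \<theta>: "0 < \<theta>" "\<theta> < 1" "\<forall>j\<ge>J0. dyadic h (Suc j) \<le> \<theta> * dyadic h j"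
  shows "bounded_trace \<phi>0 besov_weight p q \<Gamma> \<mu> r \<longleftrightarrow> summable (\<lambda>j. trace_weight r j powr v)"
proof
  have r: "r > 0" using p pr by simp
  have q: "q > 0" using r rq by simp
  assume sum: "summable (\<lambda>j. trace_weight r j powr v)"
  have m: "min r 1 = r" using rq by simp
  have "(\<Sum>j. trace_weight r j powr v) \<ge> 0" by (intro suminf_nonneg sum) simp
  then show "bounded_trace \<phi>0 besov_weight p q \<Gamma> \<mu> r"
    using sequence_bound_ell[OF less_imp_le[OF trace_weight_pos] sum r rq(1) v]
    by (intro bounded_trace_if_sequence_bound[OF \<phi> p pr q besov_weight_pos less_imp_le[OF trace_weight_pos]
          trace_weight_mult_besov_weight m[symmetric], where C' = "(\<Sum>j. trace_weight r j powr v) + 1"]) simp_all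
next
  have r: "r > 0" using p pr by simp
  have q: "q > 0" using r rq by simp
  assume tr: "bounded_trace \<phi>0 besov_weight p q \<Gamma> \<mu> r"
  obtain d0 where d0: "d0 > 0" "\<And>j. d0 * \<sigma> j \<le> \<sigma> (Suc j)" using \<sigma> unfolding admissible_def by blast
  obtain Kd where Kd: "Kd \<ge> 1" "\<And>j. dyadic h j \<le> Kd * dyadic h (Suc j)" by (rule dyadic_doubling) blast
  \<comment> \<open>The extremal sequence: with it both sides of the trace inequality are powers of the same sum.\<close>
  define u where "u j = dyadic h j powr (1 - q / p) * \<sigma> j powr (- q)" for j
  \<comment> \<open>The exponent solves \<open>a j powr r * dyadic h j = (a j * \<sigma> j * dyadic
    h j powr (1 / p)) powr q\<close> for \<open>a j\<close>; this is where \<open>r < q\<close>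
    enters.\<close>
  define a where "a j = u j powr (1 / (q - r))" for j
  define D where "D = ((1 / Kd) powr (1 - q / p) * d0 powr (- q)) powr (1 / (q - r))"
  have u: "u j > 0" for j using dyadic_pos[of j] \<sigma>_pos[of j] by (simp add: u_def)
  have a: "a j > 0" for j using u[of j] by (simp add: a_def)
  have D: "D > 0" using Kd(1) d0(1) by (simp add: D_def)
  have grow: "a (Suc j) \<le> D * a j" for j
  proof -
    \<comment> \<open>Both exponents in \<open>u\<close> are at most 0, so lower bounds for the next
      \<open>dyadic h\<close> and \<open>\<sigma>\<close>, namely doubling and admissibility, give
      an upper bound for the growth of \<open>u\<close>.\<close>
    have "1 - q / p \<le> 0" using p pr rq by (simp add: le_divide_eq)
    moreover have "1 / Kd * dyadic h j \<le> dyadic h (Suc j)" using Kd(1) Kd(2)[of j] by (simp add: divide_le_eq mult.commute)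
    ultimately have 1: "dyadic h (Suc j) powr (1 - q / p) \<le> (1 / Kd * dyadic h j) powr (1 - q / p)"
      using Kd(1) dyadic_pos[of j] by (intro powr_mono2') simp_all
    have 2: "\<sigma> (Suc j) powr (- q) \<le> (d0 * \<sigma> j) powr (- q)"
      using q d0 \<sigma>_pos[of j] by (intro powr_mono2') simp_all
    have "u (Suc j) \<le> (1 / Kd * dyadic h j) powr (1 - q / p) * (d0 * \<sigma> j) powr (- q)"
      unfolding u_def by (intro mult_mono 1 2) simp_all
    also have "\<dots> = ((1 / Kd) powr (1 - q / p) * d0 powr (- q)) * u j"
      using Kd(1) d0(1) dyadic_pos[of j] \<sigma>_pos[of j]
      by (subst (1 2) powr_mult) (simp_all add: u_def less_imp_le mult_ac)
    finally have "a (Suc j) \<le> (((1 / Kd) powr (1 - q / p) * d0 powr (- q)) * u j) powr (1 / (q - r))"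
      unfolding a_def using rq u by (intro powr_mono2) (simp_all add: less_imp_le)
    also have "\<dots> = D * a j"
      using u[of j] by (subst powr_mult) (simp_all add: D_def a_def less_imp_le)
    finally show ?thesis .
  qed
  define b where "b j = trace_weight r j powr v" for j
  have b: "b j > 0" for j using trace_weight_pos[of r j] by (simp add: b_def)
  have v_eq: "v = r * q / (q - r)"
  proof -
    have "1 / v = (q - r) / (r * q)" using v(2) r q by (simp add: field_simps)
    then show ?thesis by (metis inverse_divide inverse_inverse_eq inverse_eq_divide)
  qed
  \<comment> \<open>The identities \<open>lhs\<close> and \<open>rhs\<close> are between products of
    powers; on logarithms they become linear in \<open>ln (dyadic h j)\<close> and
    \<open>ln (\<sigma> j)\<close>.\<close>
  have ln_u: "ln (u j) = (1 - q / p) * ln (dyadic h j) - q * ln (\<sigma> j)" for j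
    using dyadic_pos[of j] \<sigma>_pos[of j] by (simp add: u_def ln_mult ln_powr)
  have ln_b: "ln (b j) = v * ((1 / r - 1 / p) * ln (dyadic h j) - ln (\<sigma> j))" for j
    using dyadic_pos[of j] \<sigma>_pos[of j] by (simp add: b_def trace_weight_def ln_mult ln_powr ln_inverse)
  have lhs: "a j powr r * dyadic h j = b j" for j
  proof -
    have "ln (a j powr r * dyadic h j) = ln (b j)"
      using a[of j] u[of j] dyadic_pos[of j] r q p rq
      by (simp add: ln_mult ln_powr a_def ln_u ln_b v_eq) (simp add: field_simps)
    then show ?thesis using a[of j] dyadic_pos[of j] b[of j] by (subst (asm) ln_inj_iff) simp_all
  qed
  have rhs: "(a j * besov_weight j * 2 powr (- (real j * real DIM('a) / p))) powr q = b j" for j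
  proof -
    have "ln ((a j * (\<sigma> j * dyadic h j powr (1 / p))) powr q) = ln (b j)"
      using a[of j] u[of j] dyadic_pos[of j] \<sigma>_pos[of j] r q p rq
      by (simp add: ln_mult ln_powr a_def ln_u ln_b v_eq) (simp add: field_simps)
    then have "(a j * (\<sigma> j * dyadic h j powr (1 / p))) powr q = b j"
      using a[of j] dyadic_pos[of j] \<sigma>_pos[of j] b[of j] by (subst (asm) ln_inj_iff) simp_all
    then show ?thesis by (simp only: mult.assoc besov_weight_normalised)
  qed
  obtain \<kappa> where \<kappa>: "\<kappa> \<ge> 1" "\<And>j. besov_weight (Suc j) \<le> \<kappa> * besov_weight j" by (rule besov_weight_growth) blast
  obtain K M where K: "K > 0" "M > 0" and seq: "\<forall>S a. finite S \<longrightarrow> spaced M S \<longrightarrow> (\<forall>j\<in>S. j \<ge> Suc J0) \<longrightarrow> (\<forall>j. a j > 0) \<longrightarrow>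
    (\<forall>j. a (Suc j) \<le> D * a j) \<longrightarrow> (\<Sum>j\<in>S. a j powr r * dyadic h j) powr (1 / r)
      \<le> K * (\<Sum>j\<in>S. (a j * besov_weight j * 2 powr (- (real j * real DIM('a) / p))) powr q) powr (1 / q)"
    using sequence_bound_if_bounded_trace[where \<rho> = besov_weight and \<kappa> = \<kappa>, OF \<phi> p q r D besov_weight_pos \<kappa>(2,1) \<theta> tr]
    by (elim exE conjE) (rule that)
  have sparse: "(\<Sum>j\<in>S. b j) \<le> K powr v" if S: "finite S" "spaced M S" "\<forall>j\<in>S. j \<ge> Suc J0" for S
  proof (cases "S = {}")
    case False
    define B where "B = (\<Sum>j\<in>S. b j)"
    have B: "B > 0" unfolding B_def using S(1) False b by (intro sum_pos) auto
    have "(\<Sum>j\<in>S. a j powr r * dyadic h j) powr (1 / r)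
      \<le> K * (\<Sum>j\<in>S. (a j * besov_weight j * 2 powr (- (real j * real DIM('a) / p))) powr q) powr (1 / q)"
      by (rule seq[rule_format, OF S(1,2)]) (use S(3) a grow in blast)+
    \<comment> \<open>Both sums have become \<open>B\<close>, which is finite and positive. Dividing
      leaves the exponent \<open>1 / r - 1 / q = 1 / v\<close> and hence a bound independent of
      \<open>S\<close>.\<close>
    then have "B powr (1 / r) \<le> K * B powr (1 / q)"
      unfolding lhs rhs B_def .
    then have "B powr (1 / r) * B powr (- (1 / q)) \<le> K * B powr (1 / q) * B powr (- (1 / q))"
      by (intro mult_right_mono) simp_all
    then have "B powr (1 / v) \<le> K" using B by (simp add: powr_add[symmetric] v(2) mult.assoc)
    then have "(B powr (1 / v)) powr v \<le> K powr v" using v by (intro powr_mono2) simp_all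
    then show ?thesis using B v(1) by (simp add: powr_powr B_def)
  qed (use K in simp)
  have "(\<Sum>j<n. b (j + Suc J0)) \<le> real M * K powr v" for n
  proof -
    \<comment> \<open>Sparsity is removed by splitting into residue classes modulo \<open>M\<close>:
      two different members of a class are at least \<open>M\<close> apart, and there are
      \<open>M\<close> classes.\<close>
    have "(\<Sum>j<n. b (j + Suc J0)) = (\<Sum>t\<in>{..<M}. \<Sum>j\<in>{j \<in> {..<n}. j mod M = t}. b (j + Suc J0))"
      using K(2) by (intro sum.group[symmetric]) auto
    also have "\<dots> \<le> (\<Sum>t\<in>{..<M}. K powr v)"
    proof (rule sum_mono)
      fix t
      let ?S = "{j \<in> {..<n}. j mod M = t}"
      have "(\<Sum>j\<in>?S. b (j + Suc J0)) = (\<Sum>i\<in>(\<lambda>j. j + Suc J0) ` ?S. b i)"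
        by (subst sum.reindex) (simp_all add: inj_on_def)
      also have "\<dots> \<le> K powr v"
      proof (rule sparse)
        show "spaced M ((\<lambda>j. j + Suc J0) ` ?S)"
          unfolding spaced_def
        proof (intro ballI impI)
          fix i k assume "i \<in> (\<lambda>j. j + Suc J0) ` ?S" "k \<in> (\<lambda>j. j + Suc J0) ` ?S" "i < k"
          then obtain i' k' where ik: "i = i' + Suc J0" "k = k' + Suc J0" "i' mod M = k' mod M" "i' < k'" by auto
          then have "M dvd k' - i'" using mod_eq_dvd_iff_nat[of i' k' M] by simp
          then have "M \<le> k' - i'" using ik(4) by (intro dvd_imp_le) simp_all
          then show "i + M \<le> k" using ik by simp
        qed
      qed auto
      finally show "(\<Sum>j\<in>?S. b (j + Suc J0)) \<le> K powr v" .
    qed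
    finally show ?thesis by simp
  qed
  then have "summable (\<lambda>j. b (j + Suc J0))"
    by (intro summableI_nonneg_bounded) (use b less_imp_le in auto)
  then show "summable (\<lambda>j. trace_weight r j powr v)" unfolding b_def by (rule summable_iff_shift[THEN iffD1])
qed

end

end

theorem proposition3p12:
  fixes h :: "real \<Rightarrow> real"
    and \<Gamma> :: "'a::euclidean_space set"
    and \<mu> :: "'a measure"
    and \<phi>0 :: "'a \<Rightarrow> complex"
    and \<sigma> :: "nat \<Rightarrow> real"
  assumes "resolution_generator \<phi>0"
    and "h_set h \<Gamma>"
    and "h_measure h \<Gamma> \<mu>"
    and "limsup (\<lambda>j. ereal (log 2 (dyadic h (Suc j) / dyadic h j))) < 0"
    and "admissible \<sigma>"
  shows
    "(\<forall>p q r :: real. 0 < p \<and> p \<le> r \<and> 0 < q \<and> q \<le> min r 1 \<longrightarrow>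
        (bounded_trace \<phi>0
            (\<lambda>j. \<sigma> j * dyadic h j powr (1 / p) * 2 powr (real j * real DIM('a) / p)) p q \<Gamma> \<mu> r
         \<longleftrightarrow> in_ell \<infinity> (\<lambda>j. inverse (\<sigma> j) * dyadic h j powr (1 / r - 1 / p))))
     \<and>
     (\<forall>(p :: real) (q :: real) (r :: real) (v :: ennreal).
        0 < q \<and> 0 < p \<and> p \<le> r \<and> r \<le> min q 1 \<and> 0 < v \<and> 1 / v = ennreal (1 / r - 1 / q) \<longrightarrow>
        (bounded_trace \<phi>0
            (\<lambda>j. \<sigma> j * dyadic h j powr (1 / p) * 2 powr (real j * real DIM('a) / p)) p q \<Gamma> \<mu> r
         \<longleftrightarrow> in_ell v (\<lambda>j. inverse (\<sigma> j) * dyadic h j powr (1 / r - 1 / p))))"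
proof -
  obtain c1 c2 where "c1 > 0" "c2 > 0" and balls: "\<forall>r\<in>{0<..1}. \<forall>\<gamma>\<in>\<Gamma>.
      c1 * h r \<le> measure \<mu> (cball \<gamma> r) \<and> measure \<mu> (cball \<gamma> r) \<le> c2 * h r"
    using assms(3) unfolding h_measure_def by blast
  then have "h_regular h \<Gamma> \<mu> c1 c2"
    using assms(2,3) unfolding h_regular_def h_set_def h_measure_def by auto
  then interpret h_regular h \<Gamma> \<mu> c1 c2 .
  obtain \<theta> J0 where \<theta>: "0 < \<theta>" "\<theta> < 1" "\<forall>j\<ge>J0. dyadic h (Suc j) \<le> \<theta> * dyadic h j"
    by (rule limsup_log_ratio_negative[OF assms(4) dyadic_pos])
  let ?\<rho> = "\<lambda>p j. \<sigma> j * dyadic h j powr (1 / p) * 2 powr (real j * real DIM('a) / p)"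
  let ?\<tau> = "\<lambda>p r j. inverse (\<sigma> j) * dyadic h j powr (1 / r - 1 / p)"
  have i: "bounded_trace \<phi>0 (?\<rho> p) p q \<Gamma> \<mu> r \<longleftrightarrow> bounded (range (?\<tau> p r))"
    if "0 < p" "p \<le> r" "0 < q" "q \<le> min r 1" for p q r
    using bounded_trace_iff_bounded[OF assms(5) that(1) assms(1) that(2,3,4) \<theta>]
    unfolding besov_weight_def[OF assms(5) that(1), abs_def] trace_weight_def[OF assms(5) that(1), abs_def] .
  have ii: "bounded_trace \<phi>0 (?\<rho> p) p q \<Gamma> \<mu> r \<longleftrightarrow> summable (\<lambda>j. ?\<tau> p r j powr v)"
    if "0 < p" "p \<le> r" "r < q" "r \<le> 1" "v > 0" "1 / v = 1 / r - 1 / q" for p q r v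
    using bounded_trace_iff_summable[OF assms(5) that(1) assms(1) that(2-6) \<theta>]
    unfolding besov_weight_def[OF assms(5) that(1), abs_def] trace_weight_def[OF assms(5) that(1), abs_def] .
  have \<sigma>: "\<sigma> j > 0" for j using assms(5) by (simp add: admissible_def)
  show ?thesis
  proof (intro conjI allI impI; elim conjE)
    fix p q r :: real assume "0 < p" "p \<le> r" "0 < q" "q \<le> min r 1"
    then show "bounded_trace \<phi>0 (?\<rho> p) p q \<Gamma> \<mu> r \<longleftrightarrow> in_ell \<infinity> (?\<tau> p r)"
      unfolding in_ell_def by (simp add: i)
  next
    fix p q r :: real and v :: ennreal
    assume a: "0 < q" "0 < p" "p \<le> r" "r \<le> min q 1" "0 < v" "1 / v = ennreal (1 / r - 1 / q)"
    have r: "r > 0" "r \<le> q" "r \<le> 1" using a by simp_all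
    \<comment> \<open>As the difference is nonnegative, \<open>ennreal\<close> does not truncate it
      and the equation for \<open>v\<close> keeps its meaning.\<close>
    then have d: "1 / r - 1 / q \<ge> 0" by (simp add: divide_left_mono)
    show "bounded_trace \<phi>0 (?\<rho> p) p q \<Gamma> \<mu> r \<longleftrightarrow> in_ell v (?\<tau> p r)"
    proof (cases v)
      case top
      \<comment> \<open>The reciprocal of infinity is 0, which forces \<open>q = r\<close>. Then
        \<open>q \<le> min r 1\<close>, and this endpoint is an instance of case (i).\<close>
      then have "1 / r - 1 / q = 0" using a(6) d by (simp add: ennreal_eq_0_iff)
      then have "q = r" using a(1) r by simp
      then show ?thesis using i[of p r q] a r top unfolding in_ell_def by simp
    next
      case (real w)
      then have w: "w > 0" using a(5) by simp
      have "ennreal (1 / w) = ennreal (1 / r - 1 / q)"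
        using a(6) w divide_ennreal[of 1 w] by (simp add: real)
      then have vw: "1 / w = 1 / r - 1 / q" using w d by (subst (asm) ennreal_inj) simp_all
      have "r < q" using vw w r a(1) by (cases "r = q") auto
      have "\<bar>?\<tau> p r j\<bar> = ?\<tau> p r j" for j using \<sigma>[of j] by simp
      then show ?thesis
        using ii[OF a(2,3) \<open>r < q\<close> r(3) w vw] w real unfolding in_ell_def by simp
    qed
  qed
qed

end
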